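(* Let $(M,g)$ be a smooth $n$-dimensional Riemannian manifold, let $A$ be a real constant and let $v:(0,\infty)\to\mathbf{R}$ be a smooth function such that $A>0$ and $v(t)>-\frac{A}{2\sqrt{t}}$ for all $t>0$. Let $J$ be the almost complex structure on the nonzero cotangent bundle $T^*_0M$ determined by $A$ and $v$ as defined in the context. Then $J$ is integrable if and only if the base manifold $(M,g)$ has positive constant sectional curvature $c$ and $$A=\sqrt{2c}.$$
   Context: Let $\pi:T^*M\to M$ be the cotangent bundle and $T^*_0M$ the complement of the zero section in $T^*M$. A local chart $(U,x^1,\dots,x^n)$ on $M$ induces a local chart $(\pi^{-1}(U),q^1,\dots,q^n,p_1,\dots,p_n)$ on $T^*M$, where $q^i=x^i\circ\pi$ and $p=p_i\,dx^i_{\pi(p)}$. The summation convention is used. Let $g_{ij}$ be the components of $g$, $(g^{kl})$ the inverse matrix of $(g_{ij})$, $\Gamma^k_{ij}$ the Christoffel symbols of the Levi-Civita connection of $g$, and put $g^{0i}=p_hg^{hi}$ and $\Gamma^0_{ih}=p_k\Gamma^k_{ih}$. The energy density is $t=\frac12 g^{ik}p_ip_k$; it takes values in $(0,\infty)$ on $T^*_0M$. The adapted local frame on $T^*_0M$ is $\left(\frac{\delta}{\delta q^1},\dots,\frac{\delta}{\delta q^n},\frac{\partial}{\partial p_1},\dots,\frac{\partial}{\partial p_n}\right)$ with $\frac{\delta}{\delta q^i}=\frac{\partial}{\partial q^i}+\Gamma^0_{ih}\frac{\partial}{\partial p_h}$. Define $G_{ij}=A\sqrt{t}\,g_{ij}+v(t)p_ip_j$.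 Under the conditions $A>0$, $v>-\frac{A}{2\sqrt t}$ the matrix $(G_{ij})$ is positive definite, and its inverse has entries $H^{kl}=\frac{1}{A\sqrt t}g^{kl}+w(t)g^{0k}g^{0l}$ with $w(t)=\frac{-v}{At(A+2\sqrt t\,v)}$. The almost complex structure is given by $J\frac{\delta}{\delta q^i}=G_{ik}\frac{\partial}{\partial p_k}$, $J\frac{\partial}{\partial p_i}=-H^{ik}\frac{\delta}{\delta q^k}$ (independent of the chart). Integrability of $J$ means vanishing of its Nijenhuis tensor field $N(X,Y)=[JX,JY]-J[JX,Y]-J[X,JY]-[X,Y]$. *)

theory Defs
  imports "HOL-Analysis.Analysis"
begin

section \<open>Smooth maps between Euclidean spaces\<close>

text \<open>Only meant for open \<open>S\<close>: the derivatives are taken in the full space.\<close>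

primrec C_k_on :: "nat \<Rightarrow> ('a::euclidean_space \<Rightarrow> 'b::real_normed_vector) \<Rightarrow> 'a set \<Rightarrow> bool" where
  "C_k_on 0 f S \<longleftrightarrow> continuous_on S f"
| "C_k_on (Suc k) f S \<longleftrightarrow>
     (\<forall>x\<in>S. f differentiable (at x)) \<and>
     (\<forall>u. C_k_on k (\<lambda>x. frechet_derivative f (at x) u) S)"

definition smooth_on :: "('a::euclidean_space \<Rightarrow> 'b::real_normed_vector) \<Rightarrow> 'a set \<Rightarrow> bool" where
  "smooth_on f S \<longleftrightarrow> (\<forall>k. C_k_on k f S)"

section \<open>Smooth manifolds\<close>

text \<open>A chart is a pair of a domain and a coordinate map; the values of the map outside
  the domain are irrelevant. A manifold is given by an atlas \<open>\<C>\<close>: its points are those covered by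
  the charts, and its topology is the one for which the charts are homeomorphisms.\<close>

type_synonym ('m, 'e) chart = "'m set \<times> ('m \<Rightarrow> 'e)"

definition carrier_of :: "('m, 'e) chart set \<Rightarrow> 'm set" where
  "carrier_of \<C> = (\<Union>c\<in>\<C>. fst c)"

definition charts_at :: "('m, 'e) chart set \<Rightarrow> 'm \<Rightarrow> ('m, 'e) chart set" where
  "charts_at \<C> p = {c \<in> \<C>. p \<in> fst c}"

definition chart_inv :: "('m, 'e) chart \<Rightarrow> 'e \<Rightarrow> 'm" where
  "chart_inv c = inv_into (fst c) (snd c)"

definition transition :: "('m, 'e) chart \<Rightarrow> ('m, 'e) chart \<Rightarrow> 'e \<Rightarrow> 'e" where
  "transition c d = snd d \<circ> chart_inv c"

definition smooth_atlas :: "('m, 'e::euclidean_space) chart set \<Rightarrow> bool" where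
  "smooth_atlas \<C> \<longleftrightarrow>
     (\<forall>c\<in>\<C>. inj_on (snd c) (fst c) \<and> open (snd c ` fst c)) \<and>
     (\<forall>c\<in>\<C>. \<forall>d\<in>\<C>. open (snd c ` (fst c \<inter> fst d)) \<and>
        smooth_on (transition c d) (snd c ` (fst c \<inter> fst d)))"

definition atlas_open :: "('m, 'e::euclidean_space) chart set \<Rightarrow> 'm set \<Rightarrow> bool" where
  "atlas_open \<C> W \<longleftrightarrow> W \<subseteq> carrier_of \<C> \<and> (\<forall>c\<in>\<C>. open (snd c ` (W \<inter> fst c)))"

definition atlas_topology :: "('m, 'e::euclidean_space) chart set \<Rightarrow> 'm topology" where
  "atlas_topology \<C> = topology (atlas_open \<C>)"

lemma openin_atlas_topology:
  assumes "smooth_atlas \<C>"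
  shows "openin (atlas_topology \<C>) W \<longleftrightarrow> atlas_open \<C> W"
proof -
  have inj: "inj_on (snd c) (fst c)" if "c \<in> \<C>" for c
    using assms that by (auto simp: smooth_atlas_def)
  have "istopology (atlas_open \<C>)"
    unfolding istopology_def
  proof (intro conjI allI impI)
    fix S T assume S: "atlas_open \<C> S" and T: "atlas_open \<C> T"
    have "snd c ` (S \<inter> T \<inter> fst c) = snd c ` (S \<inter> fst c) \<inter> snd c ` (T \<inter> fst c)"
      if "c \<in> \<C>" for c
    proof -
      have "S \<inter> T \<inter> fst c = (S \<inter> fst c) \<inter> (T \<inter> fst c)" by blast
      then show ?thesis using inj_on_image_Int[OF inj[OF that]] by (metis inf_le2)
    qed
    then show "atlas_open \<C> (S \<inter> T)"
      using S T by (auto simp: atlas_open_def)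
  next
    fix K assume K: "\<forall>S\<in>K. atlas_open \<C> S"
    have "snd c ` (\<Union>K \<inter> fst c) = (\<Union>S\<in>K. snd c ` (S \<inter> fst c))" for c :: "('a, 'b) chart"
      by blast
    then show "atlas_open \<C> (\<Union>K)"
      using K unfolding atlas_open_def by (metis Union_least open_UN)
  qed
  then show ?thesis by (simp add: atlas_topology_def)
qed

definition smooth_manifold :: "('m, 'e::euclidean_space) chart set \<Rightarrow> bool" where
  "smooth_manifold \<C> \<longleftrightarrow>
     smooth_atlas \<C> \<and> Hausdorff_space (atlas_topology \<C>) \<and> second_countable (atlas_topology \<C>)"

section \<open>Tangent vectors and vector fields\<close>

text \<open>A tangent vector at \<open>p\<close> is the family of its component vectors in all charts around \<open>p\<close>,
  related by the Jacobians of the coordinate changes (and \<open>0\<close> at all other charts, so that the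
  tangent space is in bijection with the model space).\<close>

type_synonym ('m, 'e) tvec = "('m, 'e) chart \<Rightarrow> 'e"

definition tangent_space ::
  "('m, 'e::euclidean_space) chart set \<Rightarrow> 'm \<Rightarrow> ('m, 'e) tvec set" where
  "tangent_space \<C> p =
     {\<xi>. (\<forall>c\<in>charts_at \<C> p. \<forall>d\<in>charts_at \<C> p.
            \<xi> d = frechet_derivative (transition c d) (at (snd c p)) (\<xi> c)) \<and>
          (\<forall>c. c \<notin> charts_at \<C> p \<longrightarrow> \<xi> c = 0)}"

definition coord_vec ::
  "('m, real^'n) chart set \<Rightarrow> ('m, real^'n) chart \<Rightarrow> 'n \<Rightarrow> 'm \<Rightarrow> ('m, real^'n) tvec" where
  "coord_vec \<C> c i p =
     (\<lambda>d. if d \<in> charts_at \<C> p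
          then frechet_derivative (transition c d) (at (snd c p)) (axis i 1) else 0)"

definition smooth_vector_field_on ::
  "('m, 'e::euclidean_space) chart set \<Rightarrow> 'm set \<Rightarrow> ('m \<Rightarrow> ('m, 'e) tvec) \<Rightarrow> bool" where
  "smooth_vector_field_on \<C> U X \<longleftrightarrow>
     (\<forall>p\<in>U. X p \<in> tangent_space \<C> p) \<and>
     (\<forall>c\<in>\<C>. smooth_on (\<lambda>z. X (chart_inv c z) c) (snd c ` (U \<inter> fst c)))"

text \<open>In coordinates, \<open>[X,Y]\<^sup>k = X\<^sup>i \<partial>\<^sub>i Y\<^sup>k - Y\<^sup>i \<partial>\<^sub>i X\<^sup>k\<close>.\<close>

definition lie_bracket ::
  "('m, 'e::euclidean_space) chart set \<Rightarrow> ('m \<Rightarrow> ('m, 'e) tvec) \<Rightarrow> ('m \<Rightarrow> ('m, 'e) tvec) \<Rightarrow>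
   'm \<Rightarrow> ('m, 'e) tvec" where
  "lie_bracket \<C> X Y p =
     (\<lambda>c. if c \<in> charts_at \<C> p
          then frechet_derivative (\<lambda>z. Y (chart_inv c z) c) (at (snd c p)) (X p c)
             - frechet_derivative (\<lambda>z. X (chart_inv c z) c) (at (snd c p)) (Y p c)
          else 0)"

definition nijenhuis ::
  "('m, 'e::euclidean_space) chart set \<Rightarrow> ('m \<Rightarrow> ('m, 'e) tvec \<Rightarrow> ('m, 'e) tvec) \<Rightarrow>
   ('m \<Rightarrow> ('m, 'e) tvec) \<Rightarrow> ('m \<Rightarrow> ('m, 'e) tvec) \<Rightarrow> 'm \<Rightarrow> ('m, 'e) tvec" where
  "nijenhuis \<C> J X Y p =
     (let JX = (\<lambda>q. J q (X q)); JY = (\<lambda>q. J q (Y q)) in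
      (\<lambda>c. lie_bracket \<C> JX JY p c - J p (lie_bracket \<C> JX Y p) c
         - J p (lie_bracket \<C> X JY p) c - lie_bracket \<C> X Y p c))"

text \<open>Vector fields on arbitrary open sets are admitted, so that the tensor can be evaluated
  directly on local frames.\<close>

definition integrable_structure ::
  "('m, 'e::euclidean_space) chart set \<Rightarrow> ('m \<Rightarrow> ('m, 'e) tvec \<Rightarrow> ('m, 'e) tvec) \<Rightarrow> bool" where
  "integrable_structure \<C> J \<longleftrightarrow>
     (\<forall>U X Y. openin (atlas_topology \<C>) U \<longrightarrow>
        smooth_vector_field_on \<C> U X \<longrightarrow> smooth_vector_field_on \<C> U Y \<longrightarrow>
        (\<forall>p\<in>U. nijenhuis \<C> J X Y p = (\<lambda>_. 0)))"

section \<open>Riemannian geometry\<close>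

type_synonym ('m, 'n) metric =
  "'m \<Rightarrow> ('m, real^'n) tvec \<Rightarrow> ('m, real^'n) tvec \<Rightarrow> real"

text \<open>In this section functions of a chart \<open>c\<close> and a coordinate vector \<open>x\<close> are coordinate
  expressions at the point \<open>chart_inv c x\<close>.\<close>

definition metric_comp ::
  "('m, real^'n) chart set \<Rightarrow> ('m, 'n) metric \<Rightarrow> ('m, real^'n) chart \<Rightarrow> real^'n \<Rightarrow> real^'n^'n" where
  "metric_comp \<C> g c x =
     (\<chi> i j. g (chart_inv c x) (coord_vec \<C> c i (chart_inv c x)) (coord_vec \<C> c j (chart_inv c x)))"

definition metric_inv_comp ::
  "('m, real^'n) chart set \<Rightarrow> ('m, 'n) metric \<Rightarrow> ('m, real^'n) chart \<Rightarrow> real^'n \<Rightarrow> real^'n^'n" where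
  "metric_inv_comp \<C> g c x = matrix_inv (metric_comp \<C> g c x)"

definition riemannian_metric :: "('m, real^'n) chart set \<Rightarrow> ('m, 'n) metric \<Rightarrow> bool" where
  "riemannian_metric \<C> g \<longleftrightarrow>
     (\<forall>p\<in>carrier_of \<C>. \<forall>\<xi>\<in>tangent_space \<C> p. \<forall>\<eta>\<in>tangent_space \<C> p.
        g p \<xi> \<eta> = g p \<eta> \<xi> \<and>
        (\<forall>\<zeta>\<in>tangent_space \<C> p. \<forall>a b.
           g p (\<lambda>c. a *\<^sub>R \<xi> c + b *\<^sub>R \<eta> c) \<zeta> = a * g p \<xi> \<zeta> + b * g p \<eta> \<zeta>) \<and>
        (\<xi> \<noteq> (\<lambda>_. 0) \<longrightarrow> g p \<xi> \<xi> > 0)) \<and>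
     (\<forall>c\<in>\<C>. smooth_on (metric_comp \<C> g c) (snd c ` fst c))"

definition partial :: "'n \<Rightarrow> (real^'n \<Rightarrow> real) \<Rightarrow> real^'n \<Rightarrow> real" where
  "partial i f x = frechet_derivative f (at x) (axis i 1)"

text \<open>\<open>christoffel \<C> g c k i j x\<close> is \<open>\<Gamma>\<^sup>k\<^sub>i\<^sub>j\<close>.\<close>

definition christoffel ::
  "('m, real^'n) chart set \<Rightarrow> ('m, 'n) metric \<Rightarrow> ('m, real^'n) chart \<Rightarrow>
   'n \<Rightarrow> 'n \<Rightarrow> 'n \<Rightarrow> real^'n \<Rightarrow> real" where
  "christoffel \<C> g c k i j x =
     (\<Sum>l\<in>UNIV. metric_inv_comp \<C> g c x $ k $ l *
        (partial i (\<lambda>y. metric_comp \<C> g c y $ j $ l) x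
         + partial j (\<lambda>y. metric_comp \<C> g c y $ i $ l) x
         - partial l (\<lambda>y. metric_comp \<C> g c y $ i $ j) x)) / 2"

text \<open>\<open>riemann_comp \<C> g c k h i j x\<close> is the \<open>k\<close>-th component of \<open>R(\<partial>\<^sub>i,\<partial>\<^sub>j)\<partial>\<^sub>h\<close>, where
  \<open>R(X,Y)Z = \<nabla>\<^sub>X\<nabla>\<^sub>YZ - \<nabla>\<^sub>Y\<nabla>\<^sub>XZ - \<nabla>\<^bsub>[X,Y]\<^esub>Z\<close>.\<close>

definition riemann_comp ::
  "('m, real^'n) chart set \<Rightarrow> ('m, 'n) metric \<Rightarrow> ('m, real^'n) chart \<Rightarrow>
   'n \<Rightarrow> 'n \<Rightarrow> 'n \<Rightarrow> 'n \<Rightarrow> real^'n \<Rightarrow> real" where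
  "riemann_comp \<C> g c k h i j x =
     partial i (christoffel \<C> g c k j h) x - partial j (christoffel \<C> g c k i h) x
     + (\<Sum>l\<in>UNIV. christoffel \<C> g c k i l x * christoffel \<C> g c l j h x
                - christoffel \<C> g c k j l x * christoffel \<C> g c l i h x)"

definition riemann ::
  "('m, real^'n) chart set \<Rightarrow> ('m, 'n) metric \<Rightarrow> 'm \<Rightarrow>
   ('m, real^'n) tvec \<Rightarrow> ('m, real^'n) tvec \<Rightarrow> ('m, real^'n) tvec \<Rightarrow> ('m, real^'n) tvec" where
  "riemann \<C> g p \<xi> \<eta> \<zeta> =
     (\<lambda>c. if c \<in> charts_at \<C> p
          then (\<chi> k. \<Sum>h\<in>UNIV. \<Sum>i\<in>UNIV. \<Sum>j\<in>UNIV.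
                  riemann_comp \<C> g c k h i j (snd c p) * \<xi> c $ i * \<eta> c $ j * \<zeta> c $ h)
          else 0)"

definition sectional_curvature ::
  "('m, real^'n) chart set \<Rightarrow> ('m, 'n) metric \<Rightarrow> 'm \<Rightarrow>
   ('m, real^'n) tvec \<Rightarrow> ('m, real^'n) tvec \<Rightarrow> real" where
  "sectional_curvature \<C> g p \<xi> \<eta> =
     g p (riemann \<C> g p \<xi> \<eta> \<eta>) \<xi> / (g p \<xi> \<xi> * g p \<eta> \<eta> - (g p \<xi> \<eta>)\<^sup>2)"

definition lin_indep2 :: "('m, real^'n) tvec \<Rightarrow> ('m, real^'n) tvec \<Rightarrow> bool" where
  "lin_indep2 \<xi> \<eta> \<longleftrightarrow> (\<forall>a b. (\<lambda>c. a *\<^sub>R \<xi> c + b *\<^sub>R \<eta> c) = (\<lambda>_. 0) \<longrightarrow> a = 0 \<and> b = 0)"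

definition constant_sectional_curvature ::
  "('m, real^'n) chart set \<Rightarrow> ('m, 'n) metric \<Rightarrow> real \<Rightarrow> bool" where
  "constant_sectional_curvature \<C> g \<kappa> \<longleftrightarrow>
     (\<forall>p\<in>carrier_of \<C>. \<forall>\<xi>\<in>tangent_space \<C> p. \<forall>\<eta>\<in>tangent_space \<C> p.
        lin_indep2 \<xi> \<eta> \<longrightarrow> sectional_curvature \<C> g p \<xi> \<eta> = \<kappa>)"

section \<open>The nonzero cotangent bundle\<close>

text \<open>Covectors are linear functionals on the tangent space, extended by \<open>0\<close>.\<close>

definition cotangent_space ::
  "('m, 'e::euclidean_space) chart set \<Rightarrow> 'm \<Rightarrow> (('m, 'e) tvec \<Rightarrow> real) set" where
  "cotangent_space \<C> p =
     {\<omega>. (\<forall>\<xi>\<in>tangent_space \<C> p. \<forall>\<eta>\<in>tangent_space \<C> p. \<forall>a b.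
            \<omega> (\<lambda>c. a *\<^sub>R \<xi> c + b *\<^sub>R \<eta> c) = a * \<omega> \<xi> + b * \<omega> \<eta>) \<and>
          (\<forall>\<xi>. \<xi> \<notin> tangent_space \<C> p \<longrightarrow> \<omega> \<xi> = 0)}"

type_synonym ('m, 'n) cot = "'m \<times> (('m, real^'n) tvec \<Rightarrow> real)"

definition cotangent_bundle0 :: "('m, real^'n) chart set \<Rightarrow> ('m, 'n) cot set" where
  "cotangent_bundle0 \<C> =
     {(p, \<omega>). p \<in> carrier_of \<C> \<and> \<omega> \<in> cotangent_space \<C> p \<and> \<omega> \<noteq> (\<lambda>_. 0)}"

definition induced_chart ::
  "('m, real^'n) chart set \<Rightarrow> ('m, real^'n) chart \<Rightarrow> (('m, 'n) cot, (real^'n) \<times> (real^'n)) chart" where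
  "induced_chart \<C> c =
     ({P \<in> cotangent_bundle0 \<C>. fst P \<in> fst c},
      (\<lambda>(p, \<omega>). (snd c p, \<chi> i. \<omega> (coord_vec \<C> c i p))))"

definition cotangent_atlas0 ::
  "('m, real^'n) chart set \<Rightarrow> (('m, 'n) cot, (real^'n) \<times> (real^'n)) chart set" where
  "cotangent_atlas0 \<C> = induced_chart \<C> ` \<C>"

section \<open>The almost complex structure\<close>

text \<open>The following are coordinate expressions at the point of the cotangent bundle with induced
  coordinates \<open>(q, p)\<close>. The pair \<open>(a, b)\<close> stands for the tangent vector
  \<open>a\<^sup>i \<partial>/\<partial>q\<^sup>i + b\<^sub>i \<partial>/\<partial>p\<^sub>i\<close>.\<close>

definition energy ::
  "('m, real^'n) chart set \<Rightarrow> ('m, 'n) metric \<Rightarrow> ('m, real^'n) chart \<Rightarrow>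
   (real^'n) \<times> (real^'n) \<Rightarrow> real" where
  "energy \<C> g c = (\<lambda>(q, p).
     (\<Sum>i\<in>UNIV. \<Sum>k\<in>UNIV. metric_inv_comp \<C> g c q $ i $ k * p $ i * p $ k) / 2)"

definition g0_comp ::
  "('m, real^'n) chart set \<Rightarrow> ('m, 'n) metric \<Rightarrow> ('m, real^'n) chart \<Rightarrow>
   (real^'n) \<times> (real^'n) \<Rightarrow> 'n \<Rightarrow> real" where
  "g0_comp \<C> g c = (\<lambda>(q, p) i. \<Sum>h\<in>UNIV. p $ h * metric_inv_comp \<C> g c q $ h $ i)"

definition christoffel0 ::
  "('m, real^'n) chart set \<Rightarrow> ('m, 'n) metric \<Rightarrow> ('m, real^'n) chart \<Rightarrow>
   (real^'n) \<times> (real^'n) \<Rightarrow> 'n \<Rightarrow> 'n \<Rightarrow> real" where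
  "christoffel0 \<C> g c = (\<lambda>(q, p) i h. \<Sum>k\<in>UNIV. p $ k * christoffel \<C> g c k i h q)"

definition vert_frame :: "'n \<Rightarrow> (real^'n) \<times> (real^'n)" where
  "vert_frame i = (0, axis i 1)"

definition horiz_frame ::
  "('m, real^'n) chart set \<Rightarrow> ('m, 'n) metric \<Rightarrow> ('m, real^'n) chart \<Rightarrow>
   (real^'n) \<times> (real^'n) \<Rightarrow> 'n \<Rightarrow> (real^'n) \<times> (real^'n)" where
  "horiz_frame \<C> g c z i =
     (axis i 1, 0) + (\<Sum>h\<in>UNIV. christoffel0 \<C> g c z i h *\<^sub>R vert_frame h)"

definition G_comp ::
  "('m, real^'n) chart set \<Rightarrow> ('m, 'n) metric \<Rightarrow> real \<Rightarrow> (real \<Rightarrow> real) \<Rightarrow> ('m, real^'n) chart \<Rightarrow>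
   (real^'n) \<times> (real^'n) \<Rightarrow> 'n \<Rightarrow> 'n \<Rightarrow> real" where
  "G_comp \<C> g A v c z i j =
     (let t = energy \<C> g c z in
      A * sqrt t * metric_comp \<C> g c (fst z) $ i $ j + v t * snd z $ i * snd z $ j)"

definition H_comp ::
  "('m, real^'n) chart set \<Rightarrow> ('m, 'n) metric \<Rightarrow> real \<Rightarrow> (real \<Rightarrow> real) \<Rightarrow> ('m, real^'n) chart \<Rightarrow>
   (real^'n) \<times> (real^'n) \<Rightarrow> 'n \<Rightarrow> 'n \<Rightarrow> real" where
  "H_comp \<C> g A v c z k l =
     (let t = energy \<C> g c z; w = - v t / (A * t * (A + 2 * sqrt t * v t)) in
      metric_inv_comp \<C> g c (fst z) $ k $ l / (A * sqrt t)
      + w * g0_comp \<C> g c z k * g0_comp \<C> g c z l)"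

text \<open>Since \<open>\<partial>/\<partial>q\<^sup>i = \<delta>/\<delta>q\<^sup>i - \<Gamma>\<^sup>0\<^sub>i\<^sub>h \<partial>/\<partial>p\<^sub>h\<close>, the vector \<open>(a, b)\<close> has the horizontal components
  \<open>a\<^sup>i\<close> and the vertical components \<open>b\<^sub>h - a\<^sup>i \<Gamma>\<^sup>0\<^sub>i\<^sub>h\<close> in the adapted frame.\<close>

definition J_comp ::
  "('m, real^'n) chart set \<Rightarrow> ('m, 'n) metric \<Rightarrow> real \<Rightarrow> (real \<Rightarrow> real) \<Rightarrow> ('m, real^'n) chart \<Rightarrow>
   (real^'n) \<times> (real^'n) \<Rightarrow> (real^'n) \<times> (real^'n) \<Rightarrow> (real^'n) \<times> (real^'n)" where
  "J_comp \<C> g A v c z = (\<lambda>(a, b).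
     (\<Sum>i\<in>UNIV. a $ i *\<^sub>R (\<Sum>k\<in>UNIV. G_comp \<C> g A v c z i k *\<^sub>R vert_frame k)) +
     (\<Sum>i\<in>UNIV. (b $ i - (\<Sum>j\<in>UNIV. a $ j * christoffel0 \<C> g c z j i)) *\<^sub>R
        (- (\<Sum>k\<in>UNIV. H_comp \<C> g A v c z i k *\<^sub>R horiz_frame \<C> g c z k))))"

lemma J_comp_horiz_frame:
  "J_comp \<C> g A v c z (horiz_frame \<C> g c z i) =
     (\<Sum>k\<in>UNIV. G_comp \<C> g A v c z i k *\<^sub>R vert_frame k)"
proof -
  have h: "horiz_frame \<C> g c z i = (axis i 1, \<chi> h. christoffel0 \<C> g c z i h)"
    by (simp add: horiz_frame_def vert_frame_def prod_eq_iff fst_sum snd_sum vec_eq_iff axis_def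
        if_distrib cong: if_cong)
  show ?thesis
    unfolding h J_comp_def
    by (simp add: axis_def if_distrib[where f = "\<lambda>x. x *\<^sub>R _"] if_distrib[where f = "\<lambda>x. x * _"]
        cong: if_cong)
qed

lemma J_comp_vert_frame:
  "J_comp \<C> g A v c z (vert_frame i) =
     - (\<Sum>k\<in>UNIV. H_comp \<C> g A v c z i k *\<^sub>R horiz_frame \<C> g c z k)"
  unfolding J_comp_def vert_frame_def
  by (simp add: axis_def if_distrib[where f = "\<lambda>x. x *\<^sub>R _"] sum_negf cong: if_cong)

text \<open>An induced chart determines the base chart it comes from, so \<open>inv_into\<close> recovers it.\<close>

definition J_structure ::
  "('m, real^'n) chart set \<Rightarrow> ('m, 'n) metric \<Rightarrow> real \<Rightarrow> (real \<Rightarrow> real) \<Rightarrow> ('m, 'n) cot \<Rightarrow>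
   (('m, 'n) cot, (real^'n) \<times> (real^'n)) tvec \<Rightarrow> (('m, 'n) cot, (real^'n) \<times> (real^'n)) tvec" where
  "J_structure \<C> g A v P \<xi> =
     (\<lambda>C. if C \<in> charts_at (cotangent_atlas0 \<C>) P
          then J_comp \<C> g A v (inv_into \<C> (induced_chart \<C>) C) (snd C P) (\<xi> C)
          else 0)"

end

theory Submission
  imports Defs
begin

text \<open>The Nijenhuis bracket of two fields at a point depends only on the values of the fields there, and
it satisfies \<open>N (J X) Y = - J (N X Y)\<close>. Since \<open>J\<close> interchanges vertical and horizontal vectors,
\<open>J\<close> is integrable as soon as \<open>N\<close> vanishes on pairs of vertical vectors
(\<open>field_nijenhuis\<close>, \<open>nijenhuis_zero_iff\<close>).

In an induced chart a point is a pair \<open>(x, p)\<close>. Write \<open>G\<close> for the operator with matrix \<open>G\<^sub>i\<^sub>j\<close>, \<open>H\<close> for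
its inverse, \<open>K a\<close> for the covector \<open>a\<^sup>i \<Gamma>\<^sup>0\<^sub>i\<^sub>h\<close>, so that \<open>(a, K a)\<close> is the horizontal lift of \<open>a\<close>. Then \<open>N\<close>,
applied to the vertical vectors \<open>G a\<close> and \<open>G b\<close>, splits into two parts (\<open>nijenhuis_vertical\<close>). The first
one compares the derivatives of \<open>G\<close> in horizontal directions with \<open>K\<close>; it vanishes because the Levi-Civita
connection is metric and torsion free and because the energy is constant in horizontal directions
(\<open>torsion_part_zero\<close>). The second one is the derivative of \<open>K\<close> in horizontal directions, which
gives the covector \<open>p \<circ> R(a, b)\<close>, plus derivatives of \<open>G\<close> in vertical directions. For
\<open>G\<^sub>i\<^sub>j = u(t) g\<^sub>i\<^sub>j + v(t) p\<^sub>i p\<^sub>j\<close> the latter amount to minus the multiple \<open>u u' + v (2 t u' - u)\<close> of the tensor of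
constant curvature \<open>1\<close> contracted with \<open>p\<close>. For \<open>u = A \<surd>t\<close> the factor \<open>2 t u' - u\<close> is zero and
\<open>u u' = A\<^sup>2 / 2\<close>, so that \<open>v\<close> disappears (\<open>curvature_part_eq\<close>). As \<open>p\<close> ranges over all nonzero
covectors, \<open>J\<close> is integrable if and only if \<open>R(a, b) e = (A\<^sup>2 / 2) (g(b, e) a - g(a, e) b)\<close>
(\<open>integrable_iff_constant_curvature_form\<close>).

It remains to compare this with constancy of the sectional curvature
(\<open>constant_curvature_form_iff\<close>). From the sectional curvature one recovers the curvature
tensor by its algebraic symmetries. The sectional curvature evaluates the metric on \<open>R(\<xi>, \<eta>) \<eta>\<close>,
which has to be a tangent vector, that is, a family of components that transforms correctly between charts. So
the transformation laws of the Christoffel symbols and of the curvature enter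
(\<open>christoffel_change\<close>, \<open>curvature_change\<close>).

For the step from integrability to curvature, test fields are required that are smooth in all
induced charts. The fields with constant vertical components in one chart will do, because
coordinate changes are linear in the momenta (\<open>smooth_vertical_field\<close>).\<close>

section \<open>Derivatives and smooth maps\<close>

abbreviation dd :: "('a::real_normed_vector \<Rightarrow> 'b::real_normed_vector) \<Rightarrow> 'a \<Rightarrow> 'a \<Rightarrow> 'b" where
  "dd f x \<equiv> frechet_derivative f (at x)"

lemma dd_eqI: "(f has_derivative f') (at x) \<Longrightarrow> dd f x = f'"
  by (metis frechet_derivative_at)

lemma dd_works: "f differentiable (at x) \<Longrightarrow> (f has_derivative dd f x) (at x)"
  by (simp add: frechet_derivative_works)

lemma linear_dd: "f differentiable (at x) \<Longrightarrow> linear (dd f x)"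
  by (rule linear_frechet_derivative)

text \<open>Functions that agree near \<open>x\<close> have the same derivatives there, and \<^const>\<open>frechet_derivative\<close>
selects among these, even if there are none.\<close>

lemma dd_cong:
  assumes "open S" "x \<in> S" "\<And>y. y \<in> S \<Longrightarrow> f y = h y"
  shows "dd f x = dd h x"
proof -
  have "(f has_derivative f') (at x) \<longleftrightarrow> (h has_derivative f') (at x)" for f'
    using has_derivative_transform_within_open[OF _ assms(1,2)] assms(3) by metis
  then show ?thesis by (simp add: frechet_derivative_def)
qed

lemma differentiable_cong_open:
  assumes "open S" "x \<in> S" "\<And>y. y \<in> S \<Longrightarrow> f y = h y" "f differentiable (at x)"
  shows "h differentiable (at x)"
  using assms has_derivative_transform_within_open unfolding differentiable_def by metis

lemma dd_chain:
  assumes "f differentiable (at x)" "h differentiable (at (f x))"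
  shows "(\<lambda>y. h (f y)) differentiable (at x)" "dd (\<lambda>y. h (f y)) x u = dd h (f x) (dd f x u)"
proof -
  have "((\<lambda>y. h (f y)) has_derivative (\<lambda>u. dd h (f x) (dd f x u))) (at x)"
    using has_derivative_compose[OF dd_works[OF assms(1)]] dd_works[OF assms(2)] by blast
  then show "(\<lambda>y. h (f y)) differentiable (at x)" "dd (\<lambda>y. h (f y)) x u = dd h (f x) (dd f x u)"
    by (auto intro: differentiableI simp: dd_eqI)
qed

lemma dd_linear_comp:
  assumes "f differentiable (at x)" "bounded_linear L"
  shows "(\<lambda>y. L (f y)) differentiable (at x)" "dd (\<lambda>y. L (f y)) x u = L (dd f x u)"
proof -
  have "((\<lambda>y. L (f y)) has_derivative (\<lambda>u. L (dd f x u))) (at x)"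
    using bounded_linear.has_derivative[OF assms(2) dd_works[OF assms(1)]] .
  then show "(\<lambda>y. L (f y)) differentiable (at x)" "dd (\<lambda>y. L (f y)) x u = L (dd f x u)"
    by (auto intro: differentiableI simp: dd_eqI)
qed

lemma dd_inner_left:
  assumes "f differentiable (at x)"
  shows "(\<lambda>y. f y \<bullet> b) differentiable (at x)" "dd (\<lambda>y. f y \<bullet> b) x u = dd f x u \<bullet> b"
  using dd_linear_comp[OF assms bounded_linear_inner_left[of b]] by auto

lemma dd_inner_right:
  assumes "f differentiable (at x)"
  shows "(\<lambda>y. b \<bullet> f y) differentiable (at x)" "dd (\<lambda>y. b \<bullet> f y) x u = b \<bullet> dd f x u"
  using dd_linear_comp[OF assms bounded_linear_inner_right[of b]] by auto

lemma differentiable_vec_lambda: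
  fixes f :: "'i::finite \<Rightarrow> 'a::real_normed_vector \<Rightarrow> real"
  assumes "\<And>i. f i differentiable (at x)"
  shows "(\<lambda>y. \<chi> i. f i y) differentiable (at x)"
proof -
  have "(\<lambda>y. \<Sum>i\<in>UNIV. f i y *\<^sub>R axis i 1 :: real^'i) differentiable (at x)"
    using assms by (intro differentiable_sum ballI differentiable_scaleR differentiable_const) auto
  moreover have "(\<lambda>y. \<Sum>i\<in>UNIV. f i y *\<^sub>R axis i 1 :: real^'i) = (\<lambda>y. \<chi> i. f i y)"
    by (simp add: fun_eq_iff vec_eq_iff axis_def if_distrib cong: if_cong)
  ultimately show ?thesis by simp
qed

lemma nth_differentiable:
  fixes f :: "'a::real_normed_vector \<Rightarrow> real^'k"
  shows "f differentiable (at x) \<Longrightarrow> (\<lambda>y. f y $ i) differentiable (at x)"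
  using dd_linear_comp(1)[OF _ bounded_linear_vec_nth] .

lemma fst_chain:
  assumes "f differentiable (at (fst z))"
  shows "(\<lambda>y. f (fst y)) differentiable (at z)" "dd (\<lambda>y. f (fst y)) z w = dd f (fst z) (fst w)"
proof -
  have "((\<lambda>y. f (fst y)) has_derivative (\<lambda>w. dd f (fst z) (fst w))) (at z)"
    using has_derivative_compose[OF bounded_linear_imp_has_derivative[OF bounded_linear_fst]] dd_works[OF assms]
    by blast
  then show "(\<lambda>y. f (fst y)) differentiable (at z)" "dd (\<lambda>y. f (fst y)) z w = dd f (fst z) (fst w)"
    by (auto intro: differentiableI simp: dd_eqI)
qed

lemma snd_differentiable: "snd differentiable (at z)"
  by (simp add: bounded_linear_snd bounded_linear_imp_differentiable)

lemma snd_has_derivative: "(snd has_derivative snd) (at z)"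
  by (rule bounded_linear_imp_has_derivative[OF bounded_linear_snd])

lemma C_k_on_cong:
  assumes "open S" "\<And>x. x \<in> S \<Longrightarrow> f x = h x" "C_k_on k f S"
  shows "C_k_on k h S"
  using assms(2,3)
proof (induction k arbitrary: f h)
  case 0
  then show ?case by (simp cong: continuous_on_cong)
next
  case (Suc k)
  have "C_k_on k (\<lambda>x. dd h x u) S" for u
  proof (rule Suc.IH[of "\<lambda>x. dd f x u"])
    show "dd f x u = dd h x u" if "x \<in> S" for x
      using dd_cong[OF assms(1) that] Suc.prems(1) by metis
  qed (use Suc.prems in auto)
  moreover have "h differentiable (at x)" if "x \<in> S" for x
    using differentiable_cong_open[OF assms(1) that] Suc.prems that by auto
  ultimately show ?case by simp
qed

lemma C_k_on_add:
  assumes "open S" "C_k_on k f S" "C_k_on k h S"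
  shows "C_k_on k (\<lambda>x. f x + h x) S"
  using assms(2,3)
proof (induction k arbitrary: f h)
  case 0
  then show ?case by (simp add: continuous_on_add)
next
  case (Suc k)
  have D: "((\<lambda>x. f x + h x) has_derivative (\<lambda>u. dd f x u + dd h x u)) (at x)" if "x \<in> S" for x
    using Suc.prems that by (auto intro!: has_derivative_add dd_works)
  have "C_k_on k (\<lambda>x. dd (\<lambda>x. f x + h x) x u) S" for u
  proof (rule C_k_on_cong[OF assms(1)])
    show "C_k_on k (\<lambda>x. dd f x u + dd h x u) S"
      by (rule Suc.IH) (use Suc.prems in simp_all)
    show "dd f x u + dd h x u = dd (\<lambda>x. f x + h x) x u" if "x \<in> S" for x
      using dd_eqI[OF D[OF that]] by simp
  qed
  then show ?case using D by (auto intro: differentiableI)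
qed

lemma C_k_on_const: "C_k_on k (\<lambda>x. a) S"
  by (induction k arbitrary: a) auto

lemma C_k_on_sum:
  assumes "open S" "finite I" "\<And>i. i \<in> I \<Longrightarrow> C_k_on k (f i) S"
  shows "C_k_on k (\<lambda>x. \<Sum>i\<in>I. f i x) S"
  using assms(2,3)
  by (induction I rule: finite_induct) (auto intro: C_k_on_add[OF assms(1)] C_k_on_const)

text \<open>Linear changes on both sides keep the class of functions stable under differentiation: the
derivative of \<open>L \<circ> f \<circ> l\<close> in the direction \<open>u\<close> arises in the same way from the derivative of \<open>f\<close> in
the direction \<open>l u\<close>, so the induction on the order closes.\<close>

lemma C_k_on_linear_comp:
  assumes "open S" "open T" "bounded_linear L" "bounded_linear l" "l ` T \<subseteq> S" "C_k_on k f S"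
  shows "C_k_on k (\<lambda>x. L (f (l x))) T"
  using assms(6)
proof (induction k arbitrary: f)
  case 0
  have "continuous_on T (\<lambda>x. f (l x))"
    using continuous_on_compose2[OF _ linear_continuous_on[OF assms(4)] assms(5)] 0 by simp
  then show ?case
    using bounded_linear.continuous_on[OF assms(3)] by simp
next
  case (Suc k)
  have *: "((\<lambda>x. L (f (l x))) has_derivative (\<lambda>u. L (dd f (l x) (l u)))) (at x)" if "x \<in> T" for x
  proof -
    have "(f has_derivative dd f (l x)) (at (l x))"
      using Suc.prems that assms(5) by (auto intro!: dd_works)
    then show ?thesis
      using bounded_linear.has_derivative[OF assms(3)]
        has_derivative_compose[OF bounded_linear_imp_has_derivative[OF assms(4)]] by blast
  qed
  have "C_k_on k (\<lambda>x. dd (\<lambda>x. L (f (l x))) x u) T" for u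
  proof (rule C_k_on_cong[OF assms(2)])
    show "C_k_on k (\<lambda>x. L (dd f (l x) (l u))) T"
      using Suc.IH[of "\<lambda>y. dd f y (l u)"] Suc.prems by simp
    show "L (dd f (l x) (l u)) = dd (\<lambda>x. L (f (l x))) x u" if "x \<in> T" for x
      using dd_eqI[OF *[OF that]] by simp
  qed
  then show ?case using * by (auto intro: differentiableI)
qed

lemma smooth_on_linear_comp:
  assumes "open S" "open T" "bounded_linear L" "bounded_linear l" "l ` T \<subseteq> S" "smooth_on f S"
  shows "smooth_on (\<lambda>x. L (f (l x))) T"
  using C_k_on_linear_comp[OF assms(1-5)] assms(6) by (auto simp: smooth_on_def)

lemma smooth_on_cong:
  assumes "open S" "\<And>x. x \<in> S \<Longrightarrow> f x = h x" "smooth_on f S"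
  shows "smooth_on h S"
  using C_k_on_cong[OF assms(1,2)] assms(3) by (auto simp: smooth_on_def)

lemma smooth_on_differentiable: "smooth_on f S \<Longrightarrow> x \<in> S \<Longrightarrow> f differentiable (at x)"
  unfolding smooth_on_def by (metis C_k_on.simps(2))

lemma smooth_on_dd: "smooth_on f S \<Longrightarrow> smooth_on (\<lambda>x. dd f x u) S"
  unfolding smooth_on_def by (metis C_k_on.simps(2))

section \<open>Product rules for families of linear maps\<close>

text \<open>In finite dimension a family of linear maps is differentiable as soon as its values on each fixed
vector are; expanding \<open>X y\<close> in an orthonormal basis reduces the rule to products with scalar
functions. The family may consist of derivatives \<open>dd f y\<close>, which are linear only where \<open>f\<close> is
differentiable; hence the restriction to \<open>S\<close>.\<close>

lemma has_derivative_linear_family_on: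
  fixes J :: "'z::euclidean_space \<Rightarrow> 'a::euclidean_space \<Rightarrow> 'b::real_normed_vector"
  assumes S: "open S" "x \<in> S" and lin: "\<And>y. y \<in> S \<Longrightarrow> linear (J y)"
    and J: "\<And>u. (\<lambda>y. J y u) differentiable (at x)" and X: "(X has_derivative X') (at x)"
  shows "((\<lambda>y. J y (X y)) has_derivative (\<lambda>w. dd (\<lambda>y. J y (X x)) x w + J x (X' w))) (at x)"
proof -
  have expand: "J y u = (\<Sum>e\<in>Basis. (u \<bullet> e) *\<^sub>R J y e)" if "y \<in> S" for y u
    by (subst euclidean_representation[of u, symmetric],
        simp only: linear_sum[OF lin[OF that]] linear_scale[OF lin[OF that]])
  have "((\<lambda>y. \<Sum>e\<in>Basis. (X y \<bullet> e) *\<^sub>R J y e) has_derivative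
     (\<lambda>w. \<Sum>e\<in>Basis. (X x \<bullet> e) *\<^sub>R dd (\<lambda>y. J y e) x w + (X' w \<bullet> e) *\<^sub>R J x e)) (at x)"
    by (intro has_derivative_sum has_derivative_scaleR has_derivative_inner_left X dd_works J)
  then have "((\<lambda>y. J y (X y)) has_derivative
     (\<lambda>w. \<Sum>e\<in>Basis. (X x \<bullet> e) *\<^sub>R dd (\<lambda>y. J y e) x w + (X' w \<bullet> e) *\<^sub>R J x e)) (at x)"
    by (rule has_derivative_transform_within_open[OF _ S]) (rule expand[symmetric])
  moreover have "dd (\<lambda>y. J y (X x)) x = (\<lambda>w. \<Sum>e\<in>Basis. (X x \<bullet> e) *\<^sub>R dd (\<lambda>y. J y e) x w)"
  proof -
    have "dd (\<lambda>y. J y (X x)) x = dd (\<lambda>y. \<Sum>e\<in>Basis. (X x \<bullet> e) *\<^sub>R J y e) x"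
      by (rule dd_cong[OF S]) (rule expand)
    also have "\<dots> = (\<lambda>w. \<Sum>e\<in>Basis. (X x \<bullet> e) *\<^sub>R dd (\<lambda>y. J y e) x w)"
      by (intro dd_eqI has_derivative_sum has_derivative_scaleR_right dd_works J)
    finally show ?thesis .
  qed
  moreover have "(\<lambda>w. J x (X' w)) = (\<lambda>w. \<Sum>e\<in>Basis. (X' w \<bullet> e) *\<^sub>R J x e)"
    by (rule ext) (rule expand[OF S(2)])
  ultimately show ?thesis by (simp add: sum.distrib fun_eq_iff)
qed

lemmas has_derivative_linear_family = has_derivative_linear_family_on[OF open_UNIV UNIV_I]

lemma linear_dd_family:
  fixes J :: "'z::euclidean_space \<Rightarrow> 'a::euclidean_space \<Rightarrow> 'b::real_normed_vector"
  assumes lin: "\<And>y. linear (J y)" and J: "\<And>u. (\<lambda>y. J y u) differentiable (at x)"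
  shows "linear (\<lambda>u. dd (\<lambda>y. J y u) x w)"
proof (rule linearI)
  show "dd (\<lambda>y. J y (u + u')) x w = dd (\<lambda>y. J y u) x w + dd (\<lambda>y. J y u') x w" for u u'
    by (subst linear_add[OF lin]) (rule fun_cong[OF dd_eqI], intro has_derivative_add dd_works J)
  show "dd (\<lambda>y. J y (r *\<^sub>R u)) x w = r *\<^sub>R dd (\<lambda>y. J y u) x w" for r u
    by (subst linear_scale[OF lin]) (rule fun_cong[OF dd_eqI], intro has_derivative_scaleR_right dd_works J)
qed

lemma has_derivative_bilinear_family:
  fixes B :: "'z::euclidean_space \<Rightarrow> 'a::euclidean_space \<Rightarrow> 'b::euclidean_space \<Rightarrow> 'c::real_normed_vector"
  assumes l1: "\<And>y b. linear (\<lambda>a. B y a b)" and l2: "\<And>y a. linear (B y a)"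
    and B: "\<And>a b. (\<lambda>y. B y a b) differentiable (at x)"
    and X: "(X has_derivative X') (at x)" and Y: "(Y has_derivative Y') (at x)"
  shows "((\<lambda>y. B y (X y) (Y y)) has_derivative
    (\<lambda>w. dd (\<lambda>y. B y (X x) (Y x)) x w + B x (X' w) (Y x) + B x (X x) (Y' w))) (at x)"
proof -
  have 1: "((\<lambda>y. B y (X y) b) has_derivative (\<lambda>w. dd (\<lambda>y. B y (X x) b) x w + B x (X' w) b)) (at x)" for b
    by (rule has_derivative_linear_family[where J = "\<lambda>y a. B y a b", OF l1 B X])
  have "((\<lambda>y. B y (X y) (Y y)) has_derivative
    (\<lambda>w. dd (\<lambda>y. B y (X y) (Y x)) x w + B x (X x) (Y' w))) (at x)"
    by (rule has_derivative_linear_family[where J = "\<lambda>y. B y (X y)", OF l2 _ Y])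
       (use 1 in \<open>blast intro: differentiableI\<close>)
  then show ?thesis by (simp add: dd_eqI[OF 1])
qed

section \<open>Symmetry of second derivatives\<close>

text \<open>The second difference over a parallelogram is a difference in the direction \<open>u\<close> of the function
\<open>y \<mapsto> f (y + h v) - f y\<close>. The mean value theorem turns it into a difference of \<open>D\<^sub>u f\<close> in the direction
\<open>v\<close>, and a second application into a value of \<open>D\<^sub>v D\<^sub>u f\<close>.\<close>

lemma mixed_difference_mvt:
  fixes f :: "'a::euclidean_space \<Rightarrow> real"
  assumes f: "\<And>y. y \<in> ball x r \<Longrightarrow> f differentiable (at y)"
    and df: "\<And>y. y \<in> ball x r \<Longrightarrow> (\<lambda>y. dd f y u) differentiable (at y)"
    and h: "0 < h" "h * (norm u + norm v) < r"
  obtains y where "y \<in> ball x r"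
    "f (x + h *\<^sub>R u + h *\<^sub>R v) - f (x + h *\<^sub>R u) - f (x + h *\<^sub>R v) + f x = h * (h * dd (\<lambda>y. dd f y u) y v)"
proof -
  have in_ball: "x + s *\<^sub>R u + t *\<^sub>R v \<in> ball x r" if "0 \<le> s" "s \<le> h" "0 \<le> t" "t \<le> h" for s t
  proof -
    have "norm (s *\<^sub>R u + t *\<^sub>R v) \<le> s * norm u + t * norm v"
      using norm_triangle_ineq[of "s *\<^sub>R u" "t *\<^sub>R v"] that by simp
    also have "\<dots> \<le> h * norm u + h * norm v"
      using that by (intro add_mono mult_right_mono) auto
    finally show ?thesis using h(2)
      using norm_minus_cancel[of "s *\<^sub>R u + t *\<^sub>R v"] by (simp add: dist_norm algebra_simps)
  qed
  have d1: "((\<lambda>s. f (x + s *\<^sub>R u + t *\<^sub>R v)) has_real_derivative dd f (x + s *\<^sub>R u + t *\<^sub>R v) u) (at s)"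
    if "0 \<le> s" "s \<le> h" "0 \<le> t" "t \<le> h" for s t
  proof -
    have "((\<lambda>s. f (x + s *\<^sub>R u + t *\<^sub>R v)) has_derivative
        (\<lambda>k. dd f (x + s *\<^sub>R u + t *\<^sub>R v) (k *\<^sub>R u))) (at s)"
      by (rule has_derivative_compose[of "\<lambda>s. x + s *\<^sub>R u + t *\<^sub>R v"])
         (auto intro!: derivative_eq_intros dd_works f in_ball that)
    then show ?thesis
      by (simp add: has_field_derivative_def linear_scale[OF linear_dd[OF f[OF in_ball[OF that]]]]
          mult.commute[of _ "dd f _ _"] fun_eq_iff mult_commute_abs)
  qed
  have "\<exists>s>0. s < h \<and>
     (f (x + h *\<^sub>R u + h *\<^sub>R v) - f (x + h *\<^sub>R u + 0 *\<^sub>R v)) - (f (x + 0 *\<^sub>R u + h *\<^sub>R v) - f (x + 0 *\<^sub>R u + 0 *\<^sub>R v))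
     = (h - 0) * (dd f (x + s *\<^sub>R u + h *\<^sub>R v) u - dd f (x + s *\<^sub>R u + 0 *\<^sub>R v) u)"
    by (rule MVT2[OF h(1), of "\<lambda>s. f (x + s *\<^sub>R u + h *\<^sub>R v) - f (x + s *\<^sub>R u + 0 *\<^sub>R v)"])
       (intro DERIV_diff d1; use h in simp)
  then obtain s where s: "0 < s" "s < h" and
    1: "f (x + h *\<^sub>R u + h *\<^sub>R v) - f (x + h *\<^sub>R u) - f (x + h *\<^sub>R v) + f x
     = h * (dd f (x + s *\<^sub>R u + h *\<^sub>R v) u - dd f (x + s *\<^sub>R u + 0 *\<^sub>R v) u)"
    by (auto simp: algebra_simps)
  have d2: "((\<lambda>t. dd f (x + s *\<^sub>R u + t *\<^sub>R v) u) has_real_derivative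
      dd (\<lambda>y. dd f y u) (x + s *\<^sub>R u + t *\<^sub>R v) v) (at t)"
    if "0 \<le> t" "t \<le> h" for t
  proof -
    have b: "x + s *\<^sub>R u + t *\<^sub>R v \<in> ball x r" using in_ball that s by simp
    have "((\<lambda>t. dd f (x + s *\<^sub>R u + t *\<^sub>R v) u) has_derivative
        (\<lambda>k. dd (\<lambda>y. dd f y u) (x + s *\<^sub>R u + t *\<^sub>R v) (k *\<^sub>R v))) (at t)"
      by (rule has_derivative_compose[of "\<lambda>t. x + s *\<^sub>R u + t *\<^sub>R v" _ _ _ "\<lambda>y. dd f y u"])
         (auto intro!: derivative_eq_intros dd_works df b)
    then show ?thesis
      by (simp add: has_field_derivative_def linear_scale[OF linear_dd[OF df[OF b]]]
          mult.commute[of _ "dd _ _ _"] fun_eq_iff mult_commute_abs)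
  qed
  have "\<exists>t>0. t < h \<and> dd f (x + s *\<^sub>R u + h *\<^sub>R v) u - dd f (x + s *\<^sub>R u + 0 *\<^sub>R v) u
      = (h - 0) * dd (\<lambda>y. dd f y u) (x + s *\<^sub>R u + t *\<^sub>R v) v"
    by (rule MVT2[OF h(1)]) (rule d2)
  then obtain t where t: "0 < t" "t < h" and
    2: "dd f (x + s *\<^sub>R u + h *\<^sub>R v) u - dd f (x + s *\<^sub>R u + 0 *\<^sub>R v) u
      = h * dd (\<lambda>y. dd f y u) (x + s *\<^sub>R u + t *\<^sub>R v) v"
    by auto
  show thesis
    by (rule that[OF in_ball[of s t]]) (use s t 1 2 in auto)
qed

text \<open>The second difference is symmetric in \<open>u\<close> and \<open>v\<close>. Divided by \<open>h\<^sup>2\<close> it is a value of either mixed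
derivative arbitrarily close to \<open>x\<close>, so the continuous mixed derivatives agree at \<open>x\<close>.\<close>

lemma mixed_derivatives_commute_real:
  fixes f :: "'a::euclidean_space \<Rightarrow> real"
  assumes S: "open S" "x \<in> S" and f: "C_k_on 2 f S"
  shows "dd (\<lambda>y. dd f y u) x v = dd (\<lambda>y. dd f y v) x u"
proof (rule ccontr)
  let ?P = "\<lambda>y. dd (\<lambda>y. dd f y u) y v" and ?Q = "\<lambda>y. dd (\<lambda>y. dd f y v) y u"
  assume ne: "?P x \<noteq> ?Q x"
  define e where "e = dist (?P x) (?Q x) / 2"
  have e: "e > 0" using ne by (simp add: e_def)
  have C: "continuous_on S ?P" "continuous_on S ?Q" 
    "\<And>y. y \<in> S \<Longrightarrow> f differentiable (at y)"
    "\<And>y u. y \<in> S \<Longrightarrow> (\<lambda>y. dd f y u) differentiable (at y)"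
    using f by (auto simp: numeral_2_eq_2)
  have "open (S \<inter> {y\<in>S. dist (?P y) (?P x) < e} \<inter> {y\<in>S. dist (?Q y) (?Q x) < e})"
  proof -
    have "open {y\<in>S. dist (?P y) (?P x) < e}" "open {y\<in>S. dist (?Q y) (?Q x) < e}"
      using continuous_open_preimage[OF C(1) S(1) open_ball[of "?P x" e]]
        continuous_open_preimage[OF C(2) S(1) open_ball[of "?Q x" e]]
      by (simp_all add: ball_def vimage_def dist_commute Int_def conj_commute)
    then show ?thesis using S by auto
  qed
  moreover have "x \<in> S \<inter> {y\<in>S. dist (?P y) (?P x) < e} \<inter> {y\<in>S. dist (?Q y) (?Q x) < e}"
    using S e by simp
  ultimately obtain r where r: "r > 0"
    "ball x r \<subseteq> S \<inter> {y\<in>S. dist (?P y) (?P x) < e} \<inter> {y\<in>S. dist (?Q y) (?Q x) < e}"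
    by (meson open_contains_ball)
  \<comment> \<open>Small enough that the parallelogram lies in the ball, with \<open>+ 1\<close> in case \<open>u = v = 0\<close>.\<close>
  define h where "h = r / (2 * (norm u + norm v + 1))"
  have pos: "norm u + norm v + 1 > 0" by (simp add: add_nonneg_pos)
  have h: "h > 0" using r pos by (simp add: h_def)
  have "h * (norm u + norm v) \<le> h * (norm u + norm v + 1)" using h by simp
  also have "\<dots> = r / 2" using pos by (simp add: h_def field_simps)
  finally have h2: "h * (norm u + norm v) < r" "h * (norm v + norm u) < r"
    using r by (simp_all add: add.commute)
  have C': "f differentiable (at y)" "(\<lambda>y. dd f y u) differentiable (at y)" if "y \<in> ball x r" for y u
    using that r(2) C(3,4) by (auto simp del: mem_ball)
  obtain y where y: "y \<in> ball x r"
    "f (x + h *\<^sub>R u + h *\<^sub>R v) - f (x + h *\<^sub>R u) - f (x + h *\<^sub>R v) + f x = h * (h * ?P y)"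
    using mixed_difference_mvt[OF C' h h2(1)] by blast
  obtain z where z: "z \<in> ball x r"
    "f (x + h *\<^sub>R v + h *\<^sub>R u) - f (x + h *\<^sub>R v) - f (x + h *\<^sub>R u) + f x = h * (h * ?Q z)"
    using mixed_difference_mvt[OF C' h h2(2)] by blast
  have "h * (h * ?P y) = h * (h * ?Q z)"
    using y(2) z(2) unfolding add.assoc[of x] add.commute[of "h *\<^sub>R v"] by linarith
  then have "?P y = ?Q z" using h by simp
  moreover have "dist (?P y) (?P x) < e" "dist (?Q z) (?Q x) < e" using y(1) z(1) r(2) by auto
  ultimately show False
    using dist_triangle_half_l[of "?P x" "?P y" "2*e" "?Q x"] by (simp add: e_def dist_commute)
qed

lemma mixed_derivatives_commute:
  fixes f :: "'a::euclidean_space \<Rightarrow> 'b::euclidean_space"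
  assumes S: "open S" "x \<in> S" and f: "smooth_on f S"
  shows "dd (\<lambda>y. dd f y u) x v = dd (\<lambda>y. dd f y v) x u"
proof (rule euclidean_eqI)
  fix b :: 'b assume "b \<in> Basis"
  have 1: "dd (\<lambda>y. dd (\<lambda>y. f y \<bullet> b) y u) x v = dd (\<lambda>y. dd f y u) x v \<bullet> b" for u v
  proof -
    have "dd (\<lambda>y. dd (\<lambda>y. f y \<bullet> b) y u) x = dd (\<lambda>y. dd f y u \<bullet> b) x"
      by (rule dd_cong[OF S]) (simp add: dd_inner_left(2)[OF smooth_on_differentiable[OF f]])
    then show ?thesis
      using dd_inner_left(2)[OF smooth_on_differentiable[OF smooth_on_dd[OF f] S(2)]] by simp
  qed
  have "smooth_on (\<lambda>y. f y \<bullet> b) S"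
    using smooth_on_linear_comp[OF S(1) S(1) bounded_linear_inner_left bounded_linear_ident _ f, of b] by simp
  then have "dd (\<lambda>y. dd (\<lambda>y. f y \<bullet> b) y u) x v = dd (\<lambda>y. dd (\<lambda>y. f y \<bullet> b) y v) x u"
    using mixed_derivatives_commute_real[OF S] by (simp add: smooth_on_def)
  then show "dd (\<lambda>y. dd f y u) x v \<bullet> b = dd (\<lambda>y. dd f y v) x u \<bullet> b" by (simp add: 1)
qed

section \<open>Charts and tangent vectors\<close>

text \<open>For a chart around the point this is the isomorphism from the model space onto the tangent space,
so that computations with tangent vectors can be done in a single chart.\<close>

definition tvec_of ::
  "('m, 'e::euclidean_space) chart set \<Rightarrow> ('m, 'e) chart \<Rightarrow> 'm \<Rightarrow> 'e \<Rightarrow> ('m, 'e) tvec" where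
  "tvec_of \<C> c p u = (\<lambda>d. if d \<in> charts_at \<C> p then dd (transition c d) (snd c p) u else 0)"

lemma coord_vec_eq_tvec_of: "coord_vec \<C> c i p = tvec_of \<C> c p (axis i 1)"
  by (simp add: coord_vec_def tvec_of_def)

lemma chart_inv_image:
  assumes "x \<in> snd c ` S" "S \<subseteq> fst c"
  shows "chart_inv c x \<in> fst c" "snd c (chart_inv c x) = x"
  using assms by (auto simp: chart_inv_def inv_into_into f_inv_into_f)

locale charts =
  fixes \<C> :: "('m, 'e::euclidean_space) chart set"
  assumes atlas: "smooth_atlas \<C>"
begin

lemma inj_chart: "c \<in> \<C> \<Longrightarrow> inj_on (snd c) (fst c)"
  and open_chart_image: "c \<in> \<C> \<Longrightarrow> open (snd c ` fst c)"
  and open_overlap: "c \<in> \<C> \<Longrightarrow> d \<in> \<C> \<Longrightarrow> open (snd c ` (fst c \<inter> fst d))"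
  and smooth_transition:
    "c \<in> \<C> \<Longrightarrow> d \<in> \<C> \<Longrightarrow> smooth_on (transition c d) (snd c ` (fst c \<inter> fst d))"
  using atlas by (auto simp: smooth_atlas_def)

lemma chart_inv_apply [simp]: "c \<in> \<C> \<Longrightarrow> p \<in> fst c \<Longrightarrow> chart_inv c (snd c p) = p"
  by (simp add: chart_inv_def inj_chart)

lemma transition_apply [simp]: "c \<in> \<C> \<Longrightarrow> p \<in> fst c \<Longrightarrow> transition c d (snd c p) = snd d p"
  by (simp add: transition_def)

lemma transition_differentiable:
  assumes "c \<in> charts_at \<C> p" "d \<in> charts_at \<C> p"
  shows "transition c d differentiable (at (snd c p))"
  using assms by (intro smooth_on_differentiable[OF smooth_transition]) (auto simp: charts_at_def)

lemmas linear_jacobian = linear_dd[OF transition_differentiable]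

text \<open>The cocycle property of the Jacobians; it makes \<^const>\<open>tvec_of\<close> a tangent vector.\<close>

lemma jacobian_chain:
  assumes "c \<in> charts_at \<C> p" "d \<in> charts_at \<C> p" "e \<in> charts_at \<C> p"
  shows "dd (transition d e) (snd d p) (dd (transition c d) (snd c p) u) = dd (transition c e) (snd c p) u"
proof -
  have cde: "c \<in> \<C>" "d \<in> \<C>" "e \<in> \<C>" "p \<in> fst c" "p \<in> fst d" "p \<in> fst e"
    using assms by (auto simp: charts_at_def)
  let ?S = "snd c ` (fst c \<inter> fst d)"
  have "dd (transition c e) (snd c p) u = dd (\<lambda>x. transition d e (transition c d x)) (snd c p) u"
  proof (rule fun_cong, rule dd_cong[of ?S])
    show "open ?S" using open_overlap cde by blast
    show "snd c p \<in> ?S" using cde by blast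
    show "transition c e x = transition d e (transition c d x)" if "x \<in> ?S" for x
      using that cde by auto
  qed
  also have "\<dots> = dd (transition d e) (snd d p) (dd (transition c d) (snd c p) u)"
    using dd_chain(2)[OF transition_differentiable[OF assms(1,2)], of "transition d e"]
      transition_differentiable[OF assms(2,3)] cde by simp
  finally show ?thesis by simp
qed

lemma jacobian_self:
  assumes "c \<in> charts_at \<C> p"
  shows "dd (transition c c) (snd c p) u = u"
proof -
  have c: "c \<in> \<C>" "p \<in> fst c" using assms by (auto simp: charts_at_def)
  have "dd (transition c c) (snd c p) = dd (\<lambda>x. x) (snd c p)"
    by (rule dd_cong[OF open_chart_image[OF c(1)]]) (use c in auto)
  then show ?thesis by simp
qed

lemma jacobian_inverse:
  assumes "c \<in> charts_at \<C> p" "d \<in> charts_at \<C> p"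
  shows "dd (transition d c) (snd d p) (dd (transition c d) (snd c p) u) = u"
  using jacobian_chain[OF assms assms(1)] jacobian_self[OF assms(1)] by simp

lemma tvec_of_in_tangent_space:
  "c \<in> charts_at \<C> p \<Longrightarrow> tvec_of \<C> c p u \<in> tangent_space \<C> p"
  unfolding tangent_space_def tvec_of_def mem_Collect_eq
  using jacobian_chain[of c p] by simp

lemma tvec_of_apply:
  "c \<in> charts_at \<C> p \<Longrightarrow> d \<in> charts_at \<C> p \<Longrightarrow>
    tvec_of \<C> c p u d = dd (transition c d) (snd c p) u"
  by (simp add: tvec_of_def)

lemma tvec_of_self: "c \<in> charts_at \<C> p \<Longrightarrow> tvec_of \<C> c p u c = u"
  by (simp add: tvec_of_def jacobian_self)

lemma tvec_of_component:
  "c \<in> charts_at \<C> p \<Longrightarrow> \<xi> \<in> tangent_space \<C> p \<Longrightarrow> tvec_of \<C> c p (\<xi> c) = \<xi>"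
  unfolding tangent_space_def tvec_of_def mem_Collect_eq by (rule ext) metis

lemma tvec_of_change:
  assumes "c \<in> charts_at \<C> p" "d \<in> charts_at \<C> p"
  shows "tvec_of \<C> d p (dd (transition c d) (snd c p) u) = tvec_of \<C> c p u"
  using assms jacobian_chain[OF assms] by (simp add: tvec_of_def cong: if_cong)

lemma tvec_of_combination:
  assumes "c \<in> charts_at \<C> p"
  shows "(\<lambda>d. a *\<^sub>R tvec_of \<C> c p u d + b *\<^sub>R tvec_of \<C> c p v d) = tvec_of \<C> c p (a *\<^sub>R u + b *\<^sub>R v)"
  using linear_jacobian[OF assms] by (auto simp: tvec_of_def linear_add linear_scale)

end

section \<open>The metric in a chart\<close>

definition gform ::
  "('m, real^'n) chart set \<Rightarrow> ('m, 'n) metric \<Rightarrow> ('m, real^'n) chart \<Rightarrow> real^'n \<Rightarrow> real^'n \<Rightarrow> real^'n \<Rightarrow> real" where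
  "gform \<C> g c x a b = a \<bullet> (metric_comp \<C> g c x *v b)"

lemma inner_matrix_vector:
  fixes m :: "real^'n^'n"
  shows "a \<bullet> (m *v b) = (\<Sum>i\<in>UNIV. \<Sum>j\<in>UNIV. a $ i * b $ j * m $ i $ j)"
  by (simp add: inner_vec_def matrix_vector_mult_def sum_distrib_left mult_ac)

lemma vec_expand: "(u::real^'n) = (\<Sum>i\<in>UNIV. u $ i *\<^sub>R axis i 1)"
  by (simp add: vec_eq_iff axis_def if_distrib cong: if_cong)

lemma linear_vec_expand:
  "linear f \<Longrightarrow> f (u::real^'n) = (\<Sum>i\<in>UNIV. u $ i *\<^sub>R f (axis i 1))"
  by (subst vec_expand[of u], simp only: linear_sum linear_scale)

lemma linear_gform [simp]: "linear (gform \<C> g c x a)" "linear (\<lambda>a. gform \<C> g c x a b)"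
  by (auto intro!: linearI simp: gform_def inner_add_left inner_add_right 
      matrix_vector_right_distrib matrix_vector_mult_scaleR)

locale riem = charts \<C> for \<C> :: "('m, real^'n) chart set" +
  fixes g :: "('m, 'n) metric"
  assumes metric: "riemannian_metric \<C> g"
begin

abbreviation "gf \<equiv> gform \<C> g"

lemma metric_sym: "p \<in> carrier_of \<C> \<Longrightarrow> \<xi> \<in> tangent_space \<C> p \<Longrightarrow> \<eta> \<in> tangent_space \<C> p \<Longrightarrow>
    g p \<xi> \<eta> = g p \<eta> \<xi>"
  and metric_lin: "p \<in> carrier_of \<C> \<Longrightarrow> \<xi> \<in> tangent_space \<C> p \<Longrightarrow> \<eta> \<in> tangent_space \<C> p \<Longrightarrow>
    \<zeta> \<in> tangent_space \<C> p \<Longrightarrow> g p (\<lambda>c. a *\<^sub>R \<xi> c + b *\<^sub>R \<eta> c) \<zeta> = a * g p \<xi> \<zeta> + b * g p \<eta> \<zeta>"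
  and metric_pos: "p \<in> carrier_of \<C> \<Longrightarrow> \<xi> \<in> tangent_space \<C> p \<Longrightarrow> \<xi> \<noteq> (\<lambda>_. 0) \<Longrightarrow> g p \<xi> \<xi> > 0"
  and metric_smooth: "c \<in> \<C> \<Longrightarrow> smooth_on (metric_comp \<C> g c) (snd c ` fst c)"
  using metric unfolding riemannian_metric_def by blast+

lemma charts_at_carrier: "c \<in> charts_at \<C> p \<Longrightarrow> p \<in> carrier_of \<C>"
  by (auto simp: charts_at_def carrier_of_def)

text \<open>The metric is bilinear on the tangent space, hence determined by its values on the coordinate
vectors, and these are the entries of \<^const>\<open>metric_comp\<close>.\<close>

lemma metric_in_chart:
  assumes c: "c \<in> charts_at \<C> p"
  shows "g p (tvec_of \<C> c p a) (tvec_of \<C> c p b) = gf c (snd c p) a b"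
proof -
  let ?t = "tvec_of \<C> c p" and ?e = "\<lambda>i. axis i 1 :: real^'n"
  have lin: "linear (\<lambda>a. g p (?t a) (?t b))" for b
  proof (rule linearI)
    have comb: "g p (?t (r *\<^sub>R a + s *\<^sub>R a')) (?t b) = r * g p (?t a) (?t b) + s * g p (?t a') (?t b)" for r s a a'
      using metric_lin[OF charts_at_carrier[OF c], of "?t a" "?t a'" "?t b" r s]
      by (simp add: tvec_of_in_tangent_space[OF c] tvec_of_combination[OF c])
    show "g p (?t (a + a')) (?t b) = g p (?t a) (?t b) + g p (?t a') (?t b)" for a a'
      using comb[of 1 a 1 a'] by simp
    show "g p (?t (r *\<^sub>R a)) (?t b) = r *\<^sub>R g p (?t a) (?t b)" for r a
      using comb[of r a 0 a] by simp
  qed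
  have lin2: "linear (\<lambda>b. g p (?t a) (?t b))" for a
    using lin[of a] metric_sym[OF charts_at_carrier[OF c] tvec_of_in_tangent_space[OF c] tvec_of_in_tangent_space[OF c]]
    by simp
  have "g p (?t a) (?t b) = (\<Sum>i\<in>UNIV. \<Sum>j\<in>UNIV. a $ i * b $ j * g p (?t (?e i)) (?t (?e j)))"
    by (subst linear_vec_expand[OF lin], subst linear_vec_expand[OF lin2])
       (simp add: sum_distrib_left mult.assoc)
  moreover have "metric_comp \<C> g c (snd c p) $ i $ j = g p (?t (?e i)) (?t (?e j))" for i j
    using c by (simp add: metric_comp_def coord_vec_eq_tvec_of charts_at_def)
  ultimately show ?thesis by (simp add: gform_def inner_matrix_vector)
qed

lemma gf_sym: "c \<in> \<C> \<Longrightarrow> x \<in> snd c ` fst c \<Longrightarrow> gf c x a b = gf c x b a"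
  by (auto simp: metric_in_chart[symmetric] charts_at_def
      intro!: metric_sym charts_at_carrier[of c] tvec_of_in_tangent_space)

lemma gf_pos: "c \<in> \<C> \<Longrightarrow> x \<in> snd c ` fst c \<Longrightarrow> a \<noteq> 0 \<Longrightarrow> gf c x a a > 0"
proof -
  assume c: "c \<in> \<C>" "x \<in> snd c ` fst c" and a: "a \<noteq> 0"
  then obtain p where p: "p \<in> fst c" "x = snd c p" by blast
  then have cp: "c \<in> charts_at \<C> p" using c by (simp add: charts_at_def)
  have "tvec_of \<C> c p a \<noteq> (\<lambda>_. 0)" using tvec_of_self[OF cp, of a] a by auto
  then show ?thesis
    using metric_pos[OF charts_at_carrier[OF cp] tvec_of_in_tangent_space[OF cp]] p
    by (simp add: metric_in_chart[OF cp])
qed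

lemma gf_change:
  assumes "c \<in> \<C>" "d \<in> \<C>" "x \<in> snd c ` (fst c \<inter> fst d)"
  shows "gf d (transition c d x) (dd (transition c d) x a) (dd (transition c d) x b) = gf c x a b"
proof -
  obtain p where p: "p \<in> fst c" "p \<in> fst d" "x = snd c p" using assms by blast
  then have c: "c \<in> charts_at \<C> p" "d \<in> charts_at \<C> p" using assms by (auto simp: charts_at_def)
  show ?thesis
    using assms p by (simp add: metric_in_chart[OF c(1), symmetric] metric_in_chart[OF c(2), symmetric]
        tvec_of_change[OF c])
qed

lemma gf_smooth: "c \<in> \<C> \<Longrightarrow> smooth_on (\<lambda>x. gf c x a b) (snd c ` fst c)"
proof -
  assume c: "c \<in> \<C>"
  have "linear (\<lambda>m::real^'n^'n. a \<bullet> (m *v b))"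
    by (auto intro!: linearI simp: matrix_vector_mult_add_rdistrib inner_add_right 
        scaleR_matrix_vector_assoc[symmetric])
  then show ?thesis
    using smooth_on_linear_comp[OF open_chart_image[OF c] open_chart_image[OF c] linear_conv_bounded_linear[THEN iffD1]
        bounded_linear_ident _ metric_smooth[OF c]]
    by (simp add: gform_def)
qed

end

section \<open>Christoffel symbols and curvature in a chart\<close>

text \<open>The Christoffel symbols and the curvature as multilinear maps, evaluated on constant vectors. For
constant fields the Lie bracket vanishes, which leaves four terms in \<open>R(a, b) e\<close>.\<close>

definition chr ::
  "('m, real^'n) chart set \<Rightarrow> ('m, 'n) metric \<Rightarrow> ('m, real^'n) chart \<Rightarrow>
   real^'n \<Rightarrow> real^'n \<Rightarrow> real^'n \<Rightarrow> real^'n" where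
  "chr \<C> g c x a b = (\<chi> k. \<Sum>i\<in>UNIV. \<Sum>j\<in>UNIV. a $ i * b $ j * christoffel \<C> g c k i j x)"

definition curv ::
  "('m, real^'n) chart set \<Rightarrow> ('m, 'n) metric \<Rightarrow> ('m, real^'n) chart \<Rightarrow>
   real^'n \<Rightarrow> real^'n \<Rightarrow> real^'n \<Rightarrow> real^'n \<Rightarrow> real^'n" where
  "curv \<C> g c x a b e =
     dd (\<lambda>y. chr \<C> g c y b e) x a - dd (\<lambda>y. chr \<C> g c y a e) x b
     + chr \<C> g c x a (chr \<C> g c x b e) - chr \<C> g c x b (chr \<C> g c x a e)"

lemma linear_chr [simp]: "linear (chr \<C> g c x a)" "linear (\<lambda>a. chr \<C> g c x a b)"
  by (auto intro!: linearI simp: chr_def vec_eq_iff sum.distrib[symmetric] sum_distrib_left algebra_simps)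

lemma chr_axis: "chr \<C> g c x (axis i 1) (axis j 1) $ k = christoffel \<C> g c k i j x"
  by (simp add: chr_def mult.assoc sum_distrib_left[symmetric])
     (simp add: axis_def if_distrib[of "\<lambda>r. r * _"] cong: if_cong)

lemma trilinear_eq:
  fixes f h :: "real^'n \<Rightarrow> real^'n \<Rightarrow> real^'n \<Rightarrow> 'b::real_vector"
  assumes "\<And>a b. linear (f a b)" "\<And>a e. linear (\<lambda>b. f a b e)" "\<And>b e. linear (\<lambda>a. f a b e)"
    and "\<And>a b. linear (h a b)" "\<And>a e. linear (\<lambda>b. h a b e)" "\<And>b e. linear (\<lambda>a. h a b e)"
    and "\<And>i j k. f (axis i 1) (axis j 1) (axis k 1) = h (axis i 1) (axis j 1) (axis k 1)"
  shows "f a b e = h a b e"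
proof -
  have "f (axis i 1) (axis j 1) e = h (axis i 1) (axis j 1) e" for i j e
    by (subst linear_vec_expand[OF assms(1)], subst linear_vec_expand[OF assms(4)]) (simp add: assms(7))
  then have "f (axis i 1) b e = h (axis i 1) b e" for i b e
    by (subst linear_vec_expand[OF assms(2)], subst linear_vec_expand[OF assms(5)]) simp
  then show ?thesis
    by (subst linear_vec_expand[OF assms(3)], subst linear_vec_expand[OF assms(6)]) simp
qed

lemma trilinear_expand:
  fixes f :: "real^'n \<Rightarrow> real^'n \<Rightarrow> real^'n \<Rightarrow> 'b::real_vector"
  assumes "\<And>a b. linear (f a b)" "\<And>a e. linear (\<lambda>b. f a b e)" "\<And>b e. linear (\<lambda>a. f a b e)"
  shows "f a b e = (\<Sum>k\<in>UNIV. \<Sum>i\<in>UNIV. \<Sum>j\<in>UNIV. (a $ i * b $ j * e $ k) *\<^sub>R f (axis i 1) (axis j 1) (axis k 1))"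
proof -
  have "f a b e' = (\<Sum>i\<in>UNIV. \<Sum>j\<in>UNIV. (a $ i * b $ j) *\<^sub>R f (axis i 1) (axis j 1) e')" for e'
    by (subst linear_vec_expand[OF assms(3)], subst linear_vec_expand[OF assms(2)])
       (simp add: scaleR_sum_right)
  then show ?thesis
    by (subst linear_vec_expand[OF assms(1)]) (simp add: scaleR_sum_right mult_ac)
qed

lemma metric_entry: "metric_comp \<C> g c y $ i $ j = gform \<C> g c y (axis i 1) (axis j 1)"
  by (simp add: gform_def inner_axis' matrix_vector_mult_basis column_def)

lemma matrix_inv_mult:
  fixes m :: "real^'n^'n"
  assumes "invertible m"
  shows "m *v (matrix_inv m *v b) = b" "matrix_inv m *v (m *v b) = b"
proof -
  have "m ** matrix_inv m = mat 1 \<and> matrix_inv m ** m = mat 1"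
    using assms unfolding matrix_inv_def invertible_def by (rule someI_ex)
  then show "m *v (matrix_inv m *v b) = b" "matrix_inv m *v (m *v b) = b"
    by (simp_all only: matrix_vector_mul_assoc matrix_vector_mul_lid)
qed

text \<open>By Cramer's rule the components are quotients of determinants, which are polynomials in the matrix
entries.\<close>

lemma matrix_inv_differentiable:
  fixes m :: "'a::real_normed_vector \<Rightarrow> real^'n^'n"
  assumes S: "open S" "x \<in> S" and inv: "\<And>y. y \<in> S \<Longrightarrow> invertible (m y)"
    and m: "\<And>i j. (\<lambda>y. m y $ i $ j) differentiable (at x)"
  shows "(\<lambda>y. matrix_inv (m y) *v b) differentiable (at x)"
proof (rule differentiable_cong_open[OF S])
  let ?cr = "\<lambda>y k. det (\<chi> i j. if j = k then b $ i else m y $ i $ j) / det (m y)"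
  show "(\<chi> k. ?cr y k) = matrix_inv (m y) *v b" if "y \<in> S" for y
    using cramer[of "m y" "matrix_inv (m y) *v b" b] matrix_inv_mult(1)[OF inv[OF that]] inv[OF that]
    by (simp add: invertible_det_nz)
  have det: "(\<lambda>y. det (n y)) differentiable (at x)"
    if "\<And>i j. (\<lambda>y. n y $ i $ j) differentiable (at x)" for n :: "'a \<Rightarrow> real^'n^'n"
  proof -
    have "(\<lambda>y. \<Prod>i\<in>UNIV. n y $ i $ p i) differentiable (at x)" for p
      by (rule differentiableI, rule has_derivative_prod, rule dd_works, rule that)
    then show ?thesis unfolding det_def by (intro differentiable_sum ballI differentiable_mult) auto
  qed
  have "det (m x) \<noteq> 0" using inv[OF S(2)] by (simp add: invertible_det_nz)
  moreover have "(\<lambda>y. (if j = k then b $ i else m y $ i $ j)) differentiable (at x)" for i j k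
    using m by (cases "j = k") auto
  ultimately show "(\<lambda>y. \<chi> k. ?cr y k) differentiable (at x)"
    using m by (intro differentiable_vec_lambda differentiable_divide det) simp_all
qed

context riem
begin

abbreviation "Gam \<equiv> chr \<C> g"
abbreviation "Rm \<equiv> curv \<C> g"

context
  fixes c :: "('m, real^'n) chart" assumes c: "c \<in> \<C>"
begin

abbreviation "ch \<equiv> snd c ` fst c"

lemmas open_ch = open_chart_image[OF c]

lemma gf_differentiable: "x \<in> ch \<Longrightarrow> (\<lambda>y. gf c y a b) differentiable (at x)"
  by (rule smooth_on_differentiable[OF gf_smooth[OF c]])

lemma metric_invertible: "x \<in> ch \<Longrightarrow> invertible (metric_comp \<C> g c x)"
proof -
  assume x: "x \<in> ch"
  have "a = 0" if "metric_comp \<C> g c x *v a = 0" for a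
    using gf_pos[OF c x, of a] that by (force simp: gform_def)
  then show ?thesis
    by (meson invertible_left_inverse matrix_left_invertible_ker)
qed

text \<open>The inverse matrix raises an index: it represents linear forms by the metric.\<close>

lemma gf_inverse:
  assumes x: "x \<in> ch"
  shows "gf c x a (metric_inv_comp \<C> g c x *v b) = a \<bullet> b"
    and "gf c x (metric_inv_comp \<C> g c x *v b) a = a \<bullet> b"
  using matrix_inv_mult[OF metric_invertible[OF x]] gf_sym[OF c x, of "metric_inv_comp \<C> g c x *v b" a]
  by (simp_all add: gform_def metric_inv_comp_def)

lemma gf_nondegenerate:
  assumes x: "x \<in> ch" and "\<And>w. gf c x a w = gf c x b w"
  shows "a = b"
proof (rule ccontr)
  assume "a \<noteq> b"
  then have "gf c x (a - b) (a - b) > 0" using gf_pos[OF c x] by simp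
  then show False using assms(2) by (simp add: linear_diff[OF linear_gform(2)])
qed

lemma metric_inv_differentiable:
  "x \<in> ch \<Longrightarrow> (\<lambda>y. metric_inv_comp \<C> g c y *v b) differentiable (at x)"
  unfolding metric_inv_comp_def
  by (rule matrix_inv_differentiable[OF open_ch]) 
     (auto simp: metric_invertible metric_entry gf_differentiable simp del: image_iff)

lemma metric_inv_entry: "metric_inv_comp \<C> g c y $ i $ j = (metric_inv_comp \<C> g c y *v axis j 1) $ i"
  by (simp add: matrix_vector_mult_basis column_def)

lemma christoffel_differentiable:
  assumes x: "x \<in> ch"
  shows "christoffel \<C> g c k i j differentiable (at x)"
proof -
  have "(\<lambda>y. partial i (\<lambda>y. metric_comp \<C> g c y $ j $ l) y) differentiable (at x)" for i j l
    unfolding partial_def metric_entry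
    by (rule smooth_on_differentiable[OF smooth_on_dd[OF gf_smooth[OF c]] x])
  then show ?thesis
    unfolding christoffel_def metric_inv_entry
    by (intro differentiable_divide differentiable_sum ballI differentiable_mult differentiable_diff
        differentiable_add nth_differentiable metric_inv_differentiable x) auto
qed

lemma Gam_differentiable:
  assumes x: "x \<in> ch"
  shows "(\<lambda>y. Gam c y a b) differentiable (at x)"
  unfolding chr_def
  by (intro differentiable_vec_lambda differentiable_sum ballI differentiable_mult
      christoffel_differentiable[OF x, unfolded eta_contract_eq]) auto

text \<open>The Christoffel symbols are the right-hand side with its last index raised. Both sides are
trilinear, so it suffices to insert coordinate vectors.\<close>

lemma koszul:
  assumes x: "x \<in> ch"
  shows "gf c x (Gam c x a b) w =
    (dd (\<lambda>y. gf c y b w) x a + dd (\<lambda>y. gf c y a w) x b - dd (\<lambda>y. gf c y a b) x w) / 2"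
proof (rule trilinear_eq[where f = "\<lambda>a b w. gf c x (Gam c x a b) w"])
  note d = gf_differentiable[OF x]
  note l1 = linear_dd[OF d]
  note l2 = linear_dd_family[where J = "\<lambda>y b. gf c y b w" for w, OF linear_gform(2) d]
  note l3 = linear_dd_family[where J = "\<lambda>y. gf c y b" for b, OF linear_gform(1) d]
  show "linear (\<lambda>b. gf c x (Gam c x a b) w)" for a w
    using linear_compose[OF linear_chr(1) linear_gform(2)] by (simp add: o_def)
  show "linear (\<lambda>a. gf c x (Gam c x a b) w)" for b w
    using linear_compose[OF linear_chr(2) linear_gform(2)] by (simp add: o_def)
  show "linear (\<lambda>w. (dd (\<lambda>y. gf c y b w) x a + dd (\<lambda>y. gf c y a w) x b - dd (\<lambda>y. gf c y a b) x w) / 2)" for a b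
    by (rule linearI) (simp_all add: l1[THEN linear_add] l3[THEN linear_add] 
      l1[THEN linear_scale] l3[THEN linear_scale] field_simps)
  show "linear (\<lambda>b. (dd (\<lambda>y. gf c y b w) x a + dd (\<lambda>y. gf c y a w) x b - dd (\<lambda>y. gf c y a b) x w) / 2)" for a w
    by (rule linearI) (simp_all add: l1[THEN linear_add] l2[THEN linear_add] l3[THEN linear_add] 
      l1[THEN linear_scale] l2[THEN linear_scale] l3[THEN linear_scale] field_simps)
  show "linear (\<lambda>a. (dd (\<lambda>y. gf c y b w) x a + dd (\<lambda>y. gf c y a w) x b - dd (\<lambda>y. gf c y a b) x w) / 2)" for b w
    by (rule linearI) (simp_all add: l1[THEN linear_add] l2[THEN linear_add]
      l1[THEN linear_scale] l2[THEN linear_scale] field_simps)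
  fix i j k
  let ?q = "\<chi> l. (partial i (\<lambda>y. metric_comp \<C> g c y $ j $ l) x
         + partial j (\<lambda>y. metric_comp \<C> g c y $ i $ l) x
         - partial l (\<lambda>y. metric_comp \<C> g c y $ i $ j) x) / 2"
  have "Gam c x (axis i 1) (axis j 1) = metric_inv_comp \<C> g c x *v ?q"
    by (simp add: vec_eq_iff chr_axis christoffel_def matrix_vector_mult_def sum_divide_distrib)
  then show "gf c x (Gam c x (axis i 1) (axis j 1)) (axis k 1) = 
    (dd (\<lambda>y. gf c y (axis j 1) (axis k 1)) x (axis i 1) + dd (\<lambda>y. gf c y (axis i 1) (axis k 1)) x (axis j 1)
     - dd (\<lambda>y. gf c y (axis i 1) (axis j 1)) x (axis k 1)) / 2"
    by (simp only: gf_inverse[OF x] inner_axis' partial_def metric_entry vec_lambda_beta) simp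
qed simp

lemma dd_gf_sym: "x \<in> ch \<Longrightarrow> dd (\<lambda>y. gf c y a b) x = dd (\<lambda>y. gf c y b a) x"
  by (rule dd_cong[OF open_ch]) (auto intro!: gf_sym c simp del: image_iff)

lemma Gam_sym:
  assumes x: "x \<in> ch"
  shows "Gam c x a b = Gam c x b a"
  by (rule gf_nondegenerate[OF x]) (simp add: koszul[OF x] dd_gf_sym[OF x, of a b])

text \<open>The connection is metric: in the sum of the two instances of the Koszul formula everything but the
derivative of \<open>g(a, b)\<close> cancels.\<close>

lemma metric_parallel:
  assumes x: "x \<in> ch"
  shows "dd (\<lambda>y. gf c y a b) x w = gf c x (Gam c x w a) b + gf c x a (Gam c x w b)"
proof -
  have "gf c x a (Gam c x w b) = gf c x (Gam c x w b) a"
    by (rule gf_sym[OF c x])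
  then show ?thesis
    by (simp only: koszul[OF x] dd_gf_sym[OF x, of b a]) (simp add: field_simps)
qed

lemma linear_Rm:
  assumes x: "x \<in> ch"
  shows "linear (Rm c x a b)" "linear (\<lambda>b. Rm c x a b e)" "linear (\<lambda>a. Rm c x a b e)"
proof -
  note d = Gam_differentiable[OF x]
  note l1 = linear_dd[OF d]
  note l2 = linear_dd_family[where J = "\<lambda>y b. Gam c y b w" for w, OF linear_chr(2) d]
  note l3 = linear_dd_family[where J = "\<lambda>y. Gam c y b" for b, OF linear_chr(1) d]
  note l4 = linear_compose[OF linear_chr(1) linear_chr(1), unfolded o_def]
    linear_compose[OF linear_chr(2) linear_chr(1), unfolded o_def]
  have "linear (\<lambda>e. Rm c x a b e)"
    unfolding curv_def by (intro linear_compose_add linear_compose_sub l3 l4)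
  then show "linear (Rm c x a b)" .
  show "linear (\<lambda>b. Rm c x a b e)"
    unfolding curv_def by (intro linear_compose_add linear_compose_sub l1 l2 l4 linear_chr)
  show "linear (\<lambda>a. Rm c x a b e)"
    unfolding curv_def by (intro linear_compose_add linear_compose_sub l1 l2 l4 linear_chr)
qed

lemma Rm_axis:
  assumes x: "x \<in> ch"
  shows "Rm c x (axis i 1) (axis j 1) (axis h 1) $ k = riemann_comp \<C> g c k h i j x"
proof -
  have 1: "dd (\<lambda>y. Gam c y (axis j 1) (axis h 1)) x a $ k = dd (christoffel \<C> g c k j h) x a" for a j h
    using dd_linear_comp(2)[OF Gam_differentiable[OF x] bounded_linear_vec_nth, of "axis j 1" "axis h 1" k a]
    by (simp add: chr_axis)
  have 2: "Gam c x (axis i 1) u $ k = (\<Sum>l\<in>UNIV. u $ l * christoffel \<C> g c k i l x)" for i u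
    by (subst linear_vec_expand[OF linear_chr(1)]) (simp add: chr_axis)
  show ?thesis
    by (simp add: curv_def riemann_comp_def 1 2 chr_axis partial_def sum_subtractf mult.commute)
qed

lemma riemann_in_chart:
  assumes p: "p \<in> fst c"
  shows "riemann \<C> g p \<xi> \<eta> \<zeta> c = Rm c (snd c p) (\<xi> c) (\<eta> c) (\<zeta> c)"
proof -
  have x: "snd c p \<in> ch" using p by blast
  show ?thesis
    using c p
    by (subst trilinear_expand[where f = "Rm c (snd c p)", OF linear_Rm[OF x]])
       (simp add: riemann_def vec_eq_iff Rm_axis[OF x] charts_at_def mult_ac)
qed

lemma Rm_antisym: "Rm c x a b e = - Rm c x b a e"
  by (simp add: curv_def)

lemma Rm_bianchi:
  assumes x: "x \<in> ch"
  shows "Rm c x a b e + Rm c x b e a + Rm c x e a b = 0"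
proof -
  have "dd (\<lambda>y. Gam c y a b) x = dd (\<lambda>y. Gam c y b a) x" for a b
    by (rule dd_cong[OF open_ch x]) (rule Gam_sym)
  note s = this[of a b] this[of b e] this[of e a]
    Gam_sym[OF x, of a b] Gam_sym[OF x, of b e] Gam_sym[OF x, of e a]
  show ?thesis by (simp add: curv_def s)
qed

text \<open>Differentiating \<open>D\<^sub>a g(e, e) = 2 g(\<Gamma>(a, e), e)\<close> once more in the direction \<open>b\<close>, and using that the
connection is metric, gives \<open>2 g(D\<^sub>b \<Gamma>(a, e) + \<Gamma>(b, \<Gamma>(a, e)), e)\<close> plus a term symmetric in \<open>a\<close> and \<open>b\<close>.
The second derivatives of \<open>g(e, e)\<close> are symmetric as well, so the skew part, which is the
curvature, is zero.\<close>

lemma Rm_skew_diag: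
  assumes x: "x \<in> ch"
  shows "gf c x (Rm c x a b e) e = 0"
proof -
  have D: "dd (\<lambda>y. dd (\<lambda>z. gf c z e e) y a) x b =
    2 * (gf c x (Gam c x b (Gam c x a e)) e + gf c x (Gam c x a e) (Gam c x b e) + gf c x (dd (\<lambda>y. Gam c y a e) x b) e)"
    for a b
  proof -
    have "dd (\<lambda>y. dd (\<lambda>z. gf c z e e) y a) x = dd (\<lambda>y. 2 * gf c y (Gam c y a e) e) x"
      by (rule dd_cong[OF open_ch x]) 
         (use gf_sym[OF c, of _ e] in \<open>simp add: metric_parallel del: image_iff\<close>)
    moreover have "((\<lambda>y. 2 * gf c y (Gam c y a e) e) has_derivative
      (\<lambda>w. 2 * (dd (\<lambda>y. gf c y (Gam c x a e) e) x w + gf c x (dd (\<lambda>y. Gam c y a e) x w) e))) (at x)"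
      by (intro has_derivative_mult_right has_derivative_linear_family[where J = "\<lambda>y a. gf c y a e"]
          linear_gform gf_differentiable x dd_works Gam_differentiable)
    ultimately show ?thesis
      by (simp add: dd_eqI metric_parallel[OF x])
  qed
  have "dd (\<lambda>y. dd (\<lambda>z. gf c z e e) y a) x b = dd (\<lambda>y. dd (\<lambda>z. gf c z e e) y b) x a"
    by (rule mixed_derivatives_commute[OF open_ch x gf_smooth[OF c]])
  then show ?thesis
    unfolding D curv_def using gf_sym[OF c x, of "Gam c x a e" "Gam c x b e"]
    by (simp add: linear_add[OF linear_gform(2)] linear_diff[OF linear_gform(2)])
qed

lemma Rm_skew:
  assumes x: "x \<in> ch"
  shows "gf c x (Rm c x a b e) f = - gf c x (Rm c x a b f) e"
  using Rm_skew_diag[OF x, of a b "e + f"] Rm_skew_diag[OF x, of a b e] Rm_skew_diag[OF x, of a b f]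
  by (simp add: linear_add[OF linear_Rm(1)[OF x]] linear_add[OF linear_gform(1)] linear_add[OF linear_gform(2)])

end

end

section \<open>Algebraic curvature tensors\<close>

text \<open>The Bianchi identity and the skew symmetries imply symmetry under exchange of the two pairs. With
it, polarization of \<open>B a b b a = 0\<close> in \<open>b\<close> gives \<open>B a b e a = 0\<close>, and polarization of this in \<open>a\<close>
shows that \<open>B\<close> is invariant under cyclic permutation of its first three arguments. By the Bianchi
identity then \<open>3 B = 0\<close>.\<close>

lemma algebraic_curvature_zero:
  fixes B :: "'a::real_vector \<Rightarrow> 'a \<Rightarrow> 'a \<Rightarrow> 'a \<Rightarrow> real"
  assumes add: "\<And>a a' b e f. B (a + a') b e f = B a b e f + B a' b e f"
    "\<And>a b b' e f. B a (b + b') e f = B a b e f + B a b' e f"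
    "\<And>a b e e' f. B a b (e + e') f = B a b e f + B a b e' f"
    "\<And>a b e f f'. B a b e (f + f') = B a b e f + B a b e f'"
    and skew1: "\<And>a b e f. B a b e f = - B b a e f"
    and skew2: "\<And>a b e f. B a b e f = - B a b f e"
    and bianchi: "\<And>a b e f. B a b e f + B b e a f + B e a b f = 0"
    and sec: "\<And>a b. B a b b a = 0"
  shows "B a b e f = 0"
proof -
  have pair: "B a b e f = B e f a b" for a b e f
    using bianchi[of a b e f] bianchi[of b e f a] bianchi[of e f a b] bianchi[of f a b e]
      skew1[of f a e b] skew2[of a f e b] skew1[of a e f b] skew2[of e a f b] skew2[of b e f a]
      skew2[of e f b a] skew1[of f b e a] skew1[of f a b e] skew2[of a b f e] skew2[of b f a e]
    by argo
  have 1: "B a b e a = 0" for a b e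
    using sec[of a "b + e"] sec[of a b] sec[of a e] pair[of a e b a] skew1[of b a a e] skew2[of a b a e]
    by (simp add: add)
  have 2: "B a b e f = B e a b f" for a b e f
    using 1[of "a + f" b e] 1[of a b e] 1[of f b e] pair[of f b e a] skew1[of e a f b] skew2[of a e f b] skew1[of a e b f]
    by (simp add: add)
  show ?thesis using bianchi[of a b e f] 2[of a b e f] 2[of b e a f] 2[of e a b f] by linarith
qed

section \<open>Change of charts and constant curvature\<close>

context riem
begin

context
  fixes c d :: "('m, real^'n) chart" assumes cd: "c \<in> \<C>" "d \<in> \<C>"
begin

abbreviation "ov \<equiv> snd c ` (fst c \<inter> fst d)"
abbreviation "phi \<equiv> transition c d"

text \<open>On the overlap the Jacobian of the coordinate change is surjective, its inverse being the Jacobian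
of the opposite change.\<close>

lemma overlap_point:
  assumes "x \<in> ov"
  shows "x \<in> ch c" "phi x \<in> ch d" "phi differentiable (at x)" "\<And>w. \<exists>u. w = dd phi x u"
proof -
  obtain p where p: "p \<in> fst c" "p \<in> fst d" "x = snd c p" using assms by blast
  then have q: "c \<in> charts_at \<C> p" "d \<in> charts_at \<C> p" using cd by (auto simp: charts_at_def)
  show "x \<in> ch c" "phi x \<in> ch d" using p cd by auto
  show "phi differentiable (at x)" using transition_differentiable[OF q] p by simp
  show "\<exists>u. w = dd phi x u" for w using jacobian_inverse[OF q(2,1), of w] p by metis
qed

lemmas phi_smooth = smooth_transition[OF cd]
lemmas dphi_differentiable = smooth_on_differentiable[OF smooth_on_dd[OF phi_smooth]]

lemma second_derivative_sym:
  "x \<in> ov \<Longrightarrow> dd (\<lambda>y. dd phi y a) x b = dd (\<lambda>y. dd phi y b) x a"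
  by (rule mixed_derivatives_commute[OF open_overlap[OF cd] _ phi_smooth])

text \<open>Let \<open>E(w, a)\<close> be the difference of the two sides and \<open>T(w, a, b)\<close> the product of \<open>E(w, a)\<close> with the image of
\<open>b\<close>. Differentiating the invariance of the metric, and using on both sides that the connection is
metric, shows that \<open>T\<close> is skew in \<open>a\<close> and \<open>b\<close>; it is symmetric in \<open>w\<close> and \<open>a\<close>, because
Christoffel symbols and second derivatives are. Such a \<open>T\<close> vanishes. This is the uniqueness of
the Levi-Civita connection.\<close>

lemma christoffel_change:
  assumes x: "x \<in> ov"
  shows "dd phi x (Gam c x a b) =
    Gam d (phi x) (dd phi x a) (dd phi x b) + dd (\<lambda>y. dd phi y b) x a"
proof -
  note o = overlap_point[OF x]
  let ?P = "dd phi x" and ?H = "\<lambda>w a. dd (\<lambda>y. dd phi y a) x w"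
  define E where "E w a = ?P (Gam c x w a) - Gam d (phi x) (?P w) (?P a) - ?H w a" for w a
  have E_sym: "E w a = E a w" for w a
    using Gam_sym[OF cd(1) o(1), of w a] Gam_sym[OF cd(2) o(2), of "?P w" "?P a"]
      second_derivative_sym[OF x, of w a] by (simp add: E_def)
  define T where "T w a b = gf d (phi x) (E w a) (?P b)" for w a b
  have T_skew: "T w a b = - T w b a" for w a b
  proof -
    have B: "(\<lambda>y. gf d (phi y) a b) differentiable (at x)"
      "dd (\<lambda>y. gf d (phi y) a b) x w = dd (\<lambda>y. gf d y a b) (phi x) (?P w)" for a b w
      using dd_chain[OF o(3) gf_differentiable[OF cd(2) o(2)]] by auto
    have "dd (\<lambda>y. gf c y a b) x w = dd (\<lambda>y. gf d (phi y) (dd phi y a) (dd phi y b)) x w"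
      by (rule fun_cong[OF dd_cong[OF open_overlap[OF cd] x]]) (simp add: gf_change[OF cd] del: image_iff)
    also have "\<dots> = dd (\<lambda>y. gf d (phi y) (?P a) (?P b)) x w
        + gf d (phi x) (?H w a) (?P b) + gf d (phi x) (?P a) (?H w b)"
      by (rule fun_cong[OF dd_eqI[OF has_derivative_bilinear_family[where B = "\<lambda>y. gf d (phi y)"]]])
         (simp_all add: B(1) dd_works dphi_differentiable x del: image_iff)
    finally have "gf c x (Gam c x w a) b + gf c x a (Gam c x w b)
       = gf d (phi x) (Gam d (phi x) (?P w) (?P a)) (?P b) + gf d (phi x) (?P a) (Gam d (phi x) (?P w) (?P b))
        + gf d (phi x) (?H w a) (?P b) + gf d (phi x) (?P a) (?H w b)"
      by (simp add: B(2) metric_parallel[OF cd(1) o(1)] metric_parallel[OF cd(2) o(2)])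
    then show ?thesis
      unfolding T_def E_def gf_change[OF cd x, symmetric] gf_sym[OF cd(2) o(2), of _ "?P a"]
      by (simp add: linear_diff[OF linear_gform(1)] linear_diff[OF linear_gform(2)])
  qed
  have T_sym: "T w a b = T a w b" for w a b by (simp add: T_def E_sym)
  \<comment> \<open>Alternate the two symmetries until the sign has changed.\<close>
  have "T w a b = 0" for w a b
    using T_skew[of w a b] T_sym[of w b a] T_skew[of b w a] T_sym[of b a w] T_skew[of a b w] T_sym[of a w b]
    by linarith
  then have "gf d (phi x) (E a b) w = gf d (phi x) 0 w" for w
    using o(4)[of w] by (auto simp: T_def linear_0[OF linear_gform(2)])
  then have "E a b = 0" by (rule gf_nondegenerate[OF cd(2) o(2)])
  then show ?thesis by (simp add: E_def algebra_simps)
qed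

text \<open>Differentiate \<open>christoffel_change\<close> for \<open>\<Gamma>(b, e)\<close> in the direction \<open>a\<close>. Second derivatives of the
coordinate change appear in combinations symmetric in \<open>a\<close> and \<open>b\<close>, and so does its third
derivative; all of them drop out when \<open>a\<close> and \<open>b\<close> are exchanged and the results subtracted.\<close>

lemma curvature_change:
  assumes x: "x \<in> ov"
  shows "dd phi x (Rm c x a b e) = Rm d (phi x) (dd phi x a) (dd phi x b) (dd phi x e)"
proof -
  note o = overlap_point[OF x]
  let ?P = "dd phi x" and ?H = "\<lambda>w a. dd (\<lambda>y. dd phi y a) x w"
  let ?K = "\<lambda>a b e. dd (\<lambda>y. dd (\<lambda>z. dd phi z e) y b) x a"
  let ?G = "Gam d (phi x)"
  have main: "?P (dd (\<lambda>y. Gam c y b e) x a) + ?P (Gam c x a (Gam c x b e)) =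
     dd (\<lambda>y. Gam d y (?P b) (?P e)) (phi x) (?P a) + ?G (?P a) (?G (?P b) (?P e))
     + (?G (?P a) (?H b e) + ?G (?P b) (?H a e)) + ?G (?H a b) (?P e) + ?K a b e" for a b
  proof -
    have B: "(\<lambda>y. Gam d (phi y) a b) differentiable (at x)"
      "dd (\<lambda>y. Gam d (phi y) a b) x w = dd (\<lambda>y. Gam d y a b) (phi x) (?P w)" for a b w
      using dd_chain[OF o(3) Gam_differentiable[OF cd(2) o(2)]] by auto
    have K: "(\<lambda>y. dd (\<lambda>z. dd phi z e) y b) differentiable (at x)"
      by (rule smooth_on_differentiable[OF smooth_on_dd[OF smooth_on_dd[OF phi_smooth]] x])
    have "dd (\<lambda>y. dd phi y (Gam c y b e)) x a =
        dd (\<lambda>y. Gam d (phi y) (dd phi y b) (dd phi y e) + dd (\<lambda>z. dd phi z e) y b) x a"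
      by (rule fun_cong[OF dd_cong[OF open_overlap[OF cd] x]]) (rule christoffel_change)
    also have "dd (\<lambda>y. dd phi y (Gam c y b e)) x a = ?H a (Gam c x b e) + ?P (dd (\<lambda>y. Gam c y b e) x a)"
      by (rule fun_cong[OF dd_eqI[OF has_derivative_linear_family_on[where J = "\<lambda>y. dd phi y", OF open_overlap[OF cd] x]]])
        (simp_all add: linear_dd[OF overlap_point(3)] dphi_differentiable[OF x] dd_works Gam_differentiable[OF cd(1) o(1)]
          del: image_iff)
    also have "dd (\<lambda>y. Gam d (phi y) (dd phi y b) (dd phi y e) + dd (\<lambda>z. dd phi z e) y b) x a =
      (dd (\<lambda>y. Gam d (phi y) (?P b) (?P e)) x a + ?G (?H a b) (?P e) + ?G (?P b) (?H a e)) + ?K a b e"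
      by (rule fun_cong[OF dd_eqI[OF has_derivative_add[OF
            has_derivative_bilinear_family[where B = "\<lambda>y. Gam d (phi y)"] dd_works[OF K]]]])
         (simp_all add: B(1) dd_works dphi_differentiable x del: image_iff)
    finally show ?thesis
      unfolding christoffel_change[OF x, of a "Gam c x b e"] christoffel_change[OF x, of b e] B(2)
      by (simp add: linear_add[OF linear_chr(1)] algebra_simps)
  qed
  \<comment> \<open>The third derivative of the coordinate change, as a second derivative of its derivative in the direction \<open>e\<close>.\<close>
  have K_sym: "?K a b e = ?K b a e"
    by (rule mixed_derivatives_commute[OF open_overlap[OF cd] x smooth_on_dd[OF phi_smooth]])
  have "?P (Rm c x a b e) =
     (?P (dd (\<lambda>y. Gam c y b e) x a) + ?P (Gam c x a (Gam c x b e)))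
     - (?P (dd (\<lambda>y. Gam c y a e) x b) + ?P (Gam c x b (Gam c x a e)))"
    using linear_dd[OF o(3)] by (simp add: curv_def linear_add linear_diff)
  then show ?thesis
    unfolding main K_sym second_derivative_sym[OF x, of a b] by (simp add: curv_def)
qed

end

text \<open>The components of the curvature belong to one tangent vector, to which the bilinearity of the
metric can be applied.\<close>

lemma riemann_eq_curv:
  assumes c: "c \<in> charts_at \<C> p"
  shows "riemann \<C> g p (tvec_of \<C> c p a) (tvec_of \<C> c p b) (tvec_of \<C> c p e)
    = tvec_of \<C> c p (Rm c (snd c p) a b e)"
proof
  fix d
  show "riemann \<C> g p (tvec_of \<C> c p a) (tvec_of \<C> c p b) (tvec_of \<C> c p e) d
    = tvec_of \<C> c p (Rm c (snd c p) a b e) d"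
  proof (cases "d \<in> charts_at \<C> p")
    case True
    then have "c \<in> \<C>" "d \<in> \<C>" "p \<in> fst c" "p \<in> fst d" using c by (auto simp: charts_at_def)
    then show ?thesis
      using curvature_change[of c d "snd c p" a b e]
      by (simp add: riemann_in_chart tvec_of_apply[OF c True])
  qed (simp add: riemann_def tvec_of_def)
qed

definition constant_curvature_form :: "real \<Rightarrow> bool" where
  "constant_curvature_form \<kappa> \<longleftrightarrow> (\<forall>c\<in>\<C>. \<forall>x\<in>ch c. \<forall>a b e.
     Rm c x a b e = \<kappa> *\<^sub>R (gf c x b e *\<^sub>R a - gf c x a e *\<^sub>R b))"

lemma lin_indep2_tvec_of:
  assumes c: "c \<in> charts_at \<C> p"
  shows "lin_indep2 (tvec_of \<C> c p a) (tvec_of \<C> c p b) \<longleftrightarrow> (\<forall>r s. r *\<^sub>R a + s *\<^sub>R b = 0 \<longrightarrow> r = 0 \<and> s = 0)"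
proof -
  have "tvec_of \<C> c p u = (\<lambda>_. 0) \<longleftrightarrow> u = 0" for u
    using tvec_of_self[OF c, of u] tvec_of_combination[OF c, of 0 0 0 0] by fastforce
  then show ?thesis by (simp add: lin_indep2_def tvec_of_combination[OF c])
qed

lemma sectional_curvature_in_chart:
  assumes c: "c \<in> charts_at \<C> p"
  shows "sectional_curvature \<C> g p (tvec_of \<C> c p a) (tvec_of \<C> c p b) =
    gf c (snd c p) (Rm c (snd c p) a b b) a /
    (gf c (snd c p) a a * gf c (snd c p) b b - (gf c (snd c p) a b)\<^sup>2)"
  by (simp add: sectional_curvature_def riemann_eq_curv[OF c] metric_in_chart[OF c])

text \<open>The Cauchy-Schwarz inequality, in its strict form.\<close>

lemma gram_pos:
  assumes c: "c \<in> \<C>" and x: "x \<in> ch c" and ind: "\<And>r s. r *\<^sub>R a + s *\<^sub>R b = 0 \<Longrightarrow> r = 0 \<and> s = 0"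
  shows "gf c x a a * gf c x b b - (gf c x a b)\<^sup>2 > 0"
proof -
  have "b \<noteq> 0" using ind[of 0 1] by auto
  then have b: "gf c x b b > 0" by (rule gf_pos[OF c x])
  \<comment> \<open>A multiple of the component of \<open>a\<close> orthogonal to \<open>b\<close>.\<close>
  let ?u = "gf c x b b *\<^sub>R a - gf c x a b *\<^sub>R b"
  have "?u \<noteq> 0" using ind[of "gf c x b b" "- gf c x a b"] b by auto
  then have "gf c x ?u ?u > 0" by (rule gf_pos[OF c x])
  also have "gf c x ?u ?u = gf c x b b * (gf c x a a * gf c x b b - (gf c x a b)\<^sup>2)"
    using gf_sym[OF c x, of b a]
    by (simp add: linear_diff[OF linear_gform(1)] linear_diff[OF linear_gform(2)]
        linear_scale[OF linear_gform(1)] linear_scale[OF linear_gform(2)] power2_eq_square algebra_simps)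
  finally show ?thesis using b by (simp add: zero_less_mult_iff)
qed

text \<open>From left to right the tensor is evaluated. Conversely, the difference of the curvature tensor and
the model tensor has the symmetries of a curvature tensor, and its sectional values vanish: on
independent vectors by assumption and on dependent ones by skew symmetry.\<close>

lemma constant_curvature_form_iff:
  "constant_curvature_form \<kappa> \<longleftrightarrow> constant_sectional_curvature \<C> g \<kappa>"
proof
  assume K: "constant_curvature_form \<kappa>"
  show "constant_sectional_curvature \<C> g \<kappa>"
    unfolding constant_sectional_curvature_def
  proof (intro ballI impI)
    fix p \<xi> \<eta> assume p: "p \<in> carrier_of \<C>" and t: "\<xi> \<in> tangent_space \<C> p" "\<eta> \<in> tangent_space \<C> p"
      and l: "lin_indep2 \<xi> \<eta>"
    obtain c where c: "c \<in> charts_at \<C> p" using p by (auto simp: carrier_of_def charts_at_def)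
    then have x: "c \<in> \<C>" "snd c p \<in> ch c" by (auto simp: charts_at_def)
    obtain a b where ab: "\<xi> = tvec_of \<C> c p a" "\<eta> = tvec_of \<C> c p b"
      using t tvec_of_component[OF c] by metis
    have "gf c (snd c p) a a * gf c (snd c p) b b - (gf c (snd c p) a b)\<^sup>2 > 0"
      by (rule gram_pos[OF x]) (use l in \<open>simp add: ab lin_indep2_tvec_of[OF c]\<close>)
    moreover have "Rm c (snd c p) a b b = \<kappa> *\<^sub>R (gf c (snd c p) b b *\<^sub>R a - gf c (snd c p) a b *\<^sub>R b)"
      using K x unfolding constant_curvature_form_def by blast
    ultimately show "sectional_curvature \<C> g p \<xi> \<eta> = \<kappa>"
      using gf_sym[OF x, of a b]
      by (simp add: ab sectional_curvature_in_chart[OF c] linear_diff[OF linear_gform(2)]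
          linear_scale[OF linear_gform(2)] power2_eq_square mult.commute)
  qed
next
  assume S: "constant_sectional_curvature \<C> g \<kappa>"
  show "constant_curvature_form \<kappa>"
    unfolding constant_curvature_form_def
  proof (intro ballI allI)
    fix c x a b e assume c: "c \<in> \<C>" and x: "x \<in> ch c"
    then obtain p where p: "p \<in> fst c" "x = snd c p" by blast
    then have cp: "c \<in> charts_at \<C> p" using c by (simp add: charts_at_def)
    note R = linear_Rm[OF c x]
    let ?R0 = "\<lambda>a b e. \<kappa> *\<^sub>R (gf c x b e *\<^sub>R a - gf c x a e *\<^sub>R b)"
    define B where "B a b e f = gf c x (Rm c x a b e) f -
      \<kappa> * (gf c x b e * gf c x a f - gf c x a e * gf c x b f)" for a b e f
    have R0: "gf c x (?R0 a b e) f = \<kappa> * (gf c x b e * gf c x a f - gf c x a e * gf c x b f)" for a b e f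
      by (simp add: linear_diff[OF linear_gform(2)] linear_scale[OF linear_gform(2)])
    note adds = linear_add[OF R(1)] linear_add[OF R(2)] linear_add[OF R(3)]
      linear_add[OF linear_gform(1)] linear_add[OF linear_gform(2)]
    have B0: "B a b e f = 0" for a b e f
    proof (rule algebraic_curvature_zero[where B = B])
      show "B (a + a') b e f = B a b e f + B a' b e f" "B a (b + b') e f = B a b e f + B a b' e f"
        "B a b (e + e') f = B a b e f + B a b e' f" "B a b e (f + f') = B a b e f + B a b e f'"
        for a a' b b' e e' f f' unfolding B_def adds by (simp_all add: algebra_simps)
      show "B a b e f = - B b a e f" for a b e f
        unfolding B_def Rm_antisym[OF c, of x a b] linear_neg[OF linear_gform(2)] by (simp add: algebra_simps)
      show "B a b e f = - B a b f e" for a b e f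
        unfolding B_def using Rm_skew[OF c x, of a b e f] by (simp add: algebra_simps)
      show "B a b e f + B b e a f + B e a b f = 0" for a b e f
      proof -
        have "gf c x (Rm c x a b e) f + gf c x (Rm c x b e a) f + gf c x (Rm c x e a b) f = 0"
          using Rm_bianchi[OF c x, of a b e] linear_0[OF linear_gform(2), of \<C> g c x f]
          by (metis linear_add[OF linear_gform(2)])
        then show ?thesis
          unfolding B_def using gf_sym[OF c x, of a b] gf_sym[OF c x, of a e] gf_sym[OF c x, of b e]
          by (simp add: algebra_simps)
      qed
      show "B a b b a = 0" for a b
      proof (cases "\<forall>r s. r *\<^sub>R a + s *\<^sub>R b = 0 \<longrightarrow> r = 0 \<and> s = 0")
        case True
        then have "sectional_curvature \<C> g p (tvec_of \<C> c p a) (tvec_of \<C> c p b) = \<kappa>"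
          using S charts_at_carrier[OF cp] tvec_of_in_tangent_space[OF cp] lin_indep2_tvec_of[OF cp]
          by (simp add: constant_sectional_curvature_def)
        moreover have "gf c x a a * gf c x b b - (gf c x a b)\<^sup>2 > 0"
          using True by (intro gram_pos[OF c x]) blast
        ultimately show ?thesis
          unfolding B_def using gf_sym[OF c x, of a b]
          by (simp add: sectional_curvature_in_chart[OF cp] p(2)[symmetric] power2_eq_square field_simps)
      next
        case False
        then obtain r s where rs: "r *\<^sub>R a + s *\<^sub>R b = 0" "r \<noteq> 0 \<or> s \<noteq> 0" by blast
        have zero: "Rm c x u u e = 0" for u e
          by (simp add: curv_def)
        have "(\<exists>t. a = t *\<^sub>R b) \<or> (\<exists>t. b = t *\<^sub>R a)"
        proof (cases "r = 0")
          case True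
          then have "b = 0 *\<^sub>R a" using rs by simp
          then show ?thesis by blast
        next
          case False
          have "a = (- s / r) *\<^sub>R b"
            using arg_cong[OF rs(1), of "\<lambda>v. (1 / r) *\<^sub>R v"] False
            by (simp add: scaleR_add_right add_eq_0_iff2)
          then show ?thesis by blast
        qed
        then show ?thesis
          unfolding B_def
          by (auto simp: linear_scale[OF R(2)] linear_scale[OF R(3)] zero linear_0[OF linear_gform(2)]
              linear_scale[OF linear_gform(1)] linear_scale[OF linear_gform(2)] algebra_simps)
      qed
    qed
    show "Rm c x a b e = ?R0 a b e"
      by (rule gf_nondegenerate[OF c x]) (use B0 in \<open>simp add: B_def R0\<close>)
  qed
qed

end

section \<open>Induced charts of the cotangent bundle\<close>

text \<open>Injectivity makes intersections commute with the passage to coordinates; this is how the axioms of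
a topology depend on the charts.\<close>

lemma istopology_atlas_open:
  assumes inj: "\<And>c. c \<in> \<C> \<Longrightarrow> inj_on (snd c) (fst c)"
  shows "istopology (atlas_open \<C>)"
  unfolding istopology_def
proof (intro conjI allI impI)
  fix S T assume S: "atlas_open \<C> S" and T: "atlas_open \<C> T"
  have "snd c ` (S \<inter> T \<inter> fst c) = snd c ` (S \<inter> fst c) \<inter> snd c ` (T \<inter> fst c)" if "c \<in> \<C>" for c
    using inj[OF that] unfolding inj_on_def by blast
  then show "atlas_open \<C> (S \<inter> T)" using S T by (auto simp: atlas_open_def)
next
  fix K assume "\<forall>S\<in>K. atlas_open \<C> S"
  moreover have "snd c ` (\<Union>K \<inter> fst c) = (\<Union>S\<in>K. snd c ` (S \<inter> fst c))" for c :: "('a, 'b) chart"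
    by blast
  ultimately show "atlas_open \<C> (\<Union>K)"
    unfolding atlas_open_def by (metis Union_least open_UN)
qed

text \<open>\<open>covec\<close> and \<open>covec_coords\<close> are the mutually inverse isomorphisms between component vectors in the
chart \<open>c\<close> and covectors at \<open>p\<close>; \<open>codiff c d y\<close> converts components in \<open>c\<close> into components in \<open>d\<close> at
the point with \<open>d\<close>-coordinates \<open>y\<close>, by the transpose of the Jacobian.\<close>

definition covec ::
  "('m, real^'n) chart set \<Rightarrow> ('m, real^'n) chart \<Rightarrow> 'm \<Rightarrow> real^'n \<Rightarrow> ('m, real^'n) tvec \<Rightarrow> real" where
  "covec \<C> c p w = (\<lambda>\<xi>. if \<xi> \<in> tangent_space \<C> p then w \<bullet> \<xi> c else 0)"

definition covec_coords ::
  "('m, real^'n) chart set \<Rightarrow> ('m, real^'n) chart \<Rightarrow> 'm \<Rightarrow> (('m, real^'n) tvec \<Rightarrow> real) \<Rightarrow> real^'n" where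
  "covec_coords \<C> c p \<omega> = (\<chi> i. \<omega> (coord_vec \<C> c i p))"

definition codiff ::
  "('m, real^'n) chart \<Rightarrow> ('m, real^'n) chart \<Rightarrow> real^'n \<Rightarrow> real^'n \<Rightarrow> real^'n" where
  "codiff c d y w = (\<chi> i. w \<bullet> dd (transition d c) y (axis i 1))"

lemma induced_chart_simps:
  "P \<in> fst (induced_chart \<C> c) \<longleftrightarrow> P \<in> cotangent_bundle0 \<C> \<and> fst P \<in> fst c"
  "snd (induced_chart \<C> c) P = (snd c (fst P), covec_coords \<C> c (fst P) (snd P))"
  by (auto simp: induced_chart_def covec_coords_def split: prod.splits)

lemma linear_codiff: "linear (codiff c d y)"
  by (rule linearI) (simp_all add: codiff_def vec_eq_iff inner_add_left)

lemma codiff_inner: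
  assumes "transition d c differentiable (at y)"
  shows "codiff c d y w \<bullet> u = w \<bullet> dd (transition d c) y u"
proof -
  have "w \<bullet> dd (transition d c) y u = (\<Sum>i\<in>UNIV. u $ i * (w \<bullet> dd (transition d c) y (axis i 1)))"
    by (subst linear_vec_expand[OF linear_dd[OF assms]]) (simp add: inner_sum_right)
  then show ?thesis by (simp add: codiff_def inner_vec_def[of "vec_lambda _"] mult.commute)
qed

context riem
begin

abbreviation "T0 \<equiv> cotangent_bundle0 \<C>"
abbreviation "ic \<equiv> induced_chart \<C>"
abbreviation "\<D> \<equiv> cotangent_atlas0 \<C>"

lemma covec_in_cotangent_space:
  assumes c: "c \<in> charts_at \<C> p"
  shows "covec \<C> c p w \<in> cotangent_space \<C> p"
proof -
  have "(\<lambda>d. a *\<^sub>R \<xi> d + b *\<^sub>R \<eta> d) \<in> tangent_space \<C> p"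
    if "\<xi> \<in> tangent_space \<C> p" "\<eta> \<in> tangent_space \<C> p" for \<xi> \<eta> a b
    using tvec_of_combination[OF c, of a "\<xi> c" b "\<eta> c"] tvec_of_in_tangent_space[OF c] that
    by (simp add: tvec_of_component[OF c])
  then show ?thesis by (auto simp: cotangent_space_def covec_def inner_add_right)
qed

lemma covec_coords_covec:
  assumes c: "c \<in> charts_at \<C> p" "d \<in> charts_at \<C> p"
  shows "covec_coords \<C> d p (covec \<C> c p w) = codiff c d (snd d p) w"
  by (simp add: covec_coords_def covec_def codiff_def vec_eq_iff coord_vec_eq_tvec_of
      tvec_of_in_tangent_space[OF c(2)] tvec_of_apply[OF c(2,1)])

lemma codiff_self: "c \<in> charts_at \<C> p \<Longrightarrow> codiff c c (snd c p) w = w"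
  by (simp add: codiff_def jacobian_self vec_eq_iff inner_axis)

lemma codiff_chain:
  assumes "c \<in> charts_at \<C> p" "d \<in> charts_at \<C> p" "e \<in> charts_at \<C> p"
  shows "codiff d e (snd e p) (codiff c d (snd d p) w) = codiff c e (snd e p) w"
  by (simp add: codiff_def[of d e] codiff_def[of c e] codiff_inner[OF transition_differentiable[OF assms(2,1)]]
      jacobian_chain[OF assms(3,2,1)])

text \<open>A covector is linear on the tangent space, hence determined by its values on the coordinate
vectors.\<close>

lemma covec_covec_coords:
  assumes c: "c \<in> charts_at \<C> p" and w: "\<omega> \<in> cotangent_space \<C> p"
  shows "covec \<C> c p (covec_coords \<C> c p \<omega>) = \<omega>"
proof
  fix \<xi>
  have comb: "\<omega> (tvec_of \<C> c p (r *\<^sub>R u + s *\<^sub>R v)) = r * \<omega> (tvec_of \<C> c p u) + s * \<omega> (tvec_of \<C> c p v)" for r s u v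
    using w tvec_of_in_tangent_space[OF c] unfolding cotangent_space_def tvec_of_combination[OF c, symmetric]
    by blast
  have lin: "linear (\<lambda>u. \<omega> (tvec_of \<C> c p u))"
    using comb[of 1 _ 1] comb[of _ _ 0 0] by (intro linearI) auto
  show "covec \<C> c p (covec_coords \<C> c p \<omega>) \<xi> = \<omega> \<xi>"
  proof (cases "\<xi> \<in> tangent_space \<C> p")
    case True
    have "\<omega> \<xi> = \<omega> (tvec_of \<C> c p (\<xi> c))" by (simp add: tvec_of_component[OF c True])
    also have "\<dots> = covec_coords \<C> c p \<omega> \<bullet> \<xi> c"
      by (subst linear_vec_expand[OF lin])
         (simp add: covec_coords_def coord_vec_eq_tvec_of inner_vec_def mult.commute)
    finally show ?thesis using True by (simp add: covec_def)
  qed (use w in \<open>simp add: covec_def cotangent_space_def\<close>)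
qed

lemma covec_zero_iff:
  assumes c: "c \<in> charts_at \<C> p"
  shows "covec \<C> c p w = (\<lambda>_. 0) \<longleftrightarrow> w = 0"
proof
  assume "covec \<C> c p w = (\<lambda>_. 0)"
  moreover have "covec_coords \<C> c p (covec \<C> c p w) = w"
    by (simp add: covec_coords_covec[OF c c] codiff_self[OF c])
  ultimately show "w = 0" by (simp add: covec_coords_def vec_eq_iff)
qed (simp add: covec_def fun_eq_iff)

lemma covec_in_bundle:
  "c \<in> charts_at \<C> p \<Longrightarrow> w \<noteq> 0 \<Longrightarrow> (p, covec \<C> c p w) \<in> T0"
  by (simp add: cotangent_bundle0_def charts_at_carrier covec_in_cotangent_space covec_zero_iff)

lemma induced_chart_apply_covec:
  assumes "c \<in> charts_at \<C> p" "d \<in> charts_at \<C> p"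
  shows "snd (ic d) (p, covec \<C> c p w) = (snd d p, codiff c d (snd d p) w)"
  by (simp add: induced_chart_simps covec_coords_covec[OF assms])

lemma bundle_point_covec:
  assumes "c \<in> \<C>" "P \<in> fst (ic c)"
  obtains p w where "c \<in> charts_at \<C> p" "w \<noteq> 0" "P = (p, covec \<C> c p w)"
proof -
  have P: "fst P \<in> fst c" "snd P \<in> cotangent_space \<C> (fst P)" "snd P \<noteq> (\<lambda>_. 0)"
    using assms(2) by (auto simp: induced_chart_simps cotangent_bundle0_def)
  then have c: "c \<in> charts_at \<C> (fst P)" using assms(1) by (simp add: charts_at_def)
  have e: "covec \<C> c (fst P) (covec_coords \<C> c (fst P) (snd P)) = snd P"
    by (rule covec_covec_coords[OF c P(2)])
  show thesis
    by (rule that[OF c, of "covec_coords \<C> c (fst P) (snd P)"])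
       (use e P(3) covec_zero_iff[OF c, of "covec_coords \<C> c (fst P) (snd P)"] in simp_all)
qed

lemma inj_induced_chart:
  assumes "c \<in> \<C>"
  shows "inj_on (snd (ic c)) (fst (ic c))"
proof (rule inj_onI)
  fix P Q assume P: "P \<in> fst (ic c)" and Q: "Q \<in> fst (ic c)" and eq: "snd (ic c) P = snd (ic c) Q"
  obtain p w where p: "c \<in> charts_at \<C> p" "P = (p, covec \<C> c p w)"
    using bundle_point_covec[OF assms P] by metis
  obtain q u where q: "c \<in> charts_at \<C> q" "Q = (q, covec \<C> c q u)"
    using bundle_point_covec[OF assms Q] by metis
  have "snd c p = snd c q" "w = u"
    using eq p q by (simp_all add: induced_chart_apply_covec codiff_self)
  moreover have "p = q"
    using calculation(1) p(1) q(1) inj_chart[OF assms] by (auto simp: charts_at_def inj_on_def)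
  ultimately show "P = Q" using p q by simp
qed

lemma induced_overlap:
  assumes "c \<in> \<C>" "d \<in> \<C>"
  shows "snd (ic c) ` (fst (ic c) \<inter> fst (ic d)) = (snd c ` (fst c \<inter> fst d)) \<times> (- {0})"
proof (intro equalityI subsetI)
  fix z assume "z \<in> snd (ic c) ` (fst (ic c) \<inter> fst (ic d))"
  then obtain P where P: "P \<in> fst (ic c)" "P \<in> fst (ic d)" "z = snd (ic c) P" by blast
  obtain p w where p: "c \<in> charts_at \<C> p" "w \<noteq> 0" "P = (p, covec \<C> c p w)"
    using bundle_point_covec[OF assms(1) P(1)] by metis
  then show "z \<in> (snd c ` (fst c \<inter> fst d)) \<times> (- {0})"
    using P by (auto simp: induced_chart_apply_covec codiff_self charts_at_def induced_chart_simps(1))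
next
  fix z assume z: "z \<in> (snd c ` (fst c \<inter> fst d)) \<times> (- {0 :: real^'n})"
  then obtain p and w :: "real^'n" where p: "p \<in> fst c" "p \<in> fst d" "w \<noteq> 0" "z = (snd c p, w)"
    by blast
  then have c: "c \<in> charts_at \<C> p" using assms by (simp add: charts_at_def)
  have "(p, covec \<C> c p w) \<in> fst (ic c) \<inter> fst (ic d)"
    using covec_in_bundle[OF c p(3)] p by (simp add: induced_chart_simps(1))
  moreover have "snd (ic c) (p, covec \<C> c p w) = z"
    using p by (simp add: induced_chart_apply_covec[OF c c] codiff_self[OF c])
  ultimately show "z \<in> snd (ic c) ` (fst (ic c) \<inter> fst (ic d))" by (metis imageI)
qed

lemma induced_image: "c \<in> \<C> \<Longrightarrow> snd (ic c) ` fst (ic c) = (snd c ` fst c) \<times> (- {0})"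
  using induced_overlap[of c c] by simp

lemma induced_overlap_open:
  assumes "c \<in> \<C>" "d \<in> \<C>"
  shows "open ((snd c ` (fst c \<inter> fst d)) \<times> (- {0} :: (real^'n) set))"
  by (intro open_Times open_overlap assms) (simp add: open_Compl)

lemma induced_chart_inv:
  assumes c: "c \<in> charts_at \<C> p" and w: "w \<noteq> 0"
  shows "chart_inv (ic c) (snd c p, w) = (p, covec \<C> c p w)"
proof -
  have cC: "c \<in> \<C>" "p \<in> fst c" using c by (auto simp: charts_at_def)
  have "(p, covec \<C> c p w) \<in> fst (ic c)"
    using covec_in_bundle[OF c w] cC by (simp add: induced_chart_simps(1))
  then show ?thesis
    using inv_into_f_f[OF inj_induced_chart[OF cC(1)], of "(p, covec \<C> c p w)"]
    by (simp add: chart_inv_def induced_chart_apply_covec[OF c c] codiff_self[OF c])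
qed

text \<open>Over every point of a chart there is a nonzero covector, so the domain of an induced chart
projects onto the domain of the chart it comes from.\<close>

lemma induced_chart_injective: "inj_on ic \<C>"
proof (rule inj_onI)
  fix c d assume c: "c \<in> \<C>" and d: "d \<in> \<C>" and eq: "ic c = ic d"
  have "snd c p = snd d p" for p
    using induced_chart_simps(2)[of \<C> c "(p, \<lambda>_. 0)"] induced_chart_simps(2)[of \<C> d "(p, \<lambda>_. 0)"] eq by simp
  moreover have "fst c \<subseteq> fst d" if c: "c \<in> \<C>" and eq: "ic c = ic d" for c d
  proof
    fix p assume p: "p \<in> fst c"
    then have "(p, covec \<C> c p (axis undefined 1)) \<in> fst (ic c)"
      using covec_in_bundle[of c p "axis undefined 1"] c by (simp add: induced_chart_simps(1) charts_at_def axis_eq_0_iff)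
    then show "p \<in> fst d" unfolding eq by (simp add: induced_chart_simps(1))
  qed
  ultimately show "c = d" using c d eq by (metis ext prod_eqI subset_antisym)
qed

lemma inv_into_induced_chart [simp]: "c \<in> \<C> \<Longrightarrow> inv_into \<C> ic (ic c) = c"
  by (rule inv_into_f_f[OF induced_chart_injective])

lemma charts_at_induced:
  assumes "D \<in> charts_at \<D> P"
  obtains d where "d \<in> charts_at \<C> (fst P)" "D = ic d" "P \<in> fst (ic d)"
  using assms by (auto simp: charts_at_def cotangent_atlas0_def induced_chart_simps(1))

lemma openin_induced_domain:
  assumes c: "c \<in> \<C>"
  shows "openin (atlas_topology \<D>) (fst (ic c))"
proof -
  have "istopology (atlas_open \<D>)"
    by (rule istopology_atlas_open) (auto simp: cotangent_atlas0_def intro: inj_induced_chart)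
  moreover have "atlas_open \<D> (fst (ic c))"
    unfolding atlas_open_def
  proof (intro conjI ballI)
    show "fst (ic c) \<subseteq> carrier_of \<D>" using c by (auto simp: carrier_of_def cotangent_atlas0_def)
    fix D assume "D \<in> \<D>"
    then obtain d where d: "d \<in> \<C>" "D = ic d" by (auto simp: cotangent_atlas0_def)
    then show "open (snd D ` (fst (ic c) \<inter> fst D))"
      using induced_overlap[OF d(1) c] induced_overlap_open[OF d(1) c] by (simp add: Int_commute)
  qed
  ultimately show ?thesis by (simp add: atlas_topology_def)
qed

lemma induced_transition:
  assumes c: "c \<in> \<C>" and d: "d \<in> \<C>" and z: "z \<in> (snd c ` (fst c \<inter> fst d)) \<times> (- {0})"
  shows "transition (ic c) (ic d) z
    = (transition c d (fst z), codiff c d (transition c d (fst z)) (snd z))"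
proof -
  obtain p and w :: "real^'n" where p: "p \<in> fst c" "p \<in> fst d" "w \<noteq> 0" "z = (snd c p, w)"
    using z by blast
  then have q: "c \<in> charts_at \<C> p" "d \<in> charts_at \<C> p" using c d by (auto simp: charts_at_def)
  show ?thesis
    using p c d q by (simp add: transition_def[of "ic c"] induced_chart_inv induced_chart_apply_covec)
qed

text \<open>Along a fibre the coordinate change is linear in the momenta, so it is its own derivative there.
Differentiability in all directions is still required to relate the Frechet derivative to the
restriction to the fibre.\<close>

lemma induced_transition_vertical:
  assumes q: "c \<in> charts_at \<C> p" "d \<in> charts_at \<C> p" and w: "w \<noteq> 0"
  shows "dd (transition (ic c) (ic d)) (snd c p, w) (0, b) = (0, codiff c d (snd d p) b)"
proof -
  have cd: "c \<in> \<C>" "d \<in> \<C>" "p \<in> fst c" "p \<in> fst d" using q by (auto simp: charts_at_def)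
  let ?S = "(snd c ` (fst c \<inter> fst d)) \<times> (- {0} :: (real^'n) set)"
  let ?phi = "transition c d"
  let ?F = "\<lambda>z. (?phi (fst z), codiff c d (?phi (fst z)) (snd z))"
  let ?z = "(snd c p, w)"
  have "dd (transition (ic c) (ic d)) ?z = dd ?F ?z"
    by (rule dd_cong[OF induced_overlap_open[OF cd(1,2)]])
       (use cd w induced_transition[OF cd(1,2)] in auto)
  moreover have "?F differentiable (at ?z)"
  proof -
    have fst: "fst differentiable (at ?z)" and snd: "snd differentiable (at ?z)"
      by (simp_all add: bounded_linear_fst bounded_linear_snd bounded_linear_imp_differentiable)
    have phi: "(\<lambda>z. ?phi (fst z)) differentiable (at ?z)"
      by (rule dd_chain(1)[OF fst]) (simp add: transition_differentiable[OF q])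
    have "(\<lambda>y. dd (transition d c) y u) differentiable (at (?phi (fst ?z)))" for u
      using smooth_on_differentiable[OF smooth_on_dd[OF smooth_transition[OF cd(2,1)]]] cd by simp
    then have "(\<lambda>z. dd (transition d c) (?phi (fst z)) u) differentiable (at ?z)" for u
      by (rule dd_chain(1)[OF phi])
    then have "(\<lambda>z. codiff c d (?phi (fst z)) (snd z)) differentiable (at ?z)"
      unfolding codiff_def by (intro differentiable_vec_lambda differentiable_inner snd)
    with phi show ?thesis
      unfolding differentiable_def using has_derivative_Pair by blast
  qed
  then have "dd (\<lambda>u. ?F (snd c p, u)) w b = dd ?F ?z (dd (\<lambda>u. (snd c p, u)) w b)"
    by (intro dd_chain(2)[of "\<lambda>u. (snd c p, u)" w ?F])
       (auto intro!: differentiableI[OF has_derivative_Pair] has_derivative_ident)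
  moreover have "((\<lambda>u. (snd c p, u)) has_derivative (\<lambda>u. (0, u))) (at w)"
    by (intro has_derivative_Pair) auto
  then have "dd (\<lambda>u. (snd c p, u)) w b = (0, b)" by (simp add: dd_eqI)
  moreover have "((\<lambda>u. ?F (snd c p, u)) has_derivative (\<lambda>u. (0, codiff c d (snd d p) u))) (at w)"
    using cd linear_codiff[of c d "snd d p"]
    by (auto intro!: has_derivative_Pair linear_imp_has_derivative)
  then have "dd (\<lambda>u. ?F (snd c p, u)) w b = (0, codiff c d (snd d p) b)" by (simp add: dd_eqI)
  ultimately show ?thesis by simp
qed

text \<open>The field whose components are \<open>(0, b)\<close> in the chart induced by \<open>c\<close>. Its components in other
induced charts depend on the base point alone.\<close>

definition vertical_field ::
  "('m, real^'n) chart \<Rightarrow> real^'n \<Rightarrow> ('m, 'n) cot \<Rightarrow> (('m, 'n) cot, (real^'n) \<times> (real^'n)) tvec" where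
  "vertical_field c b P =
     (\<lambda>D. if D \<in> charts_at \<D> P
          then (0, codiff c (inv_into \<C> ic D) (snd (inv_into \<C> ic D) (fst P)) b) else 0)"

lemma vertical_field_apply:
  assumes "d \<in> \<C>" "P \<in> fst (ic d)"
  shows "vertical_field c b P (ic d) = (0, codiff c d (snd d (fst P)) b)"
  using assms by (simp add: vertical_field_def charts_at_def cotangent_atlas0_def)

text \<open>In the chart induced by \<open>d\<close> the components are first derivatives of the coordinate change from \<open>d\<close>
to \<open>c\<close>, composed with the projection to the base and with linear maps. That the field consists of
tangent vectors is the cocycle property of \<^const>\<open>codiff\<close>.\<close>

lemma smooth_vertical_field:
  assumes c: "c \<in> \<C>"
  shows "smooth_vector_field_on \<D> (fst (ic c)) (vertical_field c b)"
  unfolding smooth_vector_field_on_def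
proof (intro conjI ballI)
  fix P assume P: "P \<in> fst (ic c)"
  then have cP: "c \<in> charts_at \<C> (fst P)" using c by (simp add: charts_at_def induced_chart_simps(1))
  show "vertical_field c b P \<in> tangent_space \<D> P"
    unfolding tangent_space_def mem_Collect_eq
  proof (intro conjI allI ballI impI)
    fix D E assume "D \<in> charts_at \<D> P" "E \<in> charts_at \<D> P"
    then obtain d e where d: "d \<in> charts_at \<C> (fst P)" "D = ic d" "P \<in> fst (ic d)"
      and e: "e \<in> charts_at \<C> (fst P)" "E = ic e" "P \<in> fst (ic e)"
      using charts_at_induced by metis
    then have C: "d \<in> \<C>" "e \<in> \<C>" by (auto simp: charts_at_def)
    obtain p w where p: "d \<in> charts_at \<C> p" "w \<noteq> 0" "P = (p, covec \<C> d p w)"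
      using bundle_point_covec[OF C(1) d(3)] by metis
    have "snd (ic d) P = (snd d p, w)"
      using p by (simp add: induced_chart_apply_covec codiff_self)
    then show "vertical_field c b P E = dd (transition D E) (snd D P) (vertical_field c b P D)"
      using p(2,3) d e cP by (simp add: vertical_field_apply[OF C(1)] vertical_field_apply[OF C(2)]
        induced_transition_vertical codiff_chain)
  qed (simp add: vertical_field_def)
next
  fix D assume "D \<in> \<D>"
  then obtain d where d: "d \<in> \<C>" "D = ic d" by (auto simp: cotangent_atlas0_def)
  let ?S = "snd d ` (fst d \<inter> fst c)"
  let ?T = "?S \<times> (- {0} :: (real^'n) set)"
  let ?L = "\<lambda>i u. (0 :: real^'n, (b \<bullet> u) *\<^sub>R (axis i 1 :: real^'n))"
  have T: "open ?T" by (rule induced_overlap_open[OF d(1) c])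
  have "bounded_linear (?L i)" for i
    by (intro bounded_linear_Pair bounded_linear_zero bounded_linear_scaleR_const bounded_linear_inner_right)
  then have sm: "smooth_on (\<lambda>z. ?L i (dd (transition d c) (fst z) (axis i 1))) ?T" for i
    by (rule smooth_on_linear_comp[OF open_overlap[OF d(1) c] T _ bounded_linear_fst])
       (auto intro: smooth_on_dd smooth_transition d c)
  have "smooth_on (\<lambda>z. \<Sum>i\<in>UNIV. ?L i (dd (transition d c) (fst z) (axis i 1))) ?T"
    unfolding smooth_on_def
    by (intro allI C_k_on_sum[OF T]) (use sm in \<open>auto simp: smooth_on_def\<close>)
  moreover have "(\<Sum>i\<in>UNIV. ?L i (dd (transition d c) (fst z) (axis i 1)))
      = vertical_field c b (chart_inv D z) D" if zT: "z \<in> ?T" for z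
  proof -
    obtain p w where p: "p \<in> fst c" "p \<in> fst d" "w \<noteq> 0" "z = (snd d p, w)"
      using zT by blast
    then have q: "d \<in> charts_at \<C> p" using d by (simp add: charts_at_def)
    have "chart_inv D z = (p, covec \<C> d p w)" "(p, covec \<C> d p w) \<in> fst (ic d)"
      using p d q covec_in_bundle[OF q p(3)] by (auto simp: induced_chart_inv induced_chart_simps(1))
    then have "vertical_field c b (chart_inv D z) D = (0, codiff c d (fst z) b)"
      using d p(4) by (simp add: vertical_field_apply)
    moreover have "codiff c d (fst z) b =
        (\<Sum>i\<in>UNIV. (b \<bullet> dd (transition d c) (fst z) (axis i 1)) *\<^sub>R axis i 1)"
      by (subst vec_expand) (simp add: codiff_def)
    ultimately show ?thesis by (simp add: prod_eq_iff fst_sum snd_sum)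
  qed
  ultimately have "smooth_on (\<lambda>z. vertical_field c b (chart_inv D z) D) ?T"
    by (rule smooth_on_cong[OF T, rotated])
  then show "smooth_on (\<lambda>z. vertical_field c b (chart_inv D z) D) (snd D ` (fst (ic c) \<inter> fst D))"
    using induced_overlap[OF d(1) c] d(2) by (simp add: Int_commute)
qed

end

section \<open>The Nijenhuis tensor of a family of complex structures\<close>

text \<open>The Nijenhuis bracket of two constant fields; by \<open>field_nijenhuis\<close> it is the value of the
Nijenhuis tensor on the two vectors.\<close>

definition pointwise_nijenhuis :: "('z::euclidean_space \<Rightarrow> 'z \<Rightarrow> 'z) \<Rightarrow> 'z \<Rightarrow> 'z \<Rightarrow> 'z \<Rightarrow> 'z" where
  "pointwise_nijenhuis J z a b =
     dd (\<lambda>y. J y b) z (J z a) - dd (\<lambda>y. J y a) z (J z b)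
     + J z (dd (\<lambda>y. J y a) z b) - J z (dd (\<lambda>y. J y b) z a)"

lemma pointwise_nijenhuis_skew: "pointwise_nijenhuis J z a b = - pointwise_nijenhuis J z b a"
  by (simp add: pointwise_nijenhuis_def)

locale complex_family =
  fixes Z :: "'z::euclidean_space set" and J :: "'z \<Rightarrow> 'z \<Rightarrow> 'z"
  assumes open_Z: "open Z"
    and linear_J: "z \<in> Z \<Longrightarrow> linear (J z)"
    and J_differentiable: "z \<in> Z \<Longrightarrow> (\<lambda>y. J y u) differentiable (at z)"
    and J_square: "z \<in> Z \<Longrightarrow> J z (J z u) = - u"
begin

lemma has_derivative_J_field:
  assumes "z \<in> Z" "X differentiable (at z)"
  shows "((\<lambda>y. J y (X y)) has_derivative (\<lambda>w. dd (\<lambda>y. J y (X z)) z w + J z (dd X z w))) (at z)"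
  by (rule has_derivative_linear_family_on[OF open_Z assms(1) linear_J J_differentiable[OF assms(1)]
        dd_works[OF assms(2)]])

text \<open>The derivative of the identity \<open>J\<^sup>2 = - 1\<close>.\<close>

lemma dd_J_anticommutes:
  assumes z: "z \<in> Z"
  shows "dd (\<lambda>y. J y (J z u)) z w = - J z (dd (\<lambda>y. J y u) z w)"
proof -
  have "dd (\<lambda>y. J y (J y u)) z = dd (\<lambda>y. - u) z"
    by (rule dd_cong[OF open_Z z]) (rule J_square)
  then have "dd (\<lambda>y. J y (J z u)) z w + J z (dd (\<lambda>y. J y u) z w) = 0"
    using dd_eqI[OF has_derivative_J_field[OF z J_differentiable[OF z, of u]]] by (simp add: fun_eq_iff)
  then show ?thesis by (simp add: eq_neg_iff_add_eq_0)
qed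

lemma pointwise_nijenhuis_J:
  assumes z: "z \<in> Z"
  shows "pointwise_nijenhuis J z (J z a) b = - J z (pointwise_nijenhuis J z a b)"
  using linear_J[OF z]
  by (simp add: pointwise_nijenhuis_def dd_J_anticommutes[OF z] J_square[OF z] linear_add linear_diff linear_neg
      linear_neg[OF linear_dd[OF J_differentiable[OF z]]])

lemma pointwise_nijenhuis_add:
  assumes z: "z \<in> Z"
  shows "pointwise_nijenhuis J z (a + a') b = pointwise_nijenhuis J z a b + pointwise_nijenhuis J z a' b"
proof -
  have "dd (\<lambda>y. J y (a + a')) z w = dd (\<lambda>y. J y a) z w + dd (\<lambda>y. J y a') z w" for w
  proof -
    have "dd (\<lambda>y. J y (a + a')) z = dd (\<lambda>y. J y a + J y a') z"
      by (rule dd_cong[OF open_Z z]) (simp add: linear_J linear_add)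
    also have "\<dots> = (\<lambda>w. dd (\<lambda>y. J y a) z w + dd (\<lambda>y. J y a') z w)"
      by (intro dd_eqI has_derivative_add dd_works J_differentiable z)
    finally show ?thesis by simp
  qed
  then show ?thesis
    using linear_J[OF z]
    by (simp add: pointwise_nijenhuis_def linear_add linear_add[OF linear_dd[OF J_differentiable[OF z]]])
qed

text \<open>By the product rule, derivatives of \<open>J\<close> and derivatives of the fields separate; the latter cancel
because of \<open>J\<^sup>2 = - 1\<close>.\<close>

lemma field_nijenhuis:
  assumes z: "z \<in> Z" and X: "X differentiable (at z)" and Y: "Y differentiable (at z)"
  shows "(dd (\<lambda>y. J y (Y y)) z (J z (X z)) - dd (\<lambda>y. J y (X y)) z (J z (Y z)))
       - J z (dd Y z (J z (X z)) - dd (\<lambda>y. J y (X y)) z (Y z))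
       - J z (dd (\<lambda>y. J y (Y y)) z (X z) - dd X z (J z (Y z)))
       - (dd Y z (X z) - dd X z (Y z))
     = pointwise_nijenhuis J z (X z) (Y z)"
  using linear_J[OF z] J_square[OF z]
  by (simp add: dd_eqI[OF has_derivative_J_field[OF z X]] dd_eqI[OF has_derivative_J_field[OF z Y]]
      pointwise_nijenhuis_def linear_add linear_diff algebra_simps)

end

section \<open>Complex structures adapted to a horizontal distribution\<close>

text \<open>The vectors \<open>(a, K a)\<close> are called horizontal and the vectors \<open>(0, b)\<close> vertical. The formula for \<open>J\<close>
says that \<open>J\<close> maps \<open>(a, K a)\<close> to \<open>(0, G a)\<close> and \<open>(0, b)\<close> to \<open>- (H b, K (H b))\<close>.\<close>

locale block_structure =
  fixes Z :: "('e::euclidean_space \<times> 'e) set" and G H K :: "'e \<times> 'e \<Rightarrow> 'e \<Rightarrow> 'e"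
    and J :: "'e \<times> 'e \<Rightarrow> 'e \<times> 'e \<Rightarrow> 'e \<times> 'e"
  assumes open_dom: "open Z"
    and J_eq: "z \<in> Z \<Longrightarrow> J z (a, b) =
      (- H z (b - K z a), G z a - K z (H z (b - K z a)))"
    and linear_G: "z \<in> Z \<Longrightarrow> linear (G z)" and linear_H: "z \<in> Z \<Longrightarrow> linear (H z)"
    and linear_K: "z \<in> Z \<Longrightarrow> linear (K z)"
    and GH: "z \<in> Z \<Longrightarrow> G z (H z a) = a" and HG: "z \<in> Z \<Longrightarrow> H z (G z a) = a"
    and G_diff: "z \<in> Z \<Longrightarrow> (\<lambda>y. G y a) differentiable (at z)"
    and H_diff: "z \<in> Z \<Longrightarrow> (\<lambda>y. H y a) differentiable (at z)"
    and K_diff: "z \<in> Z \<Longrightarrow> (\<lambda>y. K y a) differentiable (at z)"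
begin

lemmas block_linear_simps = linear_add[OF linear_G] linear_add[OF linear_H] linear_add[OF linear_K]
  linear_diff[OF linear_G] linear_diff[OF linear_H] linear_diff[OF linear_K]
  linear_neg[OF linear_G] linear_neg[OF linear_H] linear_neg[OF linear_K]
  linear_0[OF linear_G] linear_0[OF linear_H] linear_0[OF linear_K]
  linear_scale[OF linear_G] linear_scale[OF linear_H] linear_scale[OF linear_K]

lemma K_field: "z \<in> Z \<Longrightarrow> (X has_derivative X') (at z) \<Longrightarrow>
    ((\<lambda>y. K y (X y)) has_derivative (\<lambda>w. dd (\<lambda>y. K y (X z)) z w + K z (X' w))) (at z)"
  and H_field: "z \<in> Z \<Longrightarrow> (X has_derivative X') (at z) \<Longrightarrow>
    ((\<lambda>y. H y (X y)) has_derivative (\<lambda>w. dd (\<lambda>y. H y (X z)) z w + H z (X' w))) (at z)"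
  by (rule has_derivative_linear_family_on[OF open_dom]; simp add: linear_K linear_H K_diff H_diff)+

lemma complex_family: "complex_family Z J"
proof (rule complex_family.intro)
  fix z assume z: "z \<in> Z"
  show "linear (J z)"
    by (rule linearI) (auto simp: J_eq[OF z] block_linear_simps[OF z] algebra_simps)
  show "J z (J z u) = - u" for u
    by (cases u) (simp add: J_eq[OF z] block_linear_simps[OF z] GH[OF z] HG[OF z])
  show "(\<lambda>y. J y u) differentiable (at z)" for u
  proof (cases u)
    case (Pair a b)
    have Hb: "(\<lambda>y. H y (b - K y a)) differentiable (at z)"
      by (rule differentiableI, rule H_field[OF z],
          rule has_derivative_diff[OF has_derivative_const dd_works[OF K_diff[OF z]]])
    have KHb: "(\<lambda>y. K y (H y (b - K y a))) differentiable (at z)"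
      by (rule differentiableI, rule K_field[OF z], rule dd_works[OF Hb])
    have "(\<lambda>y. (- H y (b - K y a), G y a - K y (H y (b - K y a)))) differentiable (at z)"
      by (rule differentiableI, rule has_derivative_Pair[OF has_derivative_minus[OF dd_works[OF Hb]]
            has_derivative_diff[OF dd_works[OF G_diff[OF z]] dd_works[OF KHb]]])
    then show ?thesis
      by (rule differentiable_cong_open[OF open_dom z, rotated]) (simp add: Pair J_eq)
  qed
qed (rule open_dom)

sublocale complex_family Z J by (rule complex_family)

lemma dd_inverse_block:
  assumes z: "z \<in> Z"
  shows "dd (\<lambda>y. H y (G z a)) z w = - H z (dd (\<lambda>y. G y a) z w)"
proof -
  have "dd (\<lambda>y. H y (G y a)) z = dd (\<lambda>y. a) z"
    by (rule dd_cong[OF open_dom z]) (rule HG)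
  then have "dd (\<lambda>y. H y (G z a)) z w + H z (dd (\<lambda>y. G y a) z w) = 0"
    unfolding dd_eqI[OF H_field[OF z dd_works[OF G_diff[OF z, of a]]]] by (simp del: split_paired_All add: fun_eq_iff)
  then show ?thesis by (simp add: eq_neg_iff_add_eq_0)
qed

text \<open>The two obstructions to integrability. If \<open>K\<close> comes from a connection and \<open>G\<close> from a metric,
the first one measures the covariant derivative of \<open>G\<close> and the torsion, and the first two terms of
the second one give the curvature of the horizontal distribution.\<close>

definition torsion_part :: "'e \<times> 'e \<Rightarrow> 'e \<Rightarrow> 'e \<Rightarrow> 'e" where
  "torsion_part z a a' =
     dd (\<lambda>y. G y a) z (a', K z a') - dd (\<lambda>y. G y a') z (a, K z a)
     + dd (\<lambda>y. K y a) z (0, G z a') - dd (\<lambda>y. K y a') z (0, G z a)"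

definition curvature_part :: "'e \<times> 'e \<Rightarrow> 'e \<Rightarrow> 'e \<Rightarrow> 'e" where
  "curvature_part z a a' =
     dd (\<lambda>y. K y a') z (a, K z a) - dd (\<lambda>y. K y a) z (a', K z a')
     + dd (\<lambda>y. G y a) z (0, G z a') - dd (\<lambda>y. G y a') z (0, G z a)"

text \<open>The derivatives of \<open>H\<close> are expressed by those of \<open>G\<close> (\<open>dd_inverse_block\<close>). The result is the sum of a horizontal
vector, over \<open>H\<close> of the torsion part, and of the curvature part as a vertical vector.\<close>

lemma nijenhuis_vertical:
  assumes z: "z \<in> Z"
  shows "pointwise_nijenhuis J z (0, G z a) (0, G z a') =
    (H z (torsion_part z a a'), curvature_part z a a' + K z (H z (torsion_part z a a')))"
proof -
  have D: "dd (\<lambda>y. J y (0, G z a)) z w =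
    (H z (dd (\<lambda>y. G y a) z w), K z (H z (dd (\<lambda>y. G y a) z w)) - dd (\<lambda>y. K y a) z w)" for a w
  proof -
    have "dd (\<lambda>y. J y (0, G z a)) z = dd (\<lambda>y. (- H y (G z a), - K y (H y (G z a)))) z"
      by (rule dd_cong[OF open_dom z]) (simp add: J_eq block_linear_simps)
    also have "\<dots> = (\<lambda>w. (- dd (\<lambda>y. H y (G z a)) z w,
        - (dd (\<lambda>y. K y (H z (G z a))) z w + K z (dd (\<lambda>y. H y (G z a)) z w))))"
      by (intro dd_eqI has_derivative_Pair has_derivative_minus K_field dd_works H_diff z)
    finally show ?thesis by (simp add: dd_inverse_block[OF z] HG[OF z] block_linear_simps[OF z])
  qed
  have J0: "J z (0, G z a) = - (a, K z a)" for a
    by (simp add: J_eq[OF z] block_linear_simps[OF z] HG[OF z])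
  have J1: "J z (b, K z b - k) = (H z k, G z b + K z (H z k))" for b k
    by (simp add: J_eq[OF z] block_linear_simps[OF z])
  have neg: "dd (\<lambda>y. G y a) z (- w) = - dd (\<lambda>y. G y a) z w" "dd (\<lambda>y. K y a) z (- w) = - dd (\<lambda>y. K y a) z w" for a w
    using linear_neg[OF linear_dd[OF G_diff[OF z]]] linear_neg[OF linear_dd[OF K_diff[OF z]]] by auto
  show ?thesis
    unfolding pointwise_nijenhuis_def D J0 J1 neg torsion_part_def curvature_part_def
    by (simp add: block_linear_simps[OF z] GH[OF z] algebra_simps)
qed

text \<open>Every vector is the sum of a vertical vector and the image of a vertical vector under \<open>J\<close>, and
\<open>N (J u) u' = - J (N u u')\<close>.\<close>

lemma nijenhuis_zero_iff:
  assumes z: "z \<in> Z"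
  shows "(\<forall>u u'. pointwise_nijenhuis J z u u' = 0) \<longleftrightarrow>
    (\<forall>b b'. pointwise_nijenhuis J z (0, b) (0, b') = 0)"
proof (intro iffI allI)
  assume V: "\<forall>b b'. pointwise_nijenhuis J z (0, b) (0, b') = 0"
  have dec: "\<exists>b b'. u = (0, b) + J z (0, b')" for u
  proof (cases u)
    case (Pair a e)
    \<comment> \<open>\<open>J\<close> maps the vertical vector \<open>- G a\<close> to the horizontal part \<open>(a, K a)\<close> of \<open>u\<close>.\<close>
    have "u = (0, e - K z a) + J z (0, - G z a)"
      by (simp add: Pair J_eq[OF z] block_linear_simps[OF z] HG[OF z])
    then show ?thesis by blast
  qed
  have 1: "pointwise_nijenhuis J z u (0, b) = 0" for u b
    using dec[of u] V linear_0[OF linear_J[OF z]]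
    by (auto simp: pointwise_nijenhuis_add[OF z] pointwise_nijenhuis_J[OF z])
  have 2: "pointwise_nijenhuis J z (0, b) u = 0" for u b
    using 1[of u b] pointwise_nijenhuis_skew[of J z "(0, b)" u] by simp
  show "pointwise_nijenhuis J z u u' = 0" for u u'
    using dec[of u] 2[of _ u'] linear_0[OF linear_J[OF z]]
    by (auto simp: pointwise_nijenhuis_add[OF z] pointwise_nijenhuis_J[OF z])
qed simp

end

section \<open>The structure determined by a metric\<close>

text \<open>The linear maps with the matrices \<open>G\<^sub>i\<^sub>j\<close>, \<open>H\<^sup>k\<^sup>l\<close> and \<open>\<Gamma>\<^sup>0\<^sub>i\<^sub>h\<close>, at the point with induced coordinates \<open>z\<close>.\<close>

definition G_op ::
  "('m, real^'n) chart set \<Rightarrow> ('m, 'n) metric \<Rightarrow> real \<Rightarrow> (real \<Rightarrow> real) \<Rightarrow> ('m, real^'n) chart \<Rightarrow>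
   (real^'n) \<times> (real^'n) \<Rightarrow> real^'n \<Rightarrow> real^'n" where
  "G_op \<C> g A v c z a = (A * sqrt (energy \<C> g c z)) *\<^sub>R (metric_comp \<C> g c (fst z) *v a)
     + (v (energy \<C> g c z) * (snd z \<bullet> a)) *\<^sub>R snd z"

definition H_op ::
  "('m, real^'n) chart set \<Rightarrow> ('m, 'n) metric \<Rightarrow> real \<Rightarrow> (real \<Rightarrow> real) \<Rightarrow> ('m, real^'n) chart \<Rightarrow>
   (real^'n) \<times> (real^'n) \<Rightarrow> real^'n \<Rightarrow> real^'n" where
  "H_op \<C> g A v c z b =
     (let t = energy \<C> g c z; u = metric_inv_comp \<C> g c (fst z) *v snd z in
      (1 / (A * sqrt t)) *\<^sub>R (metric_inv_comp \<C> g c (fst z) *v b)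
      + (- v t / (A * t * (A + 2 * sqrt t * v t)) * (u \<bullet> b)) *\<^sub>R u)"

definition K_op ::
  "('m, real^'n) chart set \<Rightarrow> ('m, 'n) metric \<Rightarrow> ('m, real^'n) chart \<Rightarrow>
   (real^'n) \<times> (real^'n) \<Rightarrow> real^'n \<Rightarrow> real^'n" where
  "K_op \<C> g c z a = (\<chi> i. snd z \<bullet> chr \<C> g c (fst z) a (axis i 1))"

lemma linear_K_op: "linear (K_op \<C> g c z)"
  by (rule linearI)
     (simp_all add: K_op_def vec_eq_iff linear_add[OF linear_chr(2)] linear_scale[OF linear_chr(2)] inner_add_right)

lemma K_op_inner: "K_op \<C> g c z a \<bullet> e = snd z \<bullet> chr \<C> g c (fst z) a e"
proof -
  have "snd z \<bullet> chr \<C> g c (fst z) a e = (\<Sum>i\<in>UNIV. e $ i * (snd z \<bullet> chr \<C> g c (fst z) a (axis i 1)))"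
    by (subst linear_vec_expand[OF linear_chr(1)]) (simp add: inner_sum_right)
  then show ?thesis by (simp add: K_op_def inner_vec_def[of "vec_lambda _"] mult.commute)
qed

lemma linear_rank_one_update:
  fixes m :: "real^'n^'n"
  shows "linear (\<lambda>b. k *\<^sub>R (m *v b) + (r * (u \<bullet> b)) *\<^sub>R u')"
  by (rule linearI)
     (simp_all add: inner_add_right matrix_vector_right_distrib matrix_vector_mult_scaleR algebra_simps)

lemma linear_G_op: "linear (G_op \<C> g A v c z)"
  unfolding G_op_def[abs_def] by (rule linear_rank_one_update)

lemma linear_H_op: "linear (H_op \<C> g A v c z)"
  unfolding H_op_def[abs_def] Let_def by (rule linear_rank_one_update)

lemma energy_eq: "energy \<C> g c z = (snd z \<bullet> (metric_inv_comp \<C> g c (fst z) *v snd z)) / 2"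
  by (simp add: energy_def inner_matrix_vector split_beta mult_ac)

lemma christoffel0_eq:
  "christoffel0 \<C> g c z j i = snd z \<bullet> chr \<C> g c (fst z) (axis j 1) (axis i 1)"
  by (simp add: christoffel0_def split_beta inner_vec_def chr_axis)

lemma K_op_component: "K_op \<C> g c z a $ i = (\<Sum>j\<in>UNIV. a $ j * christoffel0 \<C> g c z j i)"
  by (simp add: K_op_def christoffel0_eq)
     (subst linear_vec_expand[OF linear_chr(2)], simp add: inner_sum_right)

lemma horiz_frame_eq: "horiz_frame \<C> g c z k = (axis k 1, K_op \<C> g c z (axis k 1))"
proof -
  have "K_op \<C> g c z (axis k 1) = (\<Sum>h\<in>UNIV. christoffel0 \<C> g c z k h *\<^sub>R axis h 1)"
    by (subst vec_expand) (simp add: K_op_def christoffel0_eq)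
  then show ?thesis
    by (simp add: horiz_frame_def vert_frame_def prod_eq_iff fst_sum snd_sum)
qed

lemma bounded_linear_matrix_vector_left: "bounded_linear (\<lambda>m::real^'n^'m. m *v b)"
  by (rule linear_conv_bounded_linear[THEN iffD1])
     (auto intro!: linearI simp: matrix_vector_mult_add_rdistrib scaleR_matrix_vector_assoc)

locale cot_structure = riem \<C> g for \<C> :: "('m, real^'n) chart set" and g :: "('m, 'n) metric" +
  fixes A :: real and v :: "real \<Rightarrow> real"
  assumes v_smooth: "smooth_on v {0<..}" and A_pos: "A > 0"
    and v_bound: "t > 0 \<Longrightarrow> v t > - A / (2 * sqrt t)"
begin

lemma denominator_pos: "t > 0 \<Longrightarrow> A + 2 * sqrt t * v t > 0"
  using v_bound[of t] by (simp add: field_simps)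

text \<open>\<open>G\<close> and \<open>H\<close> are multiples of the metric and its inverse, perturbed by a map of rank one. This is the coefficient of
the rank one part of both products; it vanishes by the choice of \<open>w\<close>.\<close>

lemma inverse_coefficient:
  assumes "t > 0"
  shows "v t / (A * sqrt t) + (- v t / (A * t * (A + 2 * sqrt t * v t))) * (A * sqrt t + 2 * t * v t) = 0"
proof -
  define s where "s = sqrt t"
  have s: "s > 0" "t = s * s" using assms by (simp_all add: s_def)
  have d: "A + 2 * s * v t > 0" using denominator_pos[OF assms] by (simp add: s_def)
  have "A * s + 2 * t * v t = s * (A + 2 * s * v t)" by (simp add: s(2) algebra_simps)
  then show ?thesis
    unfolding s_def[symmetric] using s d A_pos by (simp add: s(2))
qed

lemma v_has_derivative: "t > 0 \<Longrightarrow> \<exists>v1. (v has_derivative (\<lambda>h. v1 * h)) (at t)"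
  using smooth_on_differentiable[OF v_smooth, of t]
  by (auto simp: real_differentiable_def has_field_derivative_def)

context
  fixes c :: "('m, real^'n) chart" assumes c: "c \<in> \<C>"
begin

abbreviation "bundle_image \<equiv> ch c \<times> (- {0 :: real^'n})"
abbreviation "gi x \<equiv> metric_inv_comp \<C> g c x"
abbreviation "en \<equiv> energy \<C> g c"
abbreviation "GG \<equiv> G_op \<C> g A v c"
abbreviation "HH \<equiv> H_op \<C> g A v c"
abbreviation "KK \<equiv> K_op \<C> g c"

lemma open_bundle_image: "open bundle_image"
  by (intro open_Times open_chart_image c) (simp add: open_Compl)

lemma gi_sym: "x \<in> ch c \<Longrightarrow> (gi x *v a) \<bullet> b = a \<bullet> (gi x *v b)"
  using gf_inverse(2)[OF c, of x b "gi x *v a"] gf_inverse(1)[OF c, of x "gi x *v b" a]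
  by (simp add: inner_commute del: image_iff)

lemma energy_pos:
  assumes x: "x \<in> ch c" and p: "p \<noteq> 0"
  shows "en (x, p) > 0"
proof -
  have "gi x *v p \<noteq> 0"
    using gf_inverse(1)[OF c x, of p p] p by (auto simp: linear_0[OF linear_gform(1)])
  then have "gf c x (gi x *v p) (gi x *v p) > 0" by (rule gf_pos[OF c x])
  then show ?thesis by (simp add: energy_eq gf_inverse[OF c x] inner_commute)
qed

lemma G_op_H_op_inverse:
  assumes x: "x \<in> ch c" and p: "p \<noteq> 0"
  shows "GG (x, p) (HH (x, p) b) = b" "HH (x, p) (GG (x, p) b) = b"
proof -
  let ?t = "en (x, p)" and ?u = "gi x *v p"
  let ?w = "- v ?t / (A * ?t * (A + 2 * sqrt ?t * v ?t))"
  have t: "?t > 0" by (rule energy_pos[OF x p])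
  have pu: "p \<bullet> ?u = 2 * ?t" by (simp add: energy_eq)
  note m = matrix_inv_mult[OF metric_invertible[OF c x], folded metric_inv_comp_def]
  define a k w V where "a = A * sqrt ?t" and "k = 1 / (A * sqrt ?t)" and "w = ?w" and "V = v ?t"
  have ak: "a * k = 1" "k * a = 1" using A_pos t by (simp_all add: a_def k_def)
  have zero: "V * k + w * (a + 2 * ?t * V) = 0"
    using inverse_coefficient[OF t] by (simp add: a_def k_def w_def V_def)
  have G: "GG (x, p) y = a *\<^sub>R (metric_comp \<C> g c x *v y) + (V * (p \<bullet> y)) *\<^sub>R p" for y
    by (simp add: G_op_def a_def V_def)
  have H: "HH (x, p) y = k *\<^sub>R (gi x *v y) + (w * (?u \<bullet> y)) *\<^sub>R ?u" for y
    by (simp add: H_op_def Let_def k_def w_def)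
  have "GG (x, p) (HH (x, p) b) = (a * k) *\<^sub>R b + ((V * k + w * (a + 2 * ?t * V)) * (?u \<bullet> b)) *\<^sub>R p"
    unfolding G H by (simp add: m matrix_vector_right_distrib matrix_vector_mult_scaleR
        inner_add_right pu gi_sym[OF x, of p b, symmetric] algebra_simps)
  then show "GG (x, p) (HH (x, p) b) = b" using zero ak by simp
  have um: "?u \<bullet> (metric_comp \<C> g c x *v b) = p \<bullet> b"
    by (simp add: gi_sym[OF x] m)
  have up: "?u \<bullet> p = 2 * ?t" by (simp add: pu inner_commute)
  have "HH (x, p) (GG (x, p) b) = (k * a) *\<^sub>R b + ((V * k + w * (a + 2 * ?t * V)) * (p \<bullet> b)) *\<^sub>R ?u"
    unfolding G H by (simp add: m matrix_vector_right_distrib matrix_vector_mult_scaleR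
        inner_add_right um up algebra_simps)
  then show "HH (x, p) (GG (x, p) b) = b" using zero ak by simp
qed

lemma metric_comp_sym: "x \<in> ch c \<Longrightarrow> metric_comp \<C> g c x $ i $ j = metric_comp \<C> g c x $ j $ i"
  by (simp add: metric_entry gf_sym[OF c, of x "axis i 1"] del: image_iff)

lemma metric_inv_comp_sym: "x \<in> ch c \<Longrightarrow> gi x $ i $ j = gi x $ j $ i"
  using gi_sym[of x "axis j 1" "axis i 1"]
  by (simp add: inner_axis inner_axis' matrix_vector_mult_basis column_def del: image_iff)

lemma J_comp_block:
  assumes x: "x \<in> ch c"
  shows "J_comp \<C> g A v c (x, p) (a, b) =
    (- HH (x, p) (b - KK (x, p) a), GG (x, p) a - KK (x, p) (HH (x, p) (b - KK (x, p) a)))"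
proof -
  let ?z = "(x, p)"
  have G: "(\<Sum>i\<in>UNIV. a $ i *\<^sub>R (\<Sum>k\<in>UNIV. G_comp \<C> g A v c ?z i k *\<^sub>R vert_frame k)) = (0, GG ?z a)"
  proof -
    have "(\<Sum>i\<in>UNIV. a $ i * G_comp \<C> g A v c ?z i k) = GG ?z a $ k" for k
      by (simp add: G_comp_def G_op_def Let_def matrix_vector_mult_def inner_vec_def sum_distrib_left
          sum_distrib_right sum.distrib[symmetric] metric_comp_sym[OF x, of k] algebra_simps)
    then have "(\<Sum>i\<in>UNIV. a $ i *\<^sub>R (\<Sum>k\<in>UNIV. G_comp \<C> g A v c ?z i k *\<^sub>R axis k 1)) = GG ?z a"
      by (simp add: vec_eq_iff axis_def if_distrib cong: if_cong)
    then show ?thesis by (simp add: vert_frame_def prod_eq_iff fst_sum snd_sum)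
  qed
  have H: "(\<Sum>i\<in>UNIV. \<beta> $ i * H_comp \<C> g A v c ?z i k) = HH ?z \<beta> $ k" for k \<beta>
  proof -
    have "g0_comp \<C> g c ?z i = (gi x *v p) $ i" for i
      by (simp add: g0_comp_def matrix_vector_mult_def metric_inv_comp_sym[OF x, of i] mult.commute)
    moreover define r w where "r = 1 / (A * sqrt (en ?z))"
      and "w = - v (en ?z) / (A * en ?z * (A + 2 * sqrt (en ?z) * v (en ?z)))"
    ultimately have "H_comp \<C> g A v c ?z i k = r * gi x $ k $ i + w * (gi x *v p) $ i * (gi x *v p) $ k" for i
      by (simp add: H_comp_def Let_def metric_inv_comp_sym[OF x, of k])
    moreover have "HH ?z \<beta> = r *\<^sub>R (gi x *v \<beta>) + (w * ((gi x *v p) \<bullet> \<beta>)) *\<^sub>R (gi x *v p)"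
      by (simp add: H_op_def Let_def r_def w_def)
    ultimately show ?thesis
      by (simp add: matrix_vector_mult_def[of _ \<beta>] inner_vec_def sum_distrib_left
          sum_distrib_right sum.distrib[symmetric] algebra_simps)
  qed
  have "(\<Sum>i\<in>UNIV. \<beta> $ i *\<^sub>R (- (\<Sum>k\<in>UNIV. H_comp \<C> g A v c ?z i k *\<^sub>R horiz_frame \<C> g c ?z k)))
     = - (HH ?z \<beta>, KK ?z (HH ?z \<beta>))" for \<beta>
  proof -
    have lin: "linear (\<lambda>u. (u, KK ?z u))"
      by (rule linearI) (simp_all add: linear_add[OF linear_K_op] linear_scale[OF linear_K_op])
    have "(\<Sum>i\<in>UNIV. \<beta> $ i *\<^sub>R (\<Sum>k\<in>UNIV. H_comp \<C> g A v c ?z i k *\<^sub>R horiz_frame \<C> g c ?z k))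
      = (\<Sum>k\<in>UNIV. (\<Sum>i\<in>UNIV. \<beta> $ i * H_comp \<C> g A v c ?z i k) *\<^sub>R horiz_frame \<C> g c ?z k)"
      by (simp add: scaleR_sum_right scaleR_sum_left) (rule sum.swap)
    also have "\<dots> = (HH ?z \<beta>, KK ?z (HH ?z \<beta>))"
      unfolding H horiz_frame_eq by (rule linear_vec_expand[OF lin, symmetric])
    finally show ?thesis by (simp add: sum_negf)
  qed
  from this[of "b - KK ?z a"] show ?thesis
    unfolding J_comp_def by (simp add: G K_op_component)
qed

section \<open>Derivatives of the structure\<close>

text \<open>The derivative of \<open>g(u, u) = p(u)\<close>, where \<open>u\<close> is the vector dual to the fixed covector \<open>p\<close>, with the
derivative of the metric expressed by the Christoffel symbols.\<close>

lemma metric_inverse_derivative: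
  assumes x: "x \<in> ch c"
  shows "p \<bullet> dd (\<lambda>y. gi y *v p) x w = - 2 * (p \<bullet> Gam c x w (gi x *v p))"
proof -
  let ?u = "gi x *v p" and ?D = "dd (\<lambda>y. gi y *v p) x w"
  note d = metric_inv_differentiable[OF c x, of p]
  have "dd (\<lambda>y. gf c y (gi y *v p) (gi y *v p)) x w = dd (\<lambda>y. p \<bullet> (gi y *v p)) x w"
    by (rule fun_cong[OF dd_cong[OF open_ch[OF c] x]]) (simp add: gf_inverse[OF c] inner_commute del: image_iff)
  also have "\<dots> = p \<bullet> ?D" by (rule dd_inner_right(2)[OF d])
  also have "dd (\<lambda>y. gf c y (gi y *v p) (gi y *v p)) x w =
      dd (\<lambda>y. gf c y ?u ?u) x w + gf c x ?D ?u + gf c x ?u ?D"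
    by (rule fun_cong[OF dd_eqI[OF has_derivative_bilinear_family[where B = "gf c"]]])
       (simp_all add: gf_differentiable[OF c x] dd_works[OF d])
  finally show ?thesis
    by (simp add: metric_parallel[OF c x] gf_inverse[OF c x] inner_commute)
qed

text \<open>In particular the energy is constant in the horizontal directions \<open>(a, K a)\<close>, since
\<open>K a\<close> evaluated at a vector \<open>u\<close> is \<open>p(\<Gamma>(a, u))\<close>.\<close>

lemma energy_has_derivative:
  assumes x: "x \<in> ch c"
  shows "(en has_derivative (\<lambda>w. (gi x *v p) \<bullet> snd w - p \<bullet> Gam c x (fst w) (gi x *v p))) (at (x, p))"
proof -
  let ?z = "(x, p)" and ?u = "gi x *v p"
  have d: "(\<lambda>y. gi y *v b) differentiable (at (fst ?z))" for b
    using metric_inv_differentiable[OF c x] by simp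
  have "((\<lambda>y. gi (fst y) *v snd y) has_derivative
     (\<lambda>w. dd (\<lambda>y. gi (fst y) *v snd ?z) ?z w + gi (fst ?z) *v snd w)) (at ?z)"
    by (rule has_derivative_linear_family[where J = "\<lambda>y b. gi (fst y) *v b"])
       (auto intro: fst_chain(1)[OF d] snd_has_derivative)
  then have "((\<lambda>y. gi (fst y) *v snd y) has_derivative (\<lambda>w. dd (\<lambda>y. gi y *v p) x (fst w) + gi x *v snd w)) (at ?z)"
    using fst_chain(2)[OF d, of p] by simp
  note U = this
  have "((\<lambda>y. (snd y \<bullet> (gi (fst y) *v snd y)) / 2) has_derivative
     (\<lambda>w. (snd ?z \<bullet> (dd (\<lambda>y. gi y *v p) x (fst w) + gi x *v snd w) + snd w \<bullet> (gi (fst ?z) *v snd ?z)) / 2)) (at ?z)"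
    by (rule bounded_linear.has_derivative[OF bounded_linear_divide has_derivative_inner[OF snd_has_derivative U]])
  moreover have "(\<lambda>w. (snd ?z \<bullet> (dd (\<lambda>y. gi y *v p) x (fst w) + gi x *v snd w) + snd w \<bullet> (gi (fst ?z) *v snd ?z)) / 2)
     = (\<lambda>w. ?u \<bullet> snd w - p \<bullet> Gam c x (fst w) ?u)"
    using gi_sym[OF x, of p] by (simp add: fun_eq_iff inner_add_right metric_inverse_derivative[OF x] inner_commute[of "snd _"])
  ultimately show ?thesis by (simp only: energy_eq[abs_def])
qed

lemma block:
  "block_structure bundle_image GG HH KK (J_comp \<C> g A v c)"
proof (rule block_structure.intro)
  show "open bundle_image" by (rule open_bundle_image)
  fix z assume z: "z \<in> bundle_image"
  obtain x p where xp: "z = (x, p)" "x \<in> ch c" "p \<noteq> 0" using z by blast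
  note x = xp(2)
  show "J_comp \<C> g A v c z (a, b) = (- HH z (b - KK z a), GG z a - KK z (HH z (b - KK z a)))" for a b
    unfolding xp(1) by (rule J_comp_block[OF x])
  show "linear (GG z)" "linear (HH z)" "linear (KK z)"
    by (rule linear_G_op linear_H_op linear_K_op)+
  show "GG z (HH z a) = a" "HH z (GG z a) = a" for a
    unfolding xp(1) using G_op_H_op_inverse[OF x xp(3)] by auto
  have t: "en z > 0" unfolding xp(1) by (rule energy_pos[OF x xp(3)])
  have en: "en differentiable (at z)"
    unfolding xp(1) using energy_has_derivative[OF x] by (rule differentiableI)
  have v: "(\<lambda>y. v (en y)) differentiable (at z)"
    using smooth_on_differentiable[OF v_smooth] t by (intro dd_chain(1)[OF en]) simp
  have s: "(\<lambda>y. sqrt (en y)) differentiable (at z)"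
    using has_derivative_real_sqrt[OF t dd_works[OF en]] by (rule differentiableI)
  have "(\<lambda>y. metric_comp \<C> g c y *v a) differentiable (at x)" for a
    by (rule dd_linear_comp(1)[OF smooth_on_differentiable[OF metric_smooth[OF c] x]
        bounded_linear_matrix_vector_left])
  then have gm: "(\<lambda>y. metric_comp \<C> g c (fst y) *v a) differentiable (at z)" for a
    using fst_chain(1)[of "\<lambda>y. metric_comp \<C> g c y *v a" z] by (simp add: xp(1))
  have gi: "(\<lambda>y. gi (fst y) *v a) differentiable (at z)" for a
    using fst_chain(1)[of "\<lambda>y. gi y *v a" z] metric_inv_differentiable[OF c x] by (simp add: xp(1))
  have u: "(\<lambda>y. gi (fst y) *v snd y) differentiable (at z)"
    by (rule differentiableI, rule has_derivative_linear_family[where J = "\<lambda>y b. gi (fst y) *v b"])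
       (auto intro: gi snd_has_derivative)
  show "(\<lambda>y. GG y a) differentiable (at z)" for a
    unfolding G_op_def
    by (intro differentiable_add differentiable_scaleR differentiable_mult differentiable_const
        differentiable_inner s v gm snd_differentiable)
  have nz: "A * sqrt (en z) \<noteq> 0" "A * en z * (A + 2 * sqrt (en z) * v (en z)) \<noteq> 0"
    using t A_pos denominator_pos[OF t] by auto
  show "(\<lambda>y. HH y a) differentiable (at z)" for a
    unfolding H_op_def Let_def
    by (intro differentiable_add differentiable_scaleR differentiable_mult differentiable_const
        differentiable_inner differentiable_divide differentiable_minus s v en gi u nz)
  have "(\<lambda>y. Gam c (fst y) a e) differentiable (at z)" for a e
    using fst_chain(1)[of "\<lambda>y. Gam c y a e" z] Gam_differentiable[OF c x] by (simp add: xp(1))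
  then show "(\<lambda>y. KK y a) differentiable (at z)" for a
    unfolding K_op_def by (intro differentiable_vec_lambda differentiable_inner snd_differentiable)
qed

interpretation B: block_structure bundle_image GG HH KK "J_comp \<C> g A v c"
  by (rule block)

lemma K_op_derivative:
  assumes x: "x \<in> ch c" and p: "p \<noteq> 0"
  shows "dd (\<lambda>y. KK y a) (x, p) w \<bullet> e = snd w \<bullet> Gam c x a e + p \<bullet> dd (\<lambda>y. Gam c y a e) x (fst w)"
proof -
  have z: "(x, p) \<in> bundle_image" using x p by simp
  have d: "(\<lambda>y. Gam c y a e) differentiable (at (fst (x, p)))"
    using Gam_differentiable[OF c x] by simp
  have "dd (\<lambda>y. KK y a) (x, p) w \<bullet> e = dd (\<lambda>y. snd y \<bullet> Gam c (fst y) a e) (x, p) w"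
    using dd_inner_left(2)[OF B.K_diff[OF z], of a e w] by (simp add: K_op_inner)
  also have "\<dots> = snd (x, p) \<bullet> dd (\<lambda>y. Gam c (fst y) a e) (x, p) w + snd w \<bullet> Gam c (fst (x, p)) a e"
    by (rule fun_cong[OF dd_eqI[OF has_derivative_inner[OF snd_has_derivative dd_works[OF fst_chain(1)[OF d]]]]])
  finally show ?thesis using fst_chain(2)[OF d] by simp
qed

text \<open>The number \<open>v1\<close> is the derivative of \<open>v\<close> at the energy of the point.\<close>

lemma G_op_derivative:
  assumes x: "x \<in> ch c" and p: "p \<noteq> 0"
  obtains v1 where "\<And>a e w. dd (\<lambda>y. GG y a) (x, p) w \<bullet> e =
    A * (((gi x *v p) \<bullet> snd w - p \<bullet> Gam c x (fst w) (gi x *v p)) / (2 * sqrt (en (x, p)))) * gf c x e a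
    + A * sqrt (en (x, p)) * dd (\<lambda>y. gf c y e a) x (fst w)
    + v1 * ((gi x *v p) \<bullet> snd w - p \<bullet> Gam c x (fst w) (gi x *v p)) * ((p \<bullet> a) * (p \<bullet> e))
    + v (en (x, p)) * ((snd w \<bullet> a) * (p \<bullet> e) + (p \<bullet> a) * (snd w \<bullet> e))"
proof -
  have z: "(x, p) \<in> bundle_image" using x p by simp
  have t: "en (x, p) > 0" by (rule energy_pos[OF x p])
  obtain v1 where v1: "(v has_derivative (\<lambda>h. v1 * h)) (at (en (x, p)))"
    using v_has_derivative[OF t] by blast
  let ?E = "\<lambda>w. (gi x *v p) \<bullet> snd w - p \<bullet> Gam c x (fst w) (gi x *v p)"
  note en = energy_has_derivative[OF x, of p]
  note s = has_derivative_real_sqrt[OF t en]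
  note v = has_derivative_compose[OF en v1]
  show thesis
  proof (rule that[of v1])
    fix a e w
    have d: "(\<lambda>y. gf c y e a) differentiable (at (fst (x, p)))"
      using gf_differentiable[OF c x] by simp
    note gd = dd_works[OF fst_chain(1)[OF d]]
    have GGe: "GG y a \<bullet> e = A * (sqrt (en y) * gf c (fst y) e a) + v (en y) * ((snd y \<bullet> a) * (snd y \<bullet> e))" for y
      by (simp add: G_op_def gform_def inner_add_left inner_add_right inner_commute)
    have "dd (\<lambda>y. GG y a) (x, p) w \<bullet> e
       = dd (\<lambda>y. A * (sqrt (en y) * gf c (fst y) e a) + v (en y) * ((snd y \<bullet> a) * (snd y \<bullet> e))) (x, p) w"
      using dd_inner_left(2)[OF B.G_diff[OF z], of a e w] by (simp add: GGe)
    also have "\<dots> = A * (sqrt (en (x, p)) * dd (\<lambda>y. gf c (fst y) e a) (x, p) w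
         + ?E w * (inverse (sqrt (en (x, p))) / 2) * gf c (fst (x, p)) e a)
       + (v (en (x, p)) * ((snd (x, p) \<bullet> a) * (snd w \<bullet> e) + (snd w \<bullet> a) * (snd (x, p) \<bullet> e))
          + (v1 * ?E w) * ((snd (x, p) \<bullet> a) * (snd (x, p) \<bullet> e)))"
      by (rule fun_cong[OF dd_eqI[OF has_derivative_add[OF has_derivative_mult_right[OF has_derivative_mult[OF _ gd]]
           has_derivative_mult[OF v has_derivative_mult[OF has_derivative_inner_left[OF snd_has_derivative]
             has_derivative_inner_left[OF snd_has_derivative]]]]]])
         (use s in \<open>simp add: mult.commute\<close>)
    finally show "dd (\<lambda>y. GG y a) (x, p) w \<bullet> e = A * (?E w / (2 * sqrt (en (x, p)))) * gf c x e a
      + A * sqrt (en (x, p)) * dd (\<lambda>y. gf c y e a) x (fst w)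
      + v1 * ?E w * ((p \<bullet> a) * (p \<bullet> e)) + v (en (x, p)) * ((snd w \<bullet> a) * (p \<bullet> e) + (p \<bullet> a) * (snd w \<bullet> e))"
      using fst_chain(2)[OF d] by (simp add: algebra_simps inverse_eq_divide diff_divide_distrib)
  qed
qed

lemma G_op_inner: "GG (x, p) a \<bullet> e = A * sqrt (en (x, p)) * gf c x e a + v (en (x, p)) * (p \<bullet> a) * (p \<bullet> e)"
  by (simp add: G_op_def gform_def inner_add_left inner_add_right inner_commute)

text \<open>In horizontal directions the energy is constant and the metric is differentiated by the
Christoffel symbols; what remains cancels by the symmetry of the latter.\<close>

lemma torsion_part_zero:
  assumes x: "x \<in> ch c" and p: "p \<noteq> 0"
  shows "B.torsion_part (x, p) a a' = 0"
proof -
  obtain v1 where D: "\<And>a e w. dd (\<lambda>y. GG y a) (x, p) w \<bullet> e =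
    A * (((gi x *v p) \<bullet> snd w - p \<bullet> Gam c x (fst w) (gi x *v p)) / (2 * sqrt (en (x, p)))) * gf c x e a
    + A * sqrt (en (x, p)) * dd (\<lambda>y. gf c y e a) x (fst w)
    + v1 * ((gi x *v p) \<bullet> snd w - p \<bullet> Gam c x (fst w) (gi x *v p)) * ((p \<bullet> a) * (p \<bullet> e))
    + v (en (x, p)) * ((snd w \<bullet> a) * (p \<bullet> e) + (p \<bullet> a) * (snd w \<bullet> e))"
    using G_op_derivative[OF x p] by blast
  have E0: "(gi x *v p) \<bullet> KK (x, p) b - p \<bullet> Gam c x b (gi x *v p) = 0" for b
    using K_op_inner[of \<C> g c "(x, p)" b "gi x *v p"] by (simp add: inner_commute)
  have G: "dd (\<lambda>y. GG y a) (x, p) (b, KK (x, p) b) \<bullet> e =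
      A * sqrt (en (x, p)) * (gf c x (Gam c x b e) a + gf c x e (Gam c x b a))
      + v (en (x, p)) * ((p \<bullet> Gam c x b a) * (p \<bullet> e) + (p \<bullet> a) * (p \<bullet> Gam c x b e))" for a b e
    unfolding D fst_conv snd_conv E0 by (simp add: K_op_inner metric_parallel[OF c x])
  have K: "dd (\<lambda>y. KK y a) (x, p) (0, GG (x, p) b) \<bullet> e =
      A * sqrt (en (x, p)) * gf c x (Gam c x a e) b + v (en (x, p)) * (p \<bullet> b) * (p \<bullet> Gam c x a e)" for a b e
    using linear_0[OF linear_dd[OF Gam_differentiable[OF c x]]] by (simp add: K_op_derivative[OF x p] G_op_inner)
  have "B.torsion_part (x, p) a a' \<bullet> e = 0" for e
    unfolding B.torsion_part_def inner_diff_left inner_add_left G K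
    using Gam_sym[OF c x, of a a'] by (simp add: algebra_simps)
  from this[of "B.torsion_part (x, p) a a'"] show ?thesis by simp
qed

text \<open>The horizontal derivatives of \<open>K\<close> yield the curvature. In the vertical derivatives of \<open>G\<close> the terms with the
derivative of \<open>v\<close> are symmetric in \<open>a\<close> and \<open>a'\<close>. Of the others, up to a common sign, the derivative of \<open>A \<surd>t\<close> contributes the
factor \<open>A\<^sup>2 / 2 + A \<surd>t v\<close> and the derivative of \<open>p\<^sub>i p\<^sub>j\<close> the factor \<open>- A \<surd>t v\<close>.\<close>

lemma curvature_part_eq:
  assumes x: "x \<in> ch c" and p: "p \<noteq> 0"
  shows "B.curvature_part (x, p) a a' \<bullet> e =
    p \<bullet> (Rm c x a a' e - (A\<^sup>2 / 2) *\<^sub>R (gf c x a' e *\<^sub>R a - gf c x a e *\<^sub>R a'))"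
proof -
  obtain v1 where D: "\<And>a e w. dd (\<lambda>y. GG y a) (x, p) w \<bullet> e =
    A * (((gi x *v p) \<bullet> snd w - p \<bullet> Gam c x (fst w) (gi x *v p)) / (2 * sqrt (en (x, p)))) * gf c x e a
    + A * sqrt (en (x, p)) * dd (\<lambda>y. gf c y e a) x (fst w)
    + v1 * ((gi x *v p) \<bullet> snd w - p \<bullet> Gam c x (fst w) (gi x *v p)) * ((p \<bullet> a) * (p \<bullet> e))
    + v (en (x, p)) * ((snd w \<bullet> a) * (p \<bullet> e) + (p \<bullet> a) * (snd w \<bullet> e))"
    using G_op_derivative[OF x p] by blast
  define s where "s = sqrt (en (x, p))"
  have s: "s > 0" "en (x, p) = s * s" using energy_pos[OF x p] by (simp_all add: s_def)
  define V where "V = v (en (x, p))"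
  have K: "dd (\<lambda>y. KK y a') (x, p) (a, KK (x, p) a) \<bullet> e =
      p \<bullet> Gam c x a (Gam c x a' e) + p \<bullet> dd (\<lambda>y. Gam c y a' e) x a" for a a'
    by (simp add: K_op_derivative[OF x p] K_op_inner)
  have "p \<bullet> (gi x *v p) = 2 * (s * s)"
    using s(2) by (simp add: energy_eq)
  then have E: "(gi x *v p) \<bullet> GG (x, p) b = (A * s + 2 * (s * s) * V) * (p \<bullet> b)" for b
    unfolding inner_commute[of "gi x *v p"] G_op_inner s_def[symmetric] V_def[symmetric]
    by (simp add: gf_inverse[OF c x] inner_commute algebra_simps)
  have G: "dd (\<lambda>y. GG y a) (x, p) (0, GG (x, p) b) \<bullet> e =
     (A * (A * s + 2 * (s * s) * V) / (2 * s)) * (p \<bullet> b) * gf c x e a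
     + v1 * (A * s + 2 * (s * s) * V) * (p \<bullet> b) * ((p \<bullet> a) * (p \<bullet> e))
     + V * ((A * s * gf c x a b + V * (p \<bullet> b) * (p \<bullet> a)) * (p \<bullet> e)
          + (p \<bullet> a) * (A * s * gf c x e b + V * (p \<bullet> b) * (p \<bullet> e)))" for a b
    unfolding D fst_conv snd_conv E G_op_inner s_def[symmetric] V_def[symmetric]
    using linear_0[OF linear_dd[OF gf_differentiable[OF c x]]] by (simp add: linear_0[OF linear_chr(2)])
  \<comment> \<open>The factor \<open>A \<surd>t v\<close> cancels below against the derivative of \<open>p\<^sub>i p\<^sub>j\<close>.\<close>
  have coeff: "A * (A * s + 2 * (s * s) * V) / (2 * s) = A\<^sup>2 / 2 + A * s * V"
    using s(1) by (simp add: field_simps power2_eq_square)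
  show ?thesis
    unfolding B.curvature_part_def inner_diff_left inner_add_left K G coeff
    using gf_sym[OF c x, of e a] gf_sym[OF c x, of e a'] gf_sym[OF c x, of a a']
    by (simp add: curv_def inner_diff_right inner_add_right algebra_simps)
qed

section \<open>Integrability and curvature\<close>

lemma nijenhuis_zero_at_iff:
  assumes x: "x \<in> ch c" and p: "p \<noteq> 0"
  shows "(\<forall>u u'. pointwise_nijenhuis (J_comp \<C> g A v c) (x, p) u u' = 0) \<longleftrightarrow>
    (\<forall>a b e. p \<bullet> (Rm c x a b e - (A\<^sup>2 / 2) *\<^sub>R (gf c x b e *\<^sub>R a - gf c x a e *\<^sub>R b)) = 0)"
proof -
  have z: "(x, p) \<in> bundle_image" using x p by simp
  have surj: "\<exists>a. b = GG (x, p) a" for b using B.GH[OF z] by metis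
  have "pointwise_nijenhuis (J_comp \<C> g A v c) (x, p) (0, GG (x, p) a) (0, GG (x, p) b) =
      (0, B.curvature_part (x, p) a b)" for a b
    unfolding B.nijenhuis_vertical[OF z] torsion_part_zero[OF x p]
    by (simp add: linear_0[OF linear_H_op] linear_0[OF linear_K_op])
  then have "(\<forall>u u'. pointwise_nijenhuis (J_comp \<C> g A v c) (x, p) u u' = 0) \<longleftrightarrow>
      (\<forall>a b. B.curvature_part (x, p) a b = 0)"
    unfolding B.nijenhuis_zero_iff[OF z] using surj by (metis prod.inject zero_prod_def)
  also have "\<dots> \<longleftrightarrow> (\<forall>a b e. B.curvature_part (x, p) a b \<bullet> e = 0)"
    by (metis inner_eq_zero_iff inner_zero_left)
  finally show ?thesis by (simp only: curvature_part_eq[OF x p])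
qed

lemma nijenhuis_in_chart:
  assumes P: "P \<in> fst (ic c)"
    and X: "(\<lambda>z. X (chart_inv (ic c) z) (ic c)) differentiable (at (snd (ic c) P))"
    and Y: "(\<lambda>z. Y (chart_inv (ic c) z) (ic c)) differentiable (at (snd (ic c) P))"
  shows "nijenhuis \<D> (J_structure \<C> g A v) X Y P (ic c) =
    pointwise_nijenhuis (J_comp \<C> g A v c) (snd (ic c) P) (X P (ic c)) (Y P (ic c))"
proof -
  let ?z = "snd (ic c) P"
  have z: "?z \<in> bundle_image" using P induced_image[OF c] by blast
  have inv: "chart_inv (ic c) ?z = P"
    using inv_into_f_f[OF inj_induced_chart[OF c] P] by (simp add: chart_inv_def)
  have at: "ic c \<in> charts_at \<D> Q" if "Q \<in> fst (ic c)" for Q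
    using that c by (simp add: charts_at_def cotangent_atlas0_def)
  have J: "J_structure \<C> g A v Q \<xi> (ic c) = J_comp \<C> g A v c (snd (ic c) Q) (\<xi> (ic c))" if "Q \<in> fst (ic c)" for Q \<xi>
    using at[OF that] c by (simp add: J_structure_def)
  have JX: "dd (\<lambda>z. J_structure \<C> g A v (chart_inv (ic c) z) (X (chart_inv (ic c) z)) (ic c)) ?z
     = dd (\<lambda>z. J_comp \<C> g A v c z (X (chart_inv (ic c) z) (ic c))) ?z" for X
  proof (rule dd_cong[OF open_bundle_image z])
    fix y assume "y \<in> bundle_image"
    then have "y \<in> snd (ic c) ` fst (ic c)" using induced_image[OF c] by simp
    then show "J_structure \<C> g A v (chart_inv (ic c) y) (X (chart_inv (ic c) y)) (ic c)
      = J_comp \<C> g A v c y (X (chart_inv (ic c) y) (ic c))"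
      using chart_inv_image[of y "ic c" "fst (ic c)"] by (simp add: J)
  qed
  show ?thesis
    using B.field_nijenhuis[OF z X Y]
    by (simp add: nijenhuis_def Let_def lie_bracket_def at[OF P] J[OF P] JX inv)
qed

end

text \<open>One direction evaluates the Nijenhuis tensor on vertical test fields at suitable covectors; in the
other one the tensor vanishes at every point of every induced chart.\<close>

lemma integrable_iff_constant_curvature_form:
  "integrable_structure \<D> (J_structure \<C> g A v) \<longleftrightarrow> constant_curvature_form (A\<^sup>2 / 2)"
proof
  assume I: "integrable_structure \<D> (J_structure \<C> g A v)"
  show "constant_curvature_form (A\<^sup>2 / 2)"
    unfolding constant_curvature_form_def
  proof (intro ballI allI, rule ccontr)
    fix c x a b e assume c: "c \<in> \<C>" and x: "x \<in> ch c"
    assume ne: "Rm c x a b e \<noteq> (A\<^sup>2 / 2) *\<^sub>R (gf c x b e *\<^sub>R a - gf c x a e *\<^sub>R b)"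
    \<comment> \<open>The deviation from constant curvature itself, in components, serves as the momentum, so that its square norm must vanish.\<close>
    define p where "p = Rm c x a b e - (A\<^sup>2 / 2) *\<^sub>R (gf c x b e *\<^sub>R a - gf c x a e *\<^sub>R b)"
    have p: "p \<noteq> 0" using ne by (simp add: p_def)
    have z: "(x, p) \<in> ch c \<times> (- {0})" using x p by simp
    obtain P where P: "P \<in> fst (ic c)" "snd (ic c) P = (x, p)"
      using z induced_image[OF c] by (metis (no_types, lifting) imageE)
    have cP: "c \<in> charts_at \<C> (fst P)" using P c by (simp add: charts_at_def induced_chart_simps(1))
    have vert: "vertical_field c u P (ic c) = (0, u)" for u
      by (simp add: vertical_field_apply[OF c P(1)] codiff_self[OF cP])
    have diff: "(\<lambda>z. vertical_field c u (chart_inv (ic c) z) (ic c)) differentiable (at (snd (ic c) P))" for u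
      using smooth_vertical_field[OF c, of u] c P(1)
      unfolding smooth_vector_field_on_def cotangent_atlas0_def
      by (auto intro: smooth_on_differentiable)
    have "nijenhuis \<D> (J_structure \<C> g A v) (vertical_field c u) (vertical_field c u') P = (\<lambda>_. 0)" for u u'
      using I openin_induced_domain[OF c] smooth_vertical_field[OF c] P(1)
      unfolding integrable_structure_def by blast
    then have V: "pointwise_nijenhuis (J_comp \<C> g A v c) (x, p) (0, u) (0, u') = 0" for u u'
      using nijenhuis_in_chart[OF c P(1), of "vertical_field c u" "vertical_field c u'", OF diff diff] by (simp add: vert P(2))
    then have "\<forall>u u'. pointwise_nijenhuis (J_comp \<C> g A v c) (x, p) u u' = 0"
      using block_structure.nijenhuis_zero_iff[OF block[OF c] z] by blast
    then have "p \<bullet> p = 0"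
      unfolding nijenhuis_zero_at_iff[OF c x p] by (metis p_def)
    with p show False by simp
  qed
next
  assume K: "constant_curvature_form (A\<^sup>2 / 2)"
  show "integrable_structure \<D> (J_structure \<C> g A v)"
    unfolding integrable_structure_def
  proof (intro allI impI ballI ext)
    fix U X Y P D
    assume X: "smooth_vector_field_on \<D> U X" and Y: "smooth_vector_field_on \<D> U Y" and P: "P \<in> U"
    show "nijenhuis \<D> (J_structure \<C> g A v) X Y P D = 0"
    proof (cases "D \<in> charts_at \<D> P")
      case True
      obtain c where c: "c \<in> charts_at \<C> (fst P)" "D = ic c" "P \<in> fst (ic c)"
        using charts_at_induced[OF True] by metis
      have cC: "c \<in> \<C>" using c(1) by (simp add: charts_at_def)
      obtain x p where xp: "snd (ic c) P = (x, p)" "x \<in> ch c" "p \<noteq> 0"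
      proof -
        have "snd (ic c) P \<in> ch c \<times> (- {0})"
          using imageI[OF c(3), of "snd (ic c)"] unfolding induced_image[OF cC] .
        then show thesis using that by (cases "snd (ic c) P") simp
      qed
      have D: "D \<in> \<D>" "P \<in> U \<inter> fst D" using True P by (auto simp: charts_at_def)
      have diff: "(\<lambda>z. X (chart_inv (ic c) z) (ic c)) differentiable (at (snd (ic c) P))"
        if "smooth_vector_field_on \<D> U X" for X
        using that D unfolding smooth_vector_field_on_def c(2) by (auto intro: smooth_on_differentiable)
      have "\<forall>a b e. p \<bullet> (Rm c x a b e - (A\<^sup>2 / 2) *\<^sub>R (gf c x b e *\<^sub>R a - gf c x a e *\<^sub>R b)) = 0"
      proof (intro allI)
        fix a b e
        have "Rm c x a b e = (A\<^sup>2 / 2) *\<^sub>R (gf c x b e *\<^sub>R a - gf c x a e *\<^sub>R b)"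
          using K cC xp(2) unfolding constant_curvature_form_def by blast
        then show "p \<bullet> (Rm c x a b e - (A\<^sup>2 / 2) *\<^sub>R (gf c x b e *\<^sub>R a - gf c x a e *\<^sub>R b)) = 0" by simp
      qed
      then have "pointwise_nijenhuis (J_comp \<C> g A v c) (x, p) u u' = 0" for u u'
        using nijenhuis_zero_at_iff[OF cC xp(2,3)] by blast
      then show ?thesis
        unfolding c(2) nijenhuis_in_chart[OF cC c(3), of X Y, OF diff[OF X] diff[OF Y]] xp(1) by simp
    next
      case False
      then show ?thesis by (simp add: nijenhuis_def Let_def lie_bracket_def J_structure_def)
    qed
  qed
qed

end

theorem theorem3:
  fixes \<C> :: "('m, real^'n) chart set"
    and g :: "('m, 'n) metric"
    and A :: real
    and v :: "real \<Rightarrow> real"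
  assumes "smooth_manifold \<C>"
    and "riemannian_metric \<C> g"
    and "smooth_on v {0<..}"
    and "A > 0"
    and "\<forall>t>0. v t > - A / (2 * sqrt t)"
  shows "integrable_structure (cotangent_atlas0 \<C>) (J_structure \<C> g A v) \<longleftrightarrow>
         (\<exists>\<kappa>>0. constant_sectional_curvature \<C> g \<kappa> \<and> A = sqrt (2 * \<kappa>))"
proof -
  interpret cot_structure \<C> g A v
    using assms by unfold_locales (auto simp: smooth_manifold_def)
  have "(\<exists>\<kappa>>0. constant_sectional_curvature \<C> g \<kappa> \<and> A = sqrt (2 * \<kappa>)) \<longleftrightarrow>
      constant_sectional_curvature \<C> g (A\<^sup>2 / 2)"
  proof
    assume "\<exists>\<kappa>>0. constant_sectional_curvature \<C> g \<kappa> \<and> A = sqrt (2 * \<kappa>)"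
    then obtain \<kappa> where "\<kappa> > 0" "constant_sectional_curvature \<C> g \<kappa>" "A = sqrt (2 * \<kappa>)" by blast
    then show "constant_sectional_curvature \<C> g (A\<^sup>2 / 2)" by simp
  next
    assume "constant_sectional_curvature \<C> g (A\<^sup>2 / 2)"
    then show "\<exists>\<kappa>>0. constant_sectional_curvature \<C> g \<kappa> \<and> A = sqrt (2 * \<kappa>)"
      using assms(4) by (intro exI[of _ "A\<^sup>2 / 2"]) simp
  qed
  then show ?thesis
    using integrable_iff_constant_curvature_form constant_curvature_form_iff by blast
qed

end
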